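(* Let $n\ge 1$ be an integer, $0<\gamma<n$, $1<p\le\alpha<s\le\infty$ and $\mu\in\Delta_2$. Let $(w,\nu)$ be a pair of weights such that for some $r>1$ and some constant $C_0<\infty$, for all cubes $Q$ in $\mathbb R^n$, $$|Q|^{\gamma/n}\cdot\left(\frac{1}{|Q|}\int_Q w(x)^r\,dx\right)^{1/(rp)}\left(\frac{1}{|Q|}\int_Q \nu(x)^{-p'/p}\,dx\right)^{1/p'}\le C_0 .$$ If $w\in\Delta_2$, then the fractional integral operator $I_\gamma$ is bounded from $(L^p,L^s)^{\alpha}(\nu,w;\mu)$ into $(WL^p,L^s)^{\alpha}(w;\mu)$; that is, there is a constant $C>0$ independent of $f$ such that $\|I_\gamma f\|_{(WL^p,L^s)^{\alpha}(w;\mu)}\le C\|f\|_{(L^p,L^s)^{\alpha}(\nu,w;\mu)}$ for all $f\in(L^p,L^s)^{\alpha}(\nu,w;\mu)$.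
   Context: A weight is a non-negative locally integrable function on $\mathbb R^n$; for a weight $w$ and measurable $E$, $w(E)=\int_E w(x)\,dx$. $B(y,r)$ is the open Euclidean ball with center $y$ and radius $r$; $p'=p/(p-1)$. All cubes have sides parallel to the coordinate axes. Fractional integral operator: $I_\gamma f(x)=\frac{1}{\zeta(\gamma)}\int_{\mathbb R^n}\frac{f(y)}{|x-y|^{n-\gamma}}\,dy$, with $\zeta(\gamma)=\frac{\pi^{n/2}2^\gamma\Gamma(\gamma/2)}{\Gamma((n-\gamma)/2)}$. A weight $\mu$ is in $\Delta_2$ if there is $C>0$ with $\mu(2B)\le C\mu(B)$ for every ball $B$ ($2B$ is the concentric ball with twice the radius). Weighted amalgam spaces: for $1\le p\le\alpha\le s\le\infty$ and weights $\nu,w,\mu$, the space $(L^p,L^s)^{\alpha}(\nu,w;\mu)$ consists of all locally integrable $f$ with $$\|f\|_{(L^p,L^s)^{\alpha}(\nu,w;\mu)}:=\sup_{r>0}\Big\|w(B(y,r))^{1/\alpha-1/p-1/s}\,\|f\chi_{B(y,r)}\|_{L^p(\nu)}\Big\|_{L^s(\mu)}<\infty,$$ where the $L^s(\mu)$-norm (norm with respect to $\mu(y)\,dy$, usual modification when $s=\infty$) is taken in $y$, and $\|g\|_{L^p(\nu)}=(\int|g|^p\nu\,dx)^{1/p}$. The weak space $(WL^p,L^s)^{\alpha}(w;\mu)$ consists of all measurable $f$ with $$\|f\|_{(WL^p,L^s)^{\alpha}(w;\mu)}:=\sup_{r>0}\Big\|w(B(y,r))^{1/\alpha-1/p-1/s}\,\|f\chi_{B(y,r)}\|_{WL^p(w)}\Big\|_{L^s(\mu)}<\infty,$$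 where $\|g\|_{WL^p(w)}=\sup_{\lambda>0}\lambda\,[w(\{x:|g(x)|>\lambda\})]^{1/p}$. By convention these notions may equivalently be defined with cubes $Q(y,\ell)$ (center $y$, side length $\ell$) in place of balls $B(y,r)$. *)

theory Defs
  imports "HOL-Analysis.Analysis" "HOL-Probability.Essential_Supremum"
begin

text \<open>Powers \<open>x\<^sup>a\<close> of extended non-negative numbers with real exponent, with the conventions
  \<open>x\<^sup>0 = 1\<close>, \<open>0\<^sup>a = \<infinity>\<close> and \<open>\<infinity>\<^sup>a = 0\<close> for \<open>a < 0\<close>, and \<open>0\<^sup>a = 0\<close> and \<open>\<infinity>\<^sup>a = \<infinity>\<close> for \<open>a > 0\<close>.
  (For real \<open>powr\<close> one would have \<open>0 powr a = 0\<close> for every \<open>a\<close>.)\<close>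

definition epowr :: "ennreal \<Rightarrow> real \<Rightarrow> ennreal" (infixr \<open>epowr\<close> 80) where
  "x epowr a =
     (if a = 0 then 1
      else if x = 0 then (if a < 0 then \<infinity> else 0)
      else if x = \<infinity> then (if a < 0 then 0 else \<infinity>)
      else ennreal (enn2real x powr a))"

definition locally_integrable :: "('a::euclidean_space \<Rightarrow> 'b::euclidean_space) \<Rightarrow> bool" where
  "locally_integrable f \<longleftrightarrow> (\<forall>K. compact K \<longrightarrow> f absolutely_integrable_on K)"

definition weight :: "('a::euclidean_space \<Rightarrow> real) \<Rightarrow> bool" where
  "weight w \<longleftrightarrow> (\<forall>x. 0 \<le> w x) \<and> locally_integrable w"

definition wmeasure :: "('a::euclidean_space \<Rightarrow> real) \<Rightarrow> 'a measure" where
  "wmeasure w = density lebesgue (\<lambda>x. ennreal (w x))"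

definition Delta2 :: "('a::euclidean_space \<Rightarrow> real) \<Rightarrow> bool" where
  "Delta2 w \<longleftrightarrow> weight w \<and>
     (\<exists>C::real. C > 0 \<and> (\<forall>y r. r > 0 \<longrightarrow>
        emeasure (wmeasure w) (ball y (2 * r)) \<le> ennreal C * emeasure (wmeasure w) (ball y r)))"

text \<open>The cube with lower corner \<open>a\<close> and side length \<open>l\<close>.\<close>

definition cube :: "real ^ 'n \<Rightarrow> real \<Rightarrow> (real ^ 'n) set" where
  "cube a l = cbox a (\<chi> i. a $ i + l)"

definition avg :: "'a::euclidean_space set \<Rightarrow> ('a \<Rightarrow> ennreal) \<Rightarrow> ennreal" where
  "avg Q g = (\<integral>\<^sup>+x\<in>Q. g x \<partial>lebesgue) / emeasure lebesgue Q"

definition conj_exp :: "real \<Rightarrow> real" where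
  "conj_exp p = p / (p - 1)"

definition Lp_norm :: "ennreal \<Rightarrow> 'a measure \<Rightarrow> ('a \<Rightarrow> ennreal) \<Rightarrow> ennreal" where
  "Lp_norm s M F =
     (if s = \<infinity> then esssup M F
      else (\<integral>\<^sup>+x. F x epowr enn2real s \<partial>M) epowr (1 / enn2real s))"

definition weak_Lp_norm :: "real \<Rightarrow> 'a measure \<Rightarrow> ('a \<Rightarrow> complex) \<Rightarrow> ennreal" where
  "weak_Lp_norm p M g =
     (SUP t\<in>{0<..}. ennreal t * emeasure M {x \<in> space M. norm (g x) > t} epowr (1 / p))"

text \<open>The exponent \<open>1/\<alpha> - 1/p - 1/s\<close>, where \<open>1/s = 0\<close> for \<open>s = \<infinity>\<close>.\<close>

definition amalgam_exp :: "real \<Rightarrow> ennreal \<Rightarrow> real \<Rightarrow> real" where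
  "amalgam_exp p s \<alpha> = 1 / \<alpha> - 1 / p - enn2real (inverse s)"

definition amalgam_norm ::
  "real \<Rightarrow> ennreal \<Rightarrow> real \<Rightarrow> ('a::euclidean_space \<Rightarrow> real) \<Rightarrow> ('a \<Rightarrow> real) \<Rightarrow> ('a \<Rightarrow> real)
     \<Rightarrow> ('a \<Rightarrow> complex) \<Rightarrow> ennreal" where
  "amalgam_norm p s \<alpha> \<nu> w \<mu> f =
     (SUP r\<in>{0<..}. Lp_norm s (wmeasure \<mu>) (\<lambda>y.
        emeasure (wmeasure w) (ball y r) epowr amalgam_exp p s \<alpha> *
        Lp_norm (ennreal p) (wmeasure \<nu>) (\<lambda>x. ennreal (norm (f x * indicator (ball y r) x)))))"

definition amalgam_space ::
  "real \<Rightarrow> ennreal \<Rightarrow> real \<Rightarrow> ('a::euclidean_space \<Rightarrow> real) \<Rightarrow> ('a \<Rightarrow> real) \<Rightarrow> ('a \<Rightarrow> real)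
     \<Rightarrow> ('a \<Rightarrow> complex) set" where
  "amalgam_space p s \<alpha> \<nu> w \<mu> = {f. locally_integrable f \<and> amalgam_norm p s \<alpha> \<nu> w \<mu> f < \<infinity>}"

definition weak_amalgam_norm ::
  "real \<Rightarrow> ennreal \<Rightarrow> real \<Rightarrow> ('a::euclidean_space \<Rightarrow> real) \<Rightarrow> ('a \<Rightarrow> real)
     \<Rightarrow> ('a \<Rightarrow> complex) \<Rightarrow> ennreal" where
  "weak_amalgam_norm p s \<alpha> w \<mu> f =
     (SUP r\<in>{0<..}. Lp_norm s (wmeasure \<mu>) (\<lambda>y.
        emeasure (wmeasure w) (ball y r) epowr amalgam_exp p s \<alpha> *
        weak_Lp_norm p (wmeasure w) (\<lambda>x. f x * indicator (ball y r) x)))"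

definition weak_amalgam_space ::
  "real \<Rightarrow> ennreal \<Rightarrow> real \<Rightarrow> ('a::euclidean_space \<Rightarrow> real) \<Rightarrow> ('a \<Rightarrow> real)
     \<Rightarrow> ('a \<Rightarrow> complex) set" where
  "weak_amalgam_space p s \<alpha> w \<mu> =
     {f. f \<in> borel_measurable lebesgue \<and> weak_amalgam_norm p s \<alpha> w \<mu> f < \<infinity>}"

definition riesz_zeta :: "real \<Rightarrow> real \<Rightarrow> real" where
  "riesz_zeta n \<gamma> = pi powr (n / 2) * 2 powr \<gamma> * Gamma (\<gamma> / 2) / Gamma ((n - \<gamma>) / 2)"

definition riesz_integrand :: "real \<Rightarrow> (real ^ 'n \<Rightarrow> complex) \<Rightarrow> real ^ 'n \<Rightarrow> real ^ 'n \<Rightarrow> complex" where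
  "riesz_integrand \<gamma> f x y = f y / of_real (norm (x - y) powr (real CARD('n) - \<gamma>))"

text \<open>Pitfall: the Bochner integral is \<open>0\<close> at points \<open>x\<close> where the integrand is not integrable, so
  statements about \<open>frac_integral\<close> have to address convergence separately.\<close>

definition frac_integral :: "real \<Rightarrow> (real ^ 'n \<Rightarrow> complex) \<Rightarrow> real ^ 'n \<Rightarrow> complex" where
  "frac_integral \<gamma> f x =
     of_real (1 / riesz_zeta (real CARD('n)) \<gamma>) * (\<integral>y. riesz_integrand \<gamma> f x y \<partial>lebesgue)"

definition null_weight :: "('a::euclidean_space \<Rightarrow> real) \<Rightarrow> bool" where
  "null_weight w \<longleftrightarrow> (AE x in lebesgue. w x = 0)"

end

theory Submission
  imports Defs
begin

text \<open>The part of \<open>f\<close> outside \<open>B(y,2r)\<close> is summed over dyadic annuli: by Hoelder's inequality and the bump condition its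
  contribution on \<open>B(y,r)\<close> is at most \<open>\<Sum>\<^sub>k w(2\<^sup>kB)\<^sup>-\<^sup>1\<^sup>/\<^sup>p \<parallel>f \<chi>(2\<^sup>kB)\<parallel>\<close>, and reverse doubling of \<open>w\<close> turns this, after
  multiplication by \<open>w(B)\<^sup>1\<^sup>/\<^sup>\<alpha>\<^sup>-\<^sup>1\<^sup>/\<^sup>s\<close>, into a geometric series of the quantities whose \<open>L\<^sup>s(\<mu>)\<close> norms define the
  amalgam norm; convexity of \<open>t\<^sup>s\<close> replaces Minkowski's inequality.

  The part in \<open>B(y,2r)\<close> needs the two-weight weak type \<open>(p,p)\<close> bound for the fractional integral. The one-third
  trick dominates it by finitely many dyadic operators \<open>\<Sum>\<^sub>i F\<^sub>i\<close>, where
  \<open>F\<^sub>i(x) = l\<^sub>i\<^sup>\<gamma>\<^sup>-\<^sup>n \<integral>\<^sub>Q g\<close> over the cell \<open>Q\<close> of side \<open>l\<^sub>i = R/2\<^sup>i\<close> containing \<open>x\<close>. The generations \<open>i\<close> with \<open>\<lambda> < F\<^sub>i(x) \<le> 2\<lambda>\<close> can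
  spread over \<open>j\<close> scales only on a set that fills a fraction \<open>O(2\<^sup>-\<^sup>j\<^sup>\<gamma>)\<close> of the first such cell, since the averages
  of \<open>g\<close> grow like \<open>l\<^sub>i\<^sup>-\<^sup>\<gamma>\<close> along the chain. The exponent \<open>r > 1\<close> transfers this decay to \<open>w\<close>, and taking
  \<open>j\<close> proportional to \<open>m\<close> at the level \<open>\<lambda> = t/2\<^sup>m\<close> makes the exceptional sets summable in \<open>m\<close>.\<close>

section \<open>Powers and Hoelder's inequality for extended non-negative functions\<close>

text \<open>The sum of the dyadic operators is not controlled by its largest term:
  \<open>cell_potential\<close> may stay at one level through many generations, so a bound for the
  supremum over the generations, a fractional maximal function, does not suffice. Counting the
  generations on each level replaces that comparison; the level t/2^m can afford a multiple of m + 1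
  generations because the series of (m + 1)/2^m converges. The exponent e = 1/\<alpha> - 1/p - 1/s
  enters through two signs. Since e \<le> 0, doubling of w is needed to pass from w(B(y,\<rho>))^e
  to w(B(y,2\<rho>))^e; since e + 1/p = 1/\<alpha> - 1/s > 0, reverse doubling gives a geometric
  ratio below 1. Integrals are kept in \<open>ennreal\<close>, so estimates need no prior
  finiteness. The price is \<infinity> * 0 = 0, and this is why vanishing weights are singled out: a
  null w, cubes with w(Q) = 0, and points where \<nu> is 0.\<close>

lemma epowr_0 [simp]: "0 < a \<Longrightarrow> 0 epowr a = 0"
  by (simp add: epowr_def)

lemma epowr_1 [simp]: "x epowr 1 = x"
  by (auto simp: epowr_def less_top)

lemma one_epowr [simp]: "1 epowr a = 1"
  by (auto simp: epowr_def)

lemma epowr_ennreal: "0 < x \<or> (x = 0 \<and> 0 < a) \<Longrightarrow> ennreal x epowr a = ennreal (x powr a)"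
  by (auto simp: epowr_def)

lemma epowr_eq_0_iff: "0 < a \<Longrightarrow> x epowr a = 0 \<longleftrightarrow> x = 0"
  by (cases x) (auto simp: epowr_def ennreal_eq_0_iff)

lemma epowr_eq_top_iff: "0 < a \<Longrightarrow> x epowr a = \<infinity> \<longleftrightarrow> x = \<infinity>"
  by (cases x) (auto simp: epowr_def ennreal_eq_0_iff)

lemma epowr_mono:
  assumes "x \<le> y" "0 \<le> a"
  shows "x epowr a \<le> y epowr a"
proof (cases "a = 0 \<or> x = 0 \<or> y = \<infinity>")
  case True
  with assms show ?thesis by (auto simp: epowr_def)
next
  case False
  with assms obtain u v where "x = ennreal u" "y = ennreal v" "0 < u" "u \<le> v"
    by (cases x; cases y) (auto simp: less_le top_unique)
  with assms show ?thesis
    by (auto simp: epowr_ennreal intro!: ennreal_leI powr_mono2)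
qed

lemma epowr_antimono:
  assumes "x \<le> y" "a \<le> 0"
  shows "y epowr a \<le> x epowr a"
proof (cases "a = 0 \<or> x = 0 \<or> y = \<infinity>")
  case True
  with assms show ?thesis by (auto simp: epowr_def)
next
  case False
  with assms obtain u v where "x = ennreal u" "y = ennreal v" "0 < u" "u \<le> v"
    by (cases x; cases y) (auto simp: less_le top_unique)
  with assms show ?thesis
    by (auto simp: epowr_ennreal intro!: ennreal_leI powr_mono2')
qed

text \<open>The sign of \<open>a\<close> matters: for negative \<open>a\<close> the pair x = 0, y =
  \<infinity> gives \<infinity> on the left and \<infinity> * 0 = 0 on the right. Negative exponents
  are therefore restricted to positive finite arguments in \<open>epowr_mult_finite\<close>.\<close>

lemma epowr_mult:
  assumes "0 < a"
  shows "(x * y) epowr a = x epowr a * y epowr a"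
proof (cases "x = 0 \<or> y = 0 \<or> x = \<infinity> \<or> y = \<infinity>")
  case True
  with assms show ?thesis
    by (auto simp: epowr_eq_0_iff epowr_eq_top_iff epowr_def ennreal_mult_eq_top_iff
          ennreal_top_mult ennreal_mult_top enn2real_eq_0_iff)
next
  case False
  then obtain u v where "x = ennreal u" "y = ennreal v" "0 < u" "0 < v"
    by (cases x; cases y) (auto simp: less_le)
  then show ?thesis
    by (simp add: epowr_ennreal powr_mult flip: ennreal_mult)
qed

lemma epowr_mult_finite:
  assumes "x \<noteq> 0" "y \<noteq> 0" "x \<noteq> \<infinity>" "y \<noteq> \<infinity>"
  shows "(x * y) epowr a = x epowr a * y epowr a"
proof -
  from assms obtain u v where "x = ennreal u" "y = ennreal v" "0 < u" "0 < v"
    by (cases x; cases y) (auto simp: less_le)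
  then show ?thesis
    by (simp add: epowr_ennreal powr_mult flip: ennreal_mult)
qed

lemma epowr_epowr:
  assumes "0 < a" "0 < b"
  shows "(x epowr a) epowr b = x epowr (a * b)"
proof (cases "x = 0 \<or> x = \<infinity>")
  case True
  with assms show ?thesis by (auto simp: epowr_def mult_less_0_iff)
next
  case False
  then obtain u where "x = ennreal u" "0 < u" by (cases x) (auto simp: less_le)
  then show ?thesis by (simp add: epowr_ennreal powr_powr)
qed

lemma epowr_epowr_finite:
  assumes "x \<noteq> 0" "x \<noteq> \<infinity>"
  shows "(x epowr a) epowr b = x epowr (a * b)"
proof -
  from assms obtain u where "x = ennreal u" "0 < u" by (cases x) (auto simp: less_le)
  then show ?thesis by (simp add: epowr_ennreal powr_powr)
qed

lemma epowr_add:
  assumes "x \<noteq> 0" "x \<noteq> \<infinity>"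
  shows "x epowr (a + b) = x epowr a * x epowr b"
proof -
  from assms obtain u where "x = ennreal u" "0 < u" by (cases x) (auto simp: less_le)
  then show ?thesis by (simp add: epowr_ennreal powr_add flip: ennreal_mult)
qed

lemma epowr_add_nonneg:
  assumes "0 \<le> a" "0 \<le> b"
  shows "x epowr (a + b) = x epowr a * x epowr b"
proof (cases "x = 0 \<or> x = \<infinity>")
  case True
  with assms show ?thesis by (auto simp: epowr_def ennreal_top_mult)
next
  case False
  then show ?thesis by (intro epowr_add) auto
qed

lemma epowr_inverse_cancel [simp]: "0 < a \<Longrightarrow> (x epowr a) epowr (1 / a) = x"
  by (simp add: epowr_epowr)

lemma epowr_inverse_cancel' [simp]: "0 < a \<Longrightarrow> (x epowr (1 / a)) epowr a = x"
  by (simp add: epowr_epowr)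

lemma measurable_epowr [measurable (raw)]:
  assumes [measurable]: "f \<in> borel_measurable M"
  shows "(\<lambda>x. f x epowr a) \<in> borel_measurable M"
  unfolding epowr_def by measurable

text \<open>Young's inequality is integrated after dividing f and g by their norms. This needs both
  integrals positive and finite: a zero integral makes the product vanish almost everywhere, and
  otherwise an infinite one makes the right side infinite.\<close>

lemma Holder_inequality_nn_integral:
  assumes [measurable]: "f \<in> borel_measurable M" "g \<in> borel_measurable M"
    and p: "0 < p" and q: "0 < q" and pq: "1 / p + 1 / q = (1::real)"
  shows "(\<integral>\<^sup>+x. f x * g x \<partial>M)
    \<le> (\<integral>\<^sup>+x. f x epowr p \<partial>M) epowr (1 / p) * (\<integral>\<^sup>+x. g x epowr q \<partial>M) epowr (1 / q)"
    (is "_ \<le> ?A epowr _ * ?B epowr _")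
proof -
  have p1: "1 < p" and q1: "1 < q"
  proof -
    have "0 < 1 / p" "0 < 1 / q" using p q by auto
    then have "1 / p < 1" "1 / q < 1" using pq by linarith+
    then show "1 < p" "1 < q" using p q by auto
  qed
  consider "?A = 0 \<or> ?B = 0" | "?A \<noteq> 0" "?B \<noteq> 0" "?A = \<infinity> \<or> ?B = \<infinity>"
    | "?A \<noteq> 0" "?B \<noteq> 0" "?A \<noteq> \<infinity>" "?B \<noteq> \<infinity>" by blast
  then show ?thesis
  proof cases
    case 1
    then have "AE x in M. f x * g x = 0"
    proof
      assume "?A = 0"
      then have "AE x in M. f x epowr p = 0" by (subst (asm) nn_integral_0_iff_AE) auto
      then show ?thesis using p by (auto simp: epowr_eq_0_iff elim: eventually_mono)
    next
      assume "?B = 0"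
      then have "AE x in M. g x epowr q = 0" by (subst (asm) nn_integral_0_iff_AE) auto
      then show ?thesis using q by (auto simp: epowr_eq_0_iff elim: eventually_mono)
    qed
    then have "(\<integral>\<^sup>+x. f x * g x \<partial>M) = 0" by (subst nn_integral_0_iff_AE) auto
    then show ?thesis by simp
  next
    case 2
    then have "?A epowr (1 / p) * ?B epowr (1 / q) = \<infinity>"
      using p q by (auto simp: ennreal_mult_eq_top_iff epowr_eq_0_iff 
          epowr_eq_top_iff[unfolded infinity_ennreal_def])
    then show ?thesis by simp
  next
    case 3
    then obtain A B where AB: "?A = ennreal A" "?B = ennreal B" "0 < A" "0 < B"
      by (cases ?A; cases ?B) (auto simp: less_le)
    define a b where "a = A powr (1 / p)" and "b = B powr (1 / q)"
    have ab: "0 < a" "0 < b" "a powr p = A" "b powr q = B"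
      using AB p q by (auto simp: a_def b_def powr_powr)
    have young: "f x * g x \<le> ennreal (a * b) *
        (ennreal (1 / (p * A)) * f x epowr p + ennreal (1 / (q * B)) * g x epowr q)" for x
    proof (cases "f x = 0 \<or> g x = 0 \<or> f x = \<infinity> \<or> g x = \<infinity>")
      \<comment> \<open>The real Young inequality does not cover the values 0 and \<infinity>. A
        zero factor kills the product even against \<infinity>; if there is none, an infinite value
        makes the right side infinite, since all coefficients are positive.\<close>
      case True
      have "ennreal (a * b) \<noteq> 0" "ennreal (1 / (p * A)) \<noteq> 0" "ennreal (1 / (q * B)) \<noteq> 0"
        using ab AB p q by (auto simp: ennreal_eq_0_iff not_le intro!: mult_pos_pos divide_pos_pos)
      then have "f x * g x = 0 \<or> ennreal (a * b) *
        (ennreal (1 / (p * A)) * f x epowr p + ennreal (1 / (q * B)) * g x epowr q) = \<infinity>"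
        using True p q by (auto simp: epowr_def ennreal_mult_top ennreal_top_mult)
      then show ?thesis by auto
    next
      case False
      then obtain u v where uv: "f x = ennreal u" "g x = ennreal v" "0 < u" "0 < v"
        by (cases "f x"; cases "g x") (auto simp: less_le)
      have "(u / a) * (v / b) \<le> (u / a) powr p / p + (v / b) powr q / q"
        using uv ab p1 q1 pq by (intro Youngs_inequality) auto
      also have "\<dots> = 1 / (p * A) * u powr p + 1 / (q * B) * v powr q"
        using uv ab by (simp add: powr_divide mult.commute)
      finally have "(a * b) * ((u / a) * (v / b))
          \<le> (a * b) * (1 / (p * A) * u powr p + 1 / (q * B) * v powr q)"
        using ab by (intro mult_left_mono) auto
      then have "u * v \<le> (a * b) * (1 / (p * A) * u powr p + 1 / (q * B) * v powr q)"
        using ab by simp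
      then show ?thesis using uv ab AB p q
        by (simp add: epowr_ennreal flip: ennreal_mult ennreal_plus)
    qed
    have "(\<integral>\<^sup>+x. f x * g x \<partial>M) \<le> (\<integral>\<^sup>+x. ennreal (a * b) *
        (ennreal (1 / (p * A)) * f x epowr p + ennreal (1 / (q * B)) * g x epowr q) \<partial>M)"
      by (intro nn_integral_mono young)
    also have "\<dots> = ennreal (a * b) * (ennreal (1 / (p * A)) * ?A + ennreal (1 / (q * B)) * ?B)"
      by (simp add: nn_integral_cmult nn_integral_add)
    also have "\<dots> = ennreal (a * b) * ennreal (1 / p + 1 / q)"
      using AB p q by (simp flip: ennreal_mult ennreal_plus)
    also have "\<dots> = ennreal a * ennreal b"
      using ab pq by (simp add: ennreal_mult)
    also have "\<dots> = ?A epowr (1 / p) * ?B epowr (1 / q)"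
      using AB by (simp add: epowr_ennreal a_def b_def)
    finally show ?thesis .
  qed
qed

text \<open>Hoelder's inequality against the constant function 1 for the measure on the naturals
  with point masses \<open>c k\<close>; this is Jensen's inequality for t^s without normalising the
  masses.\<close>

lemma sum_epowr_le:
  fixes c G :: "nat \<Rightarrow> ennreal"
  assumes s: "1 < s"
  shows "(\<Sum>k. c k * G k) epowr s \<le> (\<Sum>k. c k) epowr (s - 1) * (\<Sum>k. c k * G k epowr s)"
proof -
  define M where "M = density (count_space UNIV) c"
  define q where "q = s / (s - 1)"
  have q: "0 < q" "1 / q + 1 / s = 1" "1 / q * s = s - 1"
    using s by (auto simp: q_def field_simps)
  have I: "(\<integral>\<^sup>+k. h k \<partial>M) = (\<Sum>k. c k * h k)" for h
    unfolding M_def by (subst nn_integral_density) (auto simp: nn_integral_count_space_nat)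
  have "(\<integral>\<^sup>+k. 1 * G k \<partial>M)
      \<le> (\<integral>\<^sup>+k. 1 epowr q \<partial>M) epowr (1 / q) * (\<integral>\<^sup>+k. G k epowr s \<partial>M) epowr (1 / s)"
    using s q by (intro Holder_inequality_nn_integral) (auto simp: M_def)
  then have "(\<Sum>k. c k * G k) \<le> (\<Sum>k. c k) epowr (1 / q) * (\<Sum>k. c k * G k epowr s) epowr (1 / s)"
    unfolding I by simp
  then have "(\<Sum>k. c k * G k) epowr s
      \<le> ((\<Sum>k. c k) epowr (1 / q) * (\<Sum>k. c k * G k epowr s) epowr (1 / s)) epowr s"
    using s by (intro epowr_mono) auto
  also have "\<dots> = (\<Sum>k. c k) epowr (s - 1) * (\<Sum>k. c k * G k epowr s)"
    using s q by (simp add: epowr_mult epowr_epowr)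
  finally show ?thesis .
qed

text \<open>Stands in for the triangle inequality when all G k share one bound. For finite s the
  convexity bound is integrated termwise; the power s - 1 of the sum of the \<open>c k\<close> and
  the remaining first power recombine to the power s.\<close>

lemma Lp_norm_series_le:
  fixes s :: ennreal
  assumes s: "1 < s" and [measurable]: "F \<in> borel_measurable M" "\<And>k. G k \<in> borel_measurable M"
    and F: "\<And>x. F x \<le> (\<Sum>k. c k * G k x)" and G: "\<And>k. Lp_norm s M (G k) \<le> A"
  shows "Lp_norm s M F \<le> (\<Sum>k. c k) * A"
proof (cases "s = \<infinity>")
  case True
  have "AE x in M. \<forall>k. G k x \<le> A"
    unfolding AE_all_countable
  proof
    fix k
    show "AE x in M. G k x \<le> A"
      using esssup_AE[of "G k" M] G[of k] True by (auto simp: Lp_norm_def elim: eventually_mono)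
  qed
  then have "AE x in M. F x \<le> (\<Sum>k. c k) * A"
  proof eventually_elim
    case (elim x)
    have "F x \<le> (\<Sum>k. c k * A)"
      using elim by (intro order_trans[OF F] suminf_le mult_left_mono) auto
    then show ?case by simp
  qed
  then show ?thesis using True by (auto simp: Lp_norm_def)
next
  case False
  define \<sigma> where "\<sigma> = enn2real s"
  have \<sigma>: "1 < \<sigma>" using s False unfolding \<sigma>_def
    by (metis enn2real_1 enn2real_less_iff ennreal_1 ennreal_enn2real ennreal_less_iff
        infinity_ennreal_def less_top zero_le_one)
  have N: "Lp_norm s M h = (\<integral>\<^sup>+x. h x epowr \<sigma> \<partial>M) epowr (1 / \<sigma>)" for h
    using False by (simp add: Lp_norm_def \<sigma>_def)
  have GA: "(\<integral>\<^sup>+x. G k x epowr \<sigma> \<partial>M) \<le> A epowr \<sigma>" for k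
    using epowr_mono[OF G[of k], of \<sigma>] \<sigma> by (simp add: N)
  have "(\<integral>\<^sup>+x. F x epowr \<sigma> \<partial>M)
      \<le> (\<integral>\<^sup>+x. (\<Sum>k. c k) epowr (\<sigma> - 1) * (\<Sum>k. c k * G k x epowr \<sigma>) \<partial>M)"
    using \<sigma> by (intro nn_integral_mono order_trans[OF epowr_mono[OF F] sum_epowr_le]) auto
  also have "\<dots> = (\<Sum>k. c k) epowr (\<sigma> - 1) * (\<Sum>k. c k * (\<integral>\<^sup>+x. G k x epowr \<sigma> \<partial>M))"
    by (simp add: nn_integral_cmult nn_integral_suminf)
  also have "\<dots> \<le> (\<Sum>k. c k) epowr (\<sigma> - 1) * (\<Sum>k. c k * A epowr \<sigma>)"
    by (intro mult_left_mono suminf_le GA) auto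
  also have "\<dots> = (\<Sum>k. c k) epowr (\<sigma> - 1) * (\<Sum>k. c k) epowr 1 * A epowr \<sigma>"
    by (simp add: mult.assoc)
  also have "\<dots> = ((\<Sum>k. c k) * A) epowr \<sigma>"
    using \<sigma> by (subst epowr_add_nonneg[symmetric]) (auto simp: epowr_mult)
  finally have "(\<integral>\<^sup>+x. F x epowr \<sigma> \<partial>M) epowr (1 / \<sigma>) \<le> (((\<Sum>k. c k) * A) epowr \<sigma>) epowr (1 / \<sigma>)"
    using \<sigma> by (intro epowr_mono) auto
  then show ?thesis using \<sigma> by (simp add: N)
qed

section \<open>Dyadic cells\<close>

text \<open>Turns estimates on the single stopping cells into one on their union. The constants
  multiply the measures on both sides, which avoids division in \<open>ennreal\<close>.\<close>

lemma emeasure_disjoint_cover_le: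
  assumes P: "countable P" "disjoint P" "\<And>A. A \<in> P \<Longrightarrow> A \<in> sets M"
    and N: "sets N = sets M" and D: "D \<in> sets M" "D \<subseteq> \<Union>P"
    and le: "\<And>A. A \<in> P \<Longrightarrow> a * emeasure M (D \<inter> A) \<le> c * emeasure N A"
  shows "a * emeasure M D \<le> c * emeasure N (\<Union>P)"
proof -
  have "emeasure M D = emeasure M (\<Union>A\<in>P. D \<inter> A)"
    using D(2) by (intro arg_cong2[where f=emeasure]) auto
  also have "\<dots> = (\<integral>\<^sup>+A. emeasure M (D \<inter> A) \<partial>count_space P)"
    using P D by (intro emeasure_UN_countable) (auto simp: disjoint_family_on_def disjoint_def)
  finally have "a * emeasure M D = (\<integral>\<^sup>+A. a * emeasure M (D \<inter> A) \<partial>count_space P)"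
    by (simp add: nn_integral_cmult)
  also have "\<dots> \<le> (\<integral>\<^sup>+A. c * emeasure N A \<partial>count_space P)"
    by (intro nn_integral_mono le) simp
  also have "\<dots> = c * (\<integral>\<^sup>+A. emeasure N A \<partial>count_space P)"
    by (simp add: nn_integral_cmult)
  also have "(\<integral>\<^sup>+A. emeasure N A \<partial>count_space P) = emeasure N (\<Union>A\<in>P. A)"
    using P N by (intro emeasure_UN_countable[symmetric]) (auto simp: disjoint_family_on_def disjoint_def)
  finally show ?thesis by simp
qed

lemma emeasure_cube:
  fixes a :: "real ^ 'n"
  assumes "0 \<le> l"
  shows "emeasure lebesgue (cube a l) = ennreal (l ^ CARD('n))"
proof -
  have "emeasure lborel (cube a l) = (\<Prod>b\<in>Basis. ((\<chi> i. a $ i + l) - a) \<bullet> b)"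
    unfolding cube_def
    by (intro emeasure_lborel_cbox) (use assms in \<open>auto simp: Basis_vec_def inner_axis\<close>)
  also have "(\<Prod>b\<in>Basis. ((\<chi> i. a $ i + l) - a) \<bullet> b) = (\<Prod>b\<in>(Basis::(real^'n) set). l)"
    by (intro prod.cong refl) (auto simp: Basis_vec_def inner_axis)
  finally show ?thesis by (simp add: cube_def)
qed

lemma emeasure_box_cube:
  fixes a :: "real ^ 'n"
  assumes "0 \<le> l"
  shows "emeasure lebesgue (box a (\<chi> i. a $ i + l)) = ennreal (l ^ CARD('n))"
proof -
  have "emeasure lborel (box a (\<chi> i. a $ i + l)) = emeasure lborel (cube a l)"
    unfolding cube_def emeasure_lborel_box_eq emeasure_lborel_cbox_eq ..
  then show ?thesis using emeasure_cube[OF assms, of a] by (simp add: cube_def)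
qed

text \<open>The grid has origin \<open>v\<close> and side R in generation 0, halved in each
  generation. With cells as fibres of this map, the partition property is immediate and nesting
  reduces to a statement about floors.\<close>

definition cell_index :: "real ^ 'n \<Rightarrow> real \<Rightarrow> nat \<Rightarrow> real ^ 'n \<Rightarrow> int ^ 'n" where
  "cell_index v R i x = (\<chi> c. \<lfloor>(x $ c - v $ c) * 2 ^ i / R\<rfloor>)"

definition cell :: "real ^ 'n \<Rightarrow> real \<Rightarrow> nat \<Rightarrow> real ^ 'n \<Rightarrow> (real ^ 'n) set" where
  "cell v R i x = {y. cell_index v R i y = cell_index v R i x}"

text \<open>The maximal cells on which H holds, provided H i is constant on the cells of generation
  i. Generations start at 0, so every point of some H i has a first such generation and hence a
  maximal cell.\<close>

definition stopping_cells :: "real ^ 'n \<Rightarrow> real \<Rightarrow> (nat \<Rightarrow> real ^ 'n \<Rightarrow> bool) \<Rightarrow> (real ^ 'n) set set" where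
  "stopping_cells v R H = {cell v R i x | i x. H i x \<and> (\<forall>k<i. \<not> H k x)}"

lemma cell_self [simp]: "x \<in> cell v R i x"
  by (simp add: cell_def)

lemma cell_eq: "y \<in> cell v R i x \<Longrightarrow> cell v R i y = cell v R i x"
  by (simp add: cell_def)

lemma cell_sym: "y \<in> cell v R i x \<longleftrightarrow> x \<in> cell v R i y"
  by (auto simp: cell_def)

lemma cell_Suc_subset: "cell v R (Suc i) x \<subseteq> cell v R i x"
proof
  fix y assume y: "y \<in> cell v R (Suc i) x"
  have half: "\<lfloor>u\<rfloor> = \<lfloor>2 * u\<rfloor> div 2" for u :: real
    by (rule floor_unique) linarith+
  have "\<lfloor>(z $ c - v $ c) * 2 ^ i / R\<rfloor> = cell_index v R (Suc i) z $ c div 2" for z c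
    by (subst half) (simp add: cell_index_def algebra_simps)
  then have "cell_index v R i z = (\<chi> c. cell_index v R (Suc i) z $ c div 2)" for z
    by (simp add: cell_index_def[of v R i])
  with y show "y \<in> cell v R i x" by (simp add: cell_def)
qed

lemma cell_antimono: "i \<le> j \<Longrightarrow> cell v R j x \<subseteq> cell v R i x"
  using lift_Suc_antimono_le[of "\<lambda>i. cell v R i x" i j, OF cell_Suc_subset] by simp

lemma countable_cells: "countable (range (cell v R i))"
proof -
  have "range (cell v R i) = (\<lambda>z. {y. cell_index v R i y = z}) ` range (cell_index v R i)"
    by (auto simp: cell_def)
  then show ?thesis by simp
qed

lemma cell_sets [measurable]: "cell v R i x \<in> sets lebesgue"
proof -
  have "cell v R i x = {y \<in> space borel. \<forall>c. \<lfloor>(y $ c - v $ c) * 2 ^ i / R\<rfloor> = cell_index v R i x $ c}"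
    by (auto simp: cell_def cell_index_def vec_eq_iff)
  also have "\<dots> \<in> sets borel"
    by measurable
  finally show ?thesis by (metis sets_completionI_sets sets_lborel)
qed

text \<open>Every preimage is a union of cells of one generation, and there are only countably many
  of these.\<close>

lemma measurable_cell_invariant:
  assumes "\<And>x y. y \<in> cell v R i x \<Longrightarrow> f y = f x"
  shows "f \<in> lebesgue \<rightarrow>\<^sub>M M \<longleftrightarrow> range f \<subseteq> space M"
proof
  assume *: "range f \<subseteq> space M"
  have "f -` A \<inter> space lebesgue \<in> sets lebesgue" for A
  proof -
    have "f -` A \<inter> space lebesgue = \<Union>(cell v R i ` (f -` A))"
      using assms by auto
    moreover have "countable (cell v R i ` (f -` A))"
      by (rule countable_subset[OF _ countable_cells[of v R i]]) auto
    moreover have "\<Union>(cell v R i ` (f -` A)) \<in> sets lebesgue"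
      using calculation by (intro sets.countable_Union) (auto simp: cell_sets)
    ultimately show ?thesis by simp
  qed
  then show "f \<in> lebesgue \<rightarrow>\<^sub>M M" using * by (auto simp: measurable_def)
qed (auto simp: measurable_def)

text \<open>Cells are half-open, whereas volumes are known for boxes and the bump condition is given
  for closed cubes. The sandwich gives the volume of a cell and a closed cube of the same side
  around it.\<close>

lemma cell_box_bounds:
  fixes v x :: "real ^ 'n"
  assumes R: "0 < R"
  obtains a where "cell v R i x \<subseteq> cube a (R / 2 ^ i)" "box a (\<chi> c. a $ c + R / 2 ^ i) \<subseteq> cell v R i x"
proof
  define a :: "real ^ 'n" where "a = (\<chi> c. v $ c + real_of_int (cell_index v R i x $ c) * (R / 2 ^ i))"
  have *: "\<lfloor>(y $ c - v $ c) * 2 ^ i / R\<rfloor> = cell_index v R i x $ c \<longleftrightarrow>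
      a $ c \<le> y $ c \<and> y $ c < a $ c + R / 2 ^ i" for y c
    unfolding floor_eq_iff a_def using R by (auto simp: field_simps)
  show "cell v R i x \<subseteq> cube a (R / 2 ^ i)"
  proof
    fix y assume "y \<in> cell v R i x"
    then have "\<lfloor>(y $ c - v $ c) * 2 ^ i / R\<rfloor> = cell_index v R i x $ c" for c
      by (auto simp: cell_def cell_index_def vec_eq_iff)
    then show "y \<in> cube a (R / 2 ^ i)"
      unfolding * by (auto simp: cube_def mem_box_cart less_imp_le)
  qed
  show "box a (\<chi> c. a $ c + R / 2 ^ i) \<subseteq> cell v R i x"
  proof
    fix y assume "y \<in> box a (\<chi> c. a $ c + R / 2 ^ i)"
    then have "\<lfloor>(y $ c - v $ c) * 2 ^ i / R\<rfloor> = cell_index v R i x $ c" for c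
      unfolding * by (auto simp: mem_box_cart less_imp_le)
    then show "y \<in> cell v R i x"
      by (auto simp: cell_def cell_index_def vec_eq_iff)
  qed
qed

lemma emeasure_cell:
  fixes v :: "real ^ 'n"
  assumes R: "0 < R"
  shows "emeasure lebesgue (cell v R i x) = ennreal ((R / 2 ^ i) ^ CARD('n))"
proof -
  obtain a where a: "cell v R i x \<subseteq> cube a (R / 2 ^ i)" "box a (\<chi> c. a $ c + R / 2 ^ i) \<subseteq> cell v R i x"
    using cell_box_bounds[OF R] .
  have l: "0 \<le> R / 2 ^ i" using R by simp
  show ?thesis
  proof (rule antisym)
    show "emeasure lebesgue (cell v R i x) \<le> ennreal ((R / 2 ^ i) ^ CARD('n))"
      using emeasure_mono[OF a(1), of lebesgue] emeasure_cube[OF l, of a] by (simp add: cube_def)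
    show "ennreal ((R / 2 ^ i) ^ CARD('n)) \<le> emeasure lebesgue (cell v R i x)"
      using emeasure_mono[OF a(2), of lebesgue] emeasure_box_cube[OF l, of a] by simp
  qed
qed

text \<open>For k \<le> i the truth of H k is constant on a cell of generation i, because that cell
  lies in one cell of generation k. So all points of a stopping cell have the same first generation,
  and two stopping cells that meet coincide.\<close>

lemma
  fixes H :: "nat \<Rightarrow> real ^ 'n \<Rightarrow> bool"
  assumes H: "\<And>i x y. y \<in> cell v R i x \<Longrightarrow> H i x \<Longrightarrow> H i y"
  shows disjoint_stopping_cells: "disjoint (stopping_cells v R H)"
    and Union_stopping_cells: "\<Union>(stopping_cells v R H) = {x. \<exists>i. H i x}"
    and countable_stopping_cells: "countable (stopping_cells v R H)"
proof -
  have down: "H k z \<longleftrightarrow> H k x" if "z \<in> cell v R i x" "k \<le> i" for z k i x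
    using that cell_antimono[of k i] cell_sym H by blast
  have first: "H i z \<and> (\<forall>k<i. \<not> H k z)"
    if "z \<in> cell v R i x" "H i x \<and> (\<forall>k<i. \<not> H k x)" for z i x
    using that down by (meson less_imp_le order_refl)
  show "disjoint (stopping_cells v R H)"
    unfolding disjoint_def
  proof (intro ballI impI)
    fix A B assume AB: "A \<in> stopping_cells v R H" "B \<in> stopping_cells v R H" "A \<noteq> B"
    then obtain i x j y where *: "A = cell v R i x" "H i x \<and> (\<forall>k<i. \<not> H k x)"
        "B = cell v R j y" "H j y \<and> (\<forall>k<j. \<not> H k y)"
      by (auto simp: stopping_cells_def)
    show "A \<inter> B = {}"
    proof (rule ccontr)
      assume "A \<inter> B \<noteq> {}"
      then obtain z where z: "z \<in> cell v R i x" "z \<in> cell v R j y" using * by auto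
      then have "i = j"
        using first[OF z(1)] first[OF z(2)] * by (metis linorder_neqE_nat)
      with z have "A = B" using * cell_eq by metis
      with AB show False by simp
    qed
  qed
  show "\<Union>(stopping_cells v R H) = {x. \<exists>i. H i x}"
  proof (intro equalityI subsetI)
    fix z assume "z \<in> \<Union>(stopping_cells v R H)"
    then show "z \<in> {x. \<exists>i. H i x}"
      unfolding stopping_cells_def using first by blast
  next
    fix z assume "z \<in> {x. \<exists>i. H i x}"
    then have "H (LEAST i. H i z) z" "\<forall>k<(LEAST i. H i z). \<not> H k z"
      by (auto intro: LeastI dest: not_less_Least)
    then show "z \<in> \<Union>(stopping_cells v R H)"
      unfolding stopping_cells_def using cell_self by blast
  qed
  have "stopping_cells v R H \<subseteq> (\<Union>i. range (cell v R i))"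
    by (auto simp: stopping_cells_def)
  then show "countable (stopping_cells v R H)"
    by (rule countable_subset) (intro countable_UN countable_cells, auto)
qed

lemma stopping_cells_sets: "A \<in> stopping_cells v R H \<Longrightarrow> A \<in> sets lebesgue"
  by (auto simp: stopping_cells_def cell_sets)

section \<open>Fractional averages over cells and their decay along a chain\<close>

definition cell_potential ::
    "real \<Rightarrow> (real ^ 'n \<Rightarrow> ennreal) \<Rightarrow> real ^ 'n \<Rightarrow> real \<Rightarrow> nat \<Rightarrow> real ^ 'n \<Rightarrow> ennreal" where
  "cell_potential \<gamma> g v R i x =
     ennreal ((R / 2 ^ i) powr (\<gamma> - real CARD('n))) * (\<integral>\<^sup>+y\<in>cell v R i x. g y \<partial>lebesgue)"

lemma cell_potential_eq: "y \<in> cell v R i x \<Longrightarrow> cell_potential \<gamma> g v R i y = cell_potential \<gamma> g v R i x"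
  by (simp add: cell_potential_def cell_eq)

lemma measurable_cell_potential [measurable]: "cell_potential \<gamma> g v R i \<in> borel_measurable lebesgue"
  using measurable_cell_invariant[of v R i "cell_potential \<gamma> g v R i" borel]
  by (simp add: cell_potential_eq)

text \<open>Two cells of a chain on which the potential is comparable to the same level have averages
  of \<open>g\<close> that differ by a factor \<open>2\<^sup>\<gamma>\<close> per generation, whence the exponential decay.\<close>

lemma cell_potential_decay:
  fixes v :: "real ^ 'n"
  assumes R: "0 < R" and \<gamma>: "0 < \<gamma>" and g [measurable]: "g \<in> borel_measurable lebesgue"
    and t: "0 < t" and le: "cell_potential \<gamma> g v R i x0 \<le> ennreal (2 * t)"
  shows "emeasure lebesgue {x \<in> cell v R i x0. \<exists>k\<ge>i + j. ennreal t < cell_potential \<gamma> g v R k x}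
    \<le> ennreal (2 * 2 powr (- (\<gamma> * j))) * emeasure lebesgue (cell v R i x0)"
proof -
  let ?F = "cell_potential \<gamma> g v R" and ?n = "real CARD('n)"
  define Q where "Q = cell v R i x0"
  define l where "l k = R / 2 ^ k" for k :: nat
  have l: "0 < l k" for k using R by (simp add: l_def)
  \<comment> \<open>Restricting H to Q and to the generations from i + j on makes the stopping cells
    disjoint subcells of Q.\<close>
  define H where "H k x \<longleftrightarrow> x \<in> Q \<and> i + j \<le> k \<and> ennreal t < ?F k x" for k x
  have H: "H k y" if "y \<in> cell v R k x" "H k x" for k x y
    using that cell_antimono[of i k v R x] cell_eq[of y v R i x] cell_eq[of x v R i x0]
    unfolding H_def Q_def by (auto simp: cell_potential_eq)
  \<comment> \<open>For k \<ge> i + j the side satisfies \<open>l k\<close> \<le> 2^(-j)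
    \<open>l i\<close>, so a stopping cell A has volume at most \<open>l k\<close>^\<gamma> N(A) / t
    \<le> c N(A). Since N(Q) \<le> 2 t \<open>l i\<close>^(n-\<gamma>), the total is 2 *
    2^(-\<gamma> j) |Q|; the factor 2 is the ratio of the levels 2 t and t.\<close>
  define c where "c = 2 powr (- (\<gamma> * j)) * l i powr \<gamma> / t"
  have c: "0 < c" using l[of i] t by (simp add: c_def)
  define N where "N = density lebesgue g"
  have NA: "emeasure N A = (\<integral>\<^sup>+y\<in>A. g y \<partial>lebesgue)" if "A \<in> sets lebesgue" for A
    using that by (simp add: N_def emeasure_density)
  have "1 * emeasure lebesgue {x. \<exists>k. H k x} \<le> ennreal c * emeasure N (\<Union>(stopping_cells v R H))"
  proof (rule emeasure_disjoint_cover_le)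
    show "{x. \<exists>k. H k x} \<in> sets lebesgue"
      using sets.countable_Union[of "stopping_cells v R H" lebesgue]
        countable_stopping_cells[of v R H, OF H] stopping_cells_sets[of _ v R H]
        Union_stopping_cells[of v R H, OF H] by auto
    fix A assume "A \<in> stopping_cells v R H"
    then obtain k x where A: "A = cell v R k x" and kx: "i + j \<le> k" "ennreal t < ?F k x"
      by (auto simp: stopping_cells_def H_def)
    have A_sets: "A \<in> sets lebesgue" by (simp add: A cell_sets)
    have "l k powr \<gamma> \<le> (2 powr (- real j) * l i) powr \<gamma>"
    proof (rule powr_mono2)
      have "R / 2 ^ k \<le> R / 2 ^ (i + j)"
        using kx R by (intro divide_left_mono) auto
      then show "l k \<le> 2 powr (- real j) * l i"
        by (simp add: l_def powr_minus powr_realpow power_add field_simps)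
    qed (use l[of k] \<gamma> in auto)
    also have "\<dots> = c * t"
      using l[of i] t by (simp add: c_def powr_mult powr_powr mult.commute)
    finally have lk: "l k powr \<gamma> / t \<le> c" using t by (simp add: field_simps)
    have "emeasure lebesgue A = ennreal (l k ^ CARD('n) / t) * ennreal t"
      using l[of k] t by (simp add: A emeasure_cell[OF R] l_def flip: ennreal_mult)
    also have "\<dots> \<le> ennreal (l k ^ CARD('n) / t) * ?F k x"
      using kx by (intro mult_left_mono) auto
    also have "\<dots> = ennreal (l k powr ?n / t * l k powr (\<gamma> - ?n)) * emeasure N A"
      using l[of k] t
      by (simp add: cell_potential_def l_def[symmetric] NA A_sets A[symmetric] powr_realpow
          mult.assoc[symmetric] flip: ennreal_mult)
    also have "l k powr ?n / t * l k powr (\<gamma> - ?n) = l k powr \<gamma> / t"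
      by (simp add: powr_add[symmetric])
    also have "ennreal (l k powr \<gamma> / t) * emeasure N A \<le> ennreal c * emeasure N A"
      by (intro mult_right_mono ennreal_leI lk) auto
    finally have *: "emeasure lebesgue A \<le> ennreal c * emeasure N A" .
    have "emeasure lebesgue ({x. \<exists>k. H k x} \<inter> A) \<le> emeasure lebesgue A"
      by (intro emeasure_mono A_sets) auto
    with * show "1 * emeasure lebesgue ({x. \<exists>k. H k x} \<inter> A) \<le> ennreal c * emeasure N A"
      by simp
  qed (auto simp: N_def Union_stopping_cells[of v R H, OF H] stopping_cells_sets
        intro: countable_stopping_cells[of v R H, OF H] disjoint_stopping_cells[of v R H, OF H])
  also have "\<dots> \<le> ennreal c * emeasure N Q"
  proof -
    have "\<Union>(stopping_cells v R H) \<subseteq> Q"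
      using Union_stopping_cells[of v R H, OF H] by (auto simp: H_def)
    then show ?thesis
      by (intro mult_left_mono emeasure_mono) (auto simp: Q_def N_def cell_sets)
  qed
  also have "emeasure N Q = ennreal (l i powr (?n - \<gamma>)) * ?F i x0"
  proof -
    have "l i powr (?n - \<gamma>) * l i powr (\<gamma> - ?n) = 1"
      using l[of i] by (simp add: powr_add[symmetric])
    then have "ennreal (l i powr (?n - \<gamma>)) * (ennreal (l i powr (\<gamma> - ?n)) * X) = X" for X
      by (simp add: mult.assoc[symmetric] flip: ennreal_mult)
    then show ?thesis
      by (simp add: cell_potential_def NA Q_def cell_sets l_def)
  qed
  also have "ennreal c * (ennreal (l i powr (?n - \<gamma>)) * ?F i x0)
      \<le> ennreal c * (ennreal (l i powr (?n - \<gamma>)) * ennreal (2 * t))"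
    by (intro mult_left_mono le) auto
  also have "\<dots> = ennreal (2 * 2 powr (- (\<gamma> * j)) * (l i powr \<gamma> * l i powr (?n - \<gamma>)))"
    using t c by (simp add: c_def field_simps flip: ennreal_mult)
  also have "\<dots> = ennreal (2 * 2 powr (- (\<gamma> * j))) * emeasure lebesgue Q"
    using l[of i] by (simp add: Q_def emeasure_cell[OF R] l_def[symmetric] powr_add[symmetric] powr_realpow
        flip: ennreal_mult)
  finally have "emeasure lebesgue {x. \<exists>k. H k x}
      \<le> ennreal (2 * 2 powr (- (\<gamma> * j))) * emeasure lebesgue Q" by (simp only: mult_1)
  moreover have "{x. \<exists>k. H k x} = {x \<in> cell v R i x0. \<exists>k\<ge>i + j. ennreal t < ?F k x}"
    unfolding H_def Q_def by blast
  ultimately show ?thesis unfolding Q_def by (simp only:)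
qed

section \<open>Weak type estimate for dyadic potentials\<close>

lemma suminf_swap_ennreal:
  fixes f :: "nat \<Rightarrow> nat \<Rightarrow> ennreal"
  shows "(\<Sum>i. \<Sum>j. f i j) = (\<Sum>j. \<Sum>i. f i j)"
proof -
  have "(\<integral>\<^sup>+i. (\<Sum>j. f i j) \<partial>count_space UNIV) = (\<Sum>j. \<integral>\<^sup>+i. f i j \<partial>count_space UNIV)"
    by (intro nn_integral_suminf) simp
  then show ?thesis by (simp add: nn_integral_count_space_nat)
qed

text \<open>Level m contains at most c (m + 1) indices, each contributing at most t/2^m, and the
  series of (m + 1)/2^m has the sum 4. Zero terms belong to no level.\<close>

lemma suminf_le_dyadic_levels:
  fixes a :: "nat \<Rightarrow> ennreal"
  assumes t: "0 < t" and a: "\<And>i. a i \<le> ennreal t"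
    and levels: "\<And>m. \<exists>i0. {i. ennreal (t / 2 ^ Suc m) < a i \<and> a i \<le> ennreal (t / 2 ^ m)} \<subseteq> {i0..<i0 + c * Suc m}"
  shows "(\<Sum>i. a i) \<le> ennreal (4 * real c * t)"
proof -
  define I where "I m = {i. ennreal (t / 2 ^ Suc m) < a i \<and> a i \<le> ennreal (t / 2 ^ m)}" for m
  have "a i \<le> (\<Sum>m. a i * indicator (I m) i)" for i
  proof (cases "a i = 0")
    case False
    then obtain u where u: "a i = ennreal u" "0 < u"
      using a[of i] by (cases "a i") (auto simp: less_le top_unique)
    have "u \<le> t" using a[of i] u t by simp
    obtain m0 where "inverse u * t < 2 ^ m0"
      using real_arch_pow[of 2 "inverse u * t"] by auto
    then have "t / 2 ^ m0 < u" using u t by (simp add: field_simps)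
    then have ex: "\<exists>m. t / 2 ^ m < u" by blast
    define m where "m = (LEAST m. t / 2 ^ m < u)"
    have m: "t / 2 ^ m < u" unfolding m_def using ex by (rule LeastI_ex)
    with \<open>u \<le> t\<close> obtain m' where m': "m = Suc m'" by (cases m) auto
    then have "\<not> t / 2 ^ m' < u"
      using not_less_Least[of m' "\<lambda>m. t / 2 ^ m < u"] by (simp add: m_def)
    with m m' u t have "i \<in> I m'" by (simp add: I_def ennreal_less_iff not_less)
    then have "a i = (\<Sum>m\<in>{m'}. a i * indicator (I m) i)" by simp
    also have "\<dots> \<le> (\<Sum>m. a i * indicator (I m) i)" by (intro sum_le_suminf) auto
    finally show ?thesis .
  qed simp
  then have "(\<Sum>i. a i) \<le> (\<Sum>i. \<Sum>m. a i * indicator (I m) i)"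
    by (intro suminf_le) auto
  also have "\<dots> = (\<Sum>m. \<Sum>i. a i * indicator (I m) i)"
    by (rule suminf_swap_ennreal)
  also have "\<dots> \<le> (\<Sum>m. ennreal (c * t * (real (Suc m) * (1 / 2) ^ m)))"
  proof (intro suminf_le)
    fix m
    obtain i0 where i0: "I m \<subseteq> {i0..<i0 + c * Suc m}" using levels[of m] by (auto simp: I_def)
    have "(\<Sum>i. a i * indicator (I m) i) = (\<Sum>i\<in>{i0..<i0 + c * Suc m}. a i * indicator (I m) i)"
      using i0 by (intro suminf_finite) (auto simp: indicator_def)
    also have "\<dots> \<le> (\<Sum>i\<in>{i0..<i0 + c * Suc m}. ennreal (t / 2 ^ m))"
      by (intro sum_mono) (auto simp: I_def indicator_def)
    also have "\<dots> = ennreal (real (c * Suc m) * (t / 2 ^ m))"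
      by (simp only: sum_constant card_atLeastLessThan add_diff_cancel_left' ennreal_of_nat_eq_real_of_nat)
        (use t in \<open>simp only: ennreal_mult' of_nat_0_le_iff\<close>)
    also have "real (c * Suc m) * (t / 2 ^ m) = c * t * (real (Suc m) * (1 / 2) ^ m)"
      by (simp add: field_simps)
    finally show "(\<Sum>i. a i * indicator (I m) i) \<le> ennreal (c * t * (real (Suc m) * (1 / 2) ^ m))" .
  qed auto
  also have "\<dots> = ennreal (c * t * 4)"
  proof (rule suminf_ennreal_eq)
    show "(\<lambda>m. c * t * (real (Suc m) * (1 / 2) ^ m)) sums (c * t * 4)"
      using geometric_deriv_sums[of "1 / 2 :: real"] by (intro sums_mult) (simp add: power2_eq_square)
  qed (use t in auto)
  finally show ?thesis by (simp add: mult_ac)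
qed

text \<open>\<open>key\<close> is the estimate for one cell, in which a set filling the fraction
  \<theta> gains \<theta>^\<delta>; M will be w dx and N will be g^p \<nu> dx. The sum can exceed 4
  c t only where a single potential exceeds t (\<open>B0\<close>) or where, for some m, level m is
  still met c (m + 1) or more generations after its first occurrence (\<open>B m\<close>).\<close>

lemma weak_type_cell_potential:
  fixes v :: "real ^ 'n"
  assumes R: "0 < R" and \<gamma>: "0 < \<gamma>" and \<delta>: "0 < \<delta>" "\<delta> \<le> 1" and p: "0 < p"
    and g [measurable]: "g \<in> borel_measurable lebesgue"
    and M: "sets M = sets lebesgue" and N: "sets N = sets lebesgue"
    and key: "\<And>i x A \<theta> u. A \<in> sets lebesgue \<Longrightarrow> A \<subseteq> cell v R i x \<Longrightarrow> 0 < \<theta> \<Longrightarrow> 0 < u \<Longrightarrow>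
      emeasure lebesgue A \<le> ennreal \<theta> * emeasure lebesgue (cell v R i x) \<Longrightarrow>
      ennreal u < cell_potential \<gamma> g v R i x \<Longrightarrow>
      ennreal (u powr p) * emeasure M A \<le> ennreal (\<theta> powr \<delta>) * C * emeasure N (cell v R i x)"
    and t: "0 < t" and c: "1 + p \<le> real c * \<gamma> * \<delta>"
  shows "ennreal (t powr p) * emeasure M {x. ennreal (4 * real c * t) < (\<Sum>i. cell_potential \<gamma> g v R i x)}
    \<le> 3 * C * emeasure N UNIV"
proof -
  let ?F = "cell_potential \<gamma> g v R"
  have N_le: "emeasure N X \<le> emeasure N UNIV" for X
    using emeasure_space[of N X] sets_eq_imp_space_eq[OF N] by simp
  note sM [measurable_cong] = M
  have spM [simp]: "space M = UNIV" using sets_eq_imp_space_eq[OF sM] by simp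
  have cover: "ennreal (u powr p) * emeasure M D \<le> ennreal (\<theta> powr \<delta>) * C * emeasure N UNIV"
    if H: "\<And>i x y. y \<in> cell v R i x \<Longrightarrow> H i x \<Longrightarrow> H i y"
      and D: "D \<in> sets lebesgue" "D \<subseteq> {x. \<exists>i. H i x}" and u: "0 < u" "0 < \<theta>"
      and gt: "\<And>i x. H i x \<Longrightarrow> ennreal u < ?F i x"
      and small: "\<And>i x. H i x \<Longrightarrow> \<forall>k<i. \<not> H k x \<Longrightarrow>
        emeasure lebesgue (D \<inter> cell v R i x) \<le> ennreal \<theta> * emeasure lebesgue (cell v R i x)"
    for H D u \<theta>
  proof -
    have "ennreal (u powr p) * emeasure M D
        \<le> ennreal (\<theta> powr \<delta>) * C * emeasure N (\<Union>(stopping_cells v R H))"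
    proof (rule emeasure_disjoint_cover_le)
      fix A assume "A \<in> stopping_cells v R H"
      then obtain i x where A: "A = cell v R i x" "H i x" "\<forall>k<i. \<not> H k x"
        by (auto simp: stopping_cells_def)
      show "ennreal (u powr p) * emeasure M (D \<inter> A) \<le> ennreal (\<theta> powr \<delta>) * C * emeasure N A"
        unfolding A(1)
        by (intro key u small gt A sets.Int D cell_sets) auto
    qed (use D sM N stopping_cells_sets[of _ v R H] disjoint_stopping_cells[of v R H, OF H]
        countable_stopping_cells[of v R H, OF H] Union_stopping_cells[of v R H, OF H] in auto)
    also have "\<dots> \<le> ennreal (\<theta> powr \<delta>) * C * emeasure N UNIV"
      by (intro mult_left_mono N_le) auto
    finally show ?thesis .
  qed
  define B0 where "B0 = {x. \<exists>i. ennreal t < ?F i x}"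
  define bin where "bin m i x \<longleftrightarrow> ennreal (t / 2 ^ Suc m) < ?F i x \<and> ?F i x \<le> ennreal (t / 2 ^ m)"
    for m i x
  define B where "B m = {x. \<exists>i. bin m i x \<and> (\<forall>k<i. \<not> bin m k x) \<and> (\<exists>k\<ge>i + c * Suc m. bin m k x)}"
    for m
  have bin_meas [measurable]: "Measurable.pred lebesgue (bin m i)" for m i
    unfolding bin_def by measurable
  have "{x \<in> space lebesgue. \<exists>i. ennreal t < ?F i x} \<in> sets lebesgue" by measurable
  then have B0_sets [measurable]: "B0 \<in> sets lebesgue" by (simp add: B0_def)
  have "{x \<in> space lebesgue. \<exists>i. bin m i x \<and> (\<forall>k<i. \<not> bin m k x) \<and> (\<exists>k\<ge>i + c * Suc m. bin m k x)}
      \<in> sets lebesgue" for m by measurable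
  then have B_sets [measurable]: "B m \<in> sets lebesgue" for m by (simp add: B_def)
  note sets = B0_sets B_sets
  have B0_mono: "emeasure lebesgue (B0 \<inter> cell v R i x) \<le> emeasure lebesgue (cell v R i x)" for i x
    by (intro emeasure_mono cell_sets) auto
  have B0: "ennreal (t powr p) * emeasure M B0 \<le> C * emeasure N UNIV"
  proof -
    have "ennreal (t powr p) * emeasure M B0 \<le> ennreal (1 powr \<delta>) * C * emeasure N UNIV"
      by (rule cover[where H="\<lambda>i x. ennreal t < ?F i x"])
        (use t sets B0_mono in \<open>simp_all add: cell_potential_eq, simp_all add: B0_def\<close>)
    then show ?thesis by simp
  qed
  have Bm: "ennreal (t powr p) * emeasure M (B m) \<le> ennreal (2 * (1 / 2) ^ Suc m) * (C * emeasure N UNIV)" for m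
  proof -
    define u where "u = t / 2 ^ Suc m"
    define \<theta> where "\<theta> = 2 * 2 powr (- (\<gamma> * (c * Suc m)))"
    have u: "0 < u" using t by (simp add: u_def)
    have "ennreal (u powr p) * emeasure M (B m) \<le> ennreal (\<theta> powr \<delta>) * C * emeasure N UNIV"
    proof (rule cover[where H="bin m"])
      fix i x assume ix: "bin m i x" "\<forall>k<i. \<not> bin m k x"
      have "emeasure lebesgue (B m \<inter> cell v R i x)
          \<le> emeasure lebesgue {y \<in> cell v R i x. \<exists>k\<ge>i + c * Suc m. ennreal u < ?F k y}"
      proof (rule emeasure_mono)
        show "B m \<inter> cell v R i x \<subseteq> {y \<in> cell v R i x. \<exists>k\<ge>i + c * Suc m. ennreal u < ?F k y}"
        proof
          fix y assume y: "y \<in> B m \<inter> cell v R i x"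
          then obtain i' k where ik: "bin m i' y" "\<forall>k<i'. \<not> bin m k y" "i' + c * Suc m \<le> k" "bin m k y"
            by (auto simp: B_def)
          \<comment> \<open>Potentials of generations up to i are constant on the cell, so y and x
            enter level m in the same generation.\<close>
          have eq: "bin m k' y \<longleftrightarrow> bin m k' x" if "k' \<le> i" for k'
            using y cell_antimono[OF that, of v R x] by (auto simp: bin_def cell_potential_eq)
          have "i' = i"
            using ik(1,2) ix eq by (metis linorder_neqE_nat less_imp_le order_refl)
          with ik y show "y \<in> {y \<in> cell v R i x. \<exists>k\<ge>i + c * Suc m. ennreal u < ?F k y}"
            by (auto simp: bin_def u_def)
        qed
        have "{y \<in> cell v R i x. \<exists>k\<ge>i + c * Suc m. ennreal u < ?F k y} =
            cell v R i x \<inter> {y \<in> space lebesgue. \<exists>k. i + c * Suc m \<le> k \<and> ennreal u < ?F k y}" by auto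
        also have "\<dots> \<in> sets lebesgue" by (intro sets.Int cell_sets) measurable
        finally show "{y \<in> cell v R i x. \<exists>k\<ge>i + c * Suc m. ennreal u < ?F k y} \<in> sets lebesgue" .
      qed
      also have "\<dots> \<le> ennreal \<theta> * emeasure lebesgue (cell v R i x)"
        unfolding \<theta>_def using ix(1)
        by (intro cell_potential_decay[OF R \<gamma> g u]) (auto simp: bin_def u_def)
      finally show "emeasure lebesgue (B m \<inter> cell v R i x) \<le> ennreal \<theta> * emeasure lebesgue (cell v R i x)" .
    next
      show "B m \<subseteq> {x. \<exists>i. bin m i x}" unfolding B_def by blast
      show "ennreal u < ?F i x" if "bin m i x" for i x
        using that by (simp add: bin_def u_def)
      show "bin m i y" if "y \<in> cell v R i x" "bin m i x" for i x y
        using that by (simp add: bin_def cell_potential_eq)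
    qed (use u sets in \<open>simp_all add: \<theta>_def\<close>)
    then have "ennreal ((2 ^ Suc m) powr p) * (ennreal (u powr p) * emeasure M (B m))
        \<le> ennreal ((2 ^ Suc m) powr p) * (ennreal (\<theta> powr \<delta>) * C * emeasure N UNIV)"
      by (intro mult_left_mono) auto
    also have "\<dots> = ennreal ((2 ^ Suc m) powr p * \<theta> powr \<delta>) * (C * emeasure N UNIV)"
      by (simp add: ennreal_mult mult.assoc)
    also have "\<dots> \<le> ennreal (2 * (1 / 2) ^ Suc m) * (C * emeasure N UNIV)"
    proof (intro mult_right_mono ennreal_leI)
      \<comment> \<open>Returning from the level u = t/2^(m+1) to t costs 2^((m+1) p), while
        \<theta>^\<delta> is at most 2 * 2^(-\<gamma> c (m+1) \<delta>) because \<delta> \<le> 1.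
        The condition 1 + p \<le> c \<gamma> \<delta> leaves the summable factor 2 *
        2^(-(m+1)).\<close>
      define k where "k = real (Suc m)"
      have "(2 ^ Suc m) powr p * \<theta> powr \<delta> = 2 powr (k * p) * (2 powr \<delta> * 2 powr (- (\<gamma> * (c * k) * \<delta>)))"
        unfolding k_def by (simp only: \<theta>_def powr_mult powr_powr powr_realpow[symmetric] zero_less_numeral
            zero_le_numeral powr_ge_zero) (simp add: algebra_simps)
      also have "\<dots> = 2 powr (k * p + \<delta> - \<gamma> * (c * k) * \<delta>)"
        by (simp add: powr_add[symmetric] add_diff_eq)
      also have "\<dots> \<le> 2 powr (1 - k)"
      proof (rule powr_mono)
        have "k * (1 + p) \<le> k * (real c * \<gamma> * \<delta>)" using c by (intro mult_left_mono) (auto simp: k_def)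
        then show "k * p + \<delta> - \<gamma> * (c * k) * \<delta> \<le> 1 - k" using \<delta> by (simp add: algebra_simps)
      qed simp
      also have "\<dots> = 2 * (1 / 2) ^ Suc m"
        unfolding k_def by (simp add: powr_diff powr_realpow power_divide del: of_nat_Suc power_Suc)
      finally show "(2 ^ Suc m) powr p * \<theta> powr \<delta> \<le> 2 * (1 / 2) ^ Suc m" .
    qed auto
    also have "ennreal ((2 ^ Suc m) powr p) * (ennreal (u powr p) * emeasure M (B m))
        = ennreal (t powr p) * emeasure M (B m)"
    proof -
      have "(2 ^ Suc m) powr p * u powr p = t powr p"
        using t by (simp add: u_def powr_mult[symmetric])
      then show ?thesis by (simp add: mult.assoc[symmetric] flip: ennreal_mult)
    qed
    finally show ?thesis .
  qed
  have "{x. ennreal (4 * real c * t) < (\<Sum>i. ?F i x)} \<subseteq> B0 \<union> (\<Union>m. B m)"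
  proof (rule subsetI, rule ccontr)
    fix x assume x: "x \<in> {x. ennreal (4 * real c * t) < (\<Sum>i. ?F i x)}" "x \<notin> B0 \<union> (\<Union>m. B m)"
    have "(\<Sum>i. ?F i x) \<le> ennreal (4 * real c * t)"
    proof (rule suminf_le_dyadic_levels[OF t])
      show "?F i x \<le> ennreal t" for i using x(2) by (auto simp: B0_def not_less)
      fix m
      show "\<exists>i0. {i. ennreal (t / 2 ^ Suc m) < ?F i x \<and> ?F i x \<le> ennreal (t / 2 ^ m)} \<subseteq> {i0..<i0 + c * Suc m}"
        unfolding bin_def[symmetric]
      proof (cases "\<exists>i. bin m i x")
        case True
        define i0 where "i0 = (LEAST i. bin m i x)"
        have i0: "bin m i0 x" "\<forall>k<i0. \<not> bin m k x"
          using LeastI_ex[OF True] by (auto simp: i0_def dest: not_less_Least)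
        then have "\<not> (\<exists>k\<ge>i0 + c * Suc m. bin m k x)" using x(2) by (auto simp: B_def)
        then have "{i. bin m i x} \<subseteq> {i0..<i0 + c * Suc m}" using i0 by (auto simp: not_le[symmetric])
        then show "\<exists>i0. {i. bin m i x} \<subseteq> {i0..<i0 + c * Suc m}" ..
      qed auto
    qed
    with x(1) show False by simp
  qed
  then have "emeasure M {x. ennreal (4 * real c * t) < (\<Sum>i. ?F i x)} \<le> emeasure M (B0 \<union> (\<Union>m. B m))"
    by (intro emeasure_mono) (auto simp: sM)
  also have "\<dots> \<le> emeasure M B0 + emeasure M (\<Union>m. B m)"
    by (intro emeasure_subadditive) (auto simp: sM)
  also have "\<dots> \<le> emeasure M B0 + (\<Sum>m. emeasure M (B m))"
    by (intro add_left_mono emeasure_subadditive_countably) (auto simp: sM)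
  finally have "ennreal (t powr p) * emeasure M {x. ennreal (4 * real c * t) < (\<Sum>i. ?F i x)}
      \<le> ennreal (t powr p) * (emeasure M B0 + (\<Sum>m. emeasure M (B m)))"
    by (intro mult_left_mono) auto
  also have "\<dots> = ennreal (t powr p) * emeasure M B0 + (\<Sum>m. ennreal (t powr p) * emeasure M (B m))"
    by (simp add: distrib_left)
  also have "\<dots> \<le> C * emeasure N UNIV + (\<Sum>m. ennreal (2 * (1 / 2) ^ Suc m) * (C * emeasure N UNIV))"
    by (intro add_mono B0 suminf_le Bm) auto
  \<comment> \<open>The sets \<open>B m\<close> contribute the factor 2 in total and
    \<open>B0\<close> the factor 1, whence the 3 in the conclusion.\<close>
  also have "(\<Sum>m. ennreal (2 * (1 / 2) ^ Suc m) * (C * emeasure N UNIV)) = 2 * (C * emeasure N UNIV)"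
  proof -
    have "(\<Sum>m. ennreal (2 * (1 / 2) ^ Suc m)) = ennreal (2 * 1)"
      by (rule suminf_ennreal_eq) (use sums_mult[OF power_half_series, of 2] in auto)
    then show ?thesis by (simp only: ennreal_suminf_multc) simp
  qed
  also have "C * emeasure N UNIV + 2 * (C * emeasure N UNIV) = (1 + 2) * (C * emeasure N UNIV)"
    by (simp only: distrib_right mult_1)
  finally show ?thesis by (simp add: mult.assoc)
qed

section \<open>The bump condition\<close>

lemma locally_integrable_measurable:
  fixes f :: "'a::euclidean_space \<Rightarrow> 'b::euclidean_space"
  assumes "locally_integrable f"
  shows "f \<in> borel_measurable lebesgue"
proof (rule borel_measurable_LIMSEQ_metric)
  fix n :: nat
  have "f absolutely_integrable_on cball 0 (real n)"
    using assms by (simp add: locally_integrable_def)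
  then show "(\<lambda>x. indicator (cball 0 (real n)) x *\<^sub>R f x) \<in> borel_measurable lebesgue"
    unfolding set_integrable_def by (rule borel_measurable_integrable)
next
  fix x :: 'a
  obtain N where "norm x \<le> real N" using real_arch_simple by auto
  then have "eventually (\<lambda>n. indicator (cball 0 (real n)) x *\<^sub>R f x = f x) sequentially"
    by (intro eventually_sequentiallyI[of N]) (auto simp: indicator_def)
  then show "(\<lambda>n. indicator (cball 0 (real n)) x *\<^sub>R f x) \<longlonglongrightarrow> f x"
    by (rule tendsto_eventually)
qed

lemma locally_integrable_nn_integral_finite:
  fixes f :: "'a::euclidean_space \<Rightarrow> 'b::euclidean_space"
  assumes "locally_integrable f"
  shows "(\<integral>\<^sup>+x\<in>ball y r. ennreal (norm (f x)) \<partial>lebesgue) < \<infinity>"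
proof -
  have "integrable lebesgue (\<lambda>x. indicator (cball y r) x *\<^sub>R f x)"
    using assms by (simp add: locally_integrable_def set_integrable_def)
  then have "(\<integral>\<^sup>+x. ennreal (norm (indicator (cball y r) x *\<^sub>R f x)) \<partial>lebesgue) < \<infinity>"
    by (simp add: integrable_iff_bounded)
  moreover have "(\<integral>\<^sup>+x\<in>ball y r. ennreal (norm (f x)) \<partial>lebesgue)
      \<le> (\<integral>\<^sup>+x. ennreal (norm (indicator (cball y r) x *\<^sub>R f x)) \<partial>lebesgue)"
    by (intro nn_integral_mono) (auto simp: indicator_def)
  ultimately show ?thesis by (rule le_less_trans[rotated])
qed

lemma weight_measurable: "weight w \<Longrightarrow> w \<in> borel_measurable lebesgue"
  by (simp add: weight_def locally_integrable_measurable)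

lemma sets_wmeasure [simp, measurable_cong]: "sets (wmeasure w) = sets lebesgue"
  by (simp add: wmeasure_def)

lemma space_wmeasure [simp]: "space (wmeasure w) = UNIV"
  by (simp add: wmeasure_def)

lemma emeasure_wmeasure:
  "weight w \<Longrightarrow> A \<in> sets lebesgue \<Longrightarrow> emeasure (wmeasure w) A = (\<integral>\<^sup>+x\<in>A. ennreal (w x) \<partial>lebesgue)"
  unfolding wmeasure_def using weight_measurable[of w] by (intro emeasure_density) auto

lemma emeasure_wmeasure_ball_finite:
  assumes "weight w"
  shows "emeasure (wmeasure w) (ball y r) \<noteq> \<infinity>"
proof -
  have "emeasure (wmeasure w) (ball y r) = (\<integral>\<^sup>+x\<in>ball y r. ennreal (norm (w x)) \<partial>lebesgue)"
    using assms by (simp add: emeasure_wmeasure weight_def)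
  with assms show ?thesis
    using locally_integrable_nn_integral_finite[of w y r] by (auto simp: weight_def)
qed

lemma indicator_epowr: "0 < a \<Longrightarrow> indicator A y epowr a = indicator A y"
  by (auto simp: indicator_def)

text \<open>Finiteness of the dual integral excludes that \<open>\<nu>\<close> vanishes on a set of positive measure,
  where the factor \<open>\<nu>\<^sup>1\<^sup>/\<^sup>p \<nu>\<^sup>-\<^sup>1\<^sup>/\<^sup>p\<close> would be the junk value \<open>0 \<cdot> \<infinity> = 0\<close>.\<close>

lemma weighted_Holder:
  fixes \<nu> :: "'a::euclidean_space \<Rightarrow> real"
  assumes p: "1 < p" and \<nu>: "weight \<nu>" and [measurable]: "g \<in> borel_measurable lebesgue" "S \<in> sets lebesgue"
    and fin: "(\<integral>\<^sup>+x\<in>S. ennreal (\<nu> x) epowr (- conj_exp p / p) \<partial>lebesgue) \<noteq> \<infinity>"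
  shows "(\<integral>\<^sup>+x\<in>S. g x \<partial>lebesgue)
    \<le> (\<integral>\<^sup>+x\<in>S. g x epowr p * ennreal (\<nu> x) \<partial>lebesgue) epowr (1 / p)
      * (\<integral>\<^sup>+x\<in>S. ennreal (\<nu> x) epowr (- conj_exp p / p) \<partial>lebesgue) epowr (1 / conj_exp p)"
proof -
  note [measurable] = weight_measurable[OF \<nu>]
  define q where "q = conj_exp p"
  have q: "0 < q" "1 / p + 1 / q = 1" using p by (auto simp: q_def conj_exp_def field_simps)
  define G where "G x = (g x * ennreal (\<nu> x) epowr (1 / p)) * indicator S x" for x
  define H where "H x = ennreal (\<nu> x) epowr (- (1 / p)) * indicator S x" for x
  have "AE x in lebesgue. ennreal (\<nu> x) epowr (- q / p) * indicator S x \<noteq> \<infinity>"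
    using fin unfolding q_def[symmetric] by (intro nn_integral_PInf_AE) auto
  then have "AE x in lebesgue. g x * indicator S x = G x * H x"
  proof eventually_elim
    case (elim x)
    show ?case
    proof (cases "x \<in> S")
      case True
      with elim p q have "ennreal (\<nu> x) \<noteq> 0" by (auto simp: epowr_def)
      then have "ennreal (\<nu> x) epowr (1 / p) * ennreal (\<nu> x) epowr (- (1 / p)) = 1"
        by (subst epowr_add[symmetric]) (auto simp: epowr_def)
      then show ?thesis using True by (simp add: G_def H_def mult.assoc)
    qed (simp add: G_def)
  qed
  then have "(\<integral>\<^sup>+x\<in>S. g x \<partial>lebesgue) = (\<integral>\<^sup>+x. G x * H x \<partial>lebesgue)"
    by (rule nn_integral_cong_AE)
  also have "\<dots> \<le> (\<integral>\<^sup>+x. G x epowr p \<partial>lebesgue) epowr (1 / p) * (\<integral>\<^sup>+x. H x epowr q \<partial>lebesgue) epowr (1 / q)"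
    by (intro Holder_inequality_nn_integral) (use p q in \<open>auto simp: G_def[abs_def] H_def[abs_def]\<close>)
  also have "(\<integral>\<^sup>+x. G x epowr p \<partial>lebesgue) = (\<integral>\<^sup>+x\<in>S. g x epowr p * ennreal (\<nu> x) \<partial>lebesgue)"
    using p by (intro nn_integral_cong) (simp add: G_def epowr_mult indicator_epowr epowr_mult)
  also have "(\<integral>\<^sup>+x. H x epowr q \<partial>lebesgue) = (\<integral>\<^sup>+x\<in>S. ennreal (\<nu> x) epowr (- q / p) \<partial>lebesgue)"
  proof (intro nn_integral_cong)
    fix x
    have "(ennreal (\<nu> x) epowr (- (1 / p))) epowr q = ennreal (\<nu> x) epowr (- q / p)"
    proof (cases "ennreal (\<nu> x) = 0")
      case True
      with p q show ?thesis by (auto simp: epowr_def)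
    qed (simp add: epowr_epowr_finite)
    then show "H x epowr q = ennreal (\<nu> x) epowr (- q / p) * indicator S x"
      using q by (simp add: H_def epowr_mult indicator_epowr)
  qed
  finally show ?thesis by (simp add: q_def)
qed

text \<open>Hoelder with exponent r on w and the conjugate exponent on the indicator of A. A set
  that is small for Lebesgue measure is thereby small for w, with exponent 1 - 1/r.\<close>

lemma wmeasure_Holder:
  assumes r: "1 < r" and w: "weight w" and [measurable]: "A \<in> sets lebesgue" "Q \<in> sets lebesgue" and AQ: "A \<subseteq> Q"
  shows "emeasure (wmeasure w) A \<le> emeasure lebesgue A epowr (1 - 1 / r)
    * (\<integral>\<^sup>+x\<in>Q. ennreal (w x) epowr r \<partial>lebesgue) epowr (1 / r)"
proof -
  note [measurable] = weight_measurable[OF w]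
  define q where "q = r / (r - 1)"
  have q: "0 < q" "1 / q = 1 - 1 / r" using r by (auto simp: q_def field_simps)
  have "emeasure (wmeasure w) A = (\<integral>\<^sup>+x. indicator A x * (ennreal (w x) * indicator Q x) \<partial>lebesgue)"
    unfolding emeasure_wmeasure[OF w \<open>A \<in> sets lebesgue\<close>] using AQ
    by (intro nn_integral_cong) (auto simp: indicator_def)
  also have "\<dots> \<le> (\<integral>\<^sup>+x. indicator A x epowr q \<partial>lebesgue) epowr (1 / q)
      * (\<integral>\<^sup>+x. (ennreal (w x) * indicator Q x) epowr r \<partial>lebesgue) epowr (1 / r)"
    using q r by (intro Holder_inequality_nn_integral) auto
  also have "(\<integral>\<^sup>+x. indicator A x epowr q \<partial>lebesgue) = (\<integral>\<^sup>+x. indicator A x \<partial>lebesgue)"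
    using q by (intro nn_integral_cong) (auto simp: indicator_def)
  also have "\<dots> = emeasure lebesgue A" by simp
  finally show ?thesis using r by (simp add: epowr_mult indicator_epowr q(2))
qed

locale bump_pair =
  fixes \<gamma> p r C0 :: real and w \<nu> :: "real ^ 'n \<Rightarrow> real"
  assumes \<gamma>: "0 < \<gamma>" "\<gamma> < real CARD('n)" and p: "1 < p" and r: "1 < r"
    and w: "weight w" and \<nu>: "weight \<nu>"
    and bump: "\<And>a l. 0 < l \<Longrightarrow>
           emeasure lebesgue (cube a l) epowr (\<gamma> / real CARD('n))
           * avg (cube a l) (\<lambda>x. ennreal (w x) epowr r) epowr (1 / (r * p))
           * avg (cube a l) (\<lambda>x. ennreal (\<nu> x) epowr (- conj_exp p / p)) epowr (1 / conj_exp p)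
           \<le> ennreal C0"
begin

lemmas [measurable] = weight_measurable[OF w] weight_measurable[OF \<nu>]

text \<open>The second factor on the left is the bound that \<open>wmeasure_Holder\<close> gives for
  w of the whole cube, so w-measures can be inserted there. The hypothesis \<open>pos\<close> guards
  against \<infinity> * 0: if w vanished on the cube, the bump condition would hold with an infinite
  dual integral.\<close>

lemma cube_estimate:
  fixes a :: "real ^ 'n"
  assumes l: "0 < l" and pos: "emeasure (wmeasure w) (cube a l) \<noteq> 0"
    and [measurable]: "g \<in> borel_measurable lebesgue" "S \<in> sets lebesgue" and S: "S \<subseteq> cube a l"
  shows "(ennreal (l powr (\<gamma> - real CARD('n))) * (\<integral>\<^sup>+x\<in>S. g x \<partial>lebesgue)) epowr p
      * (ennreal (l ^ CARD('n)) epowr (1 - 1 / r)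
          * (\<integral>\<^sup>+x\<in>cube a l. ennreal (w x) epowr r \<partial>lebesgue) epowr (1 / r))
    \<le> ennreal C0 epowr p * (\<integral>\<^sup>+x\<in>S. g x epowr p * ennreal (\<nu> x) \<partial>lebesgue)"
proof -
  define n where "n = real CARD('n)"
  define q where "q = conj_exp p"
  have q: "0 < q" "1 / p + 1 / q = 1" using p by (auto simp: q_def conj_exp_def field_simps)
  have n: "0 < n" using \<gamma> by (simp add: n_def)
  let ?Q = "cube a l"
  define Iw where "Iw = (\<integral>\<^sup>+x\<in>?Q. ennreal (w x) epowr r \<partial>lebesgue)"
  define I\<sigma> where "I\<sigma> = (\<integral>\<^sup>+x\<in>?Q. ennreal (\<nu> x) epowr (- q / p) \<partial>lebesgue)"
  define N where "N = (\<integral>\<^sup>+x\<in>S. g x epowr p * ennreal (\<nu> x) \<partial>lebesgue)"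
  have Q_sets [measurable]: "?Q \<in> sets lebesgue" by (simp add: cube_def)
  have Q: "emeasure lebesgue ?Q = ennreal (l powr n)"
    by (simp only: emeasure_cube[OF less_imp_le[OF l]] n_def powr_realpow[OF l])
  have avg: "avg ?Q f = ennreal (l powr (- n)) * (\<integral>\<^sup>+x\<in>?Q. f x \<partial>lebesgue)" for f
    using l by (simp add: avg_def Q divide_ennreal_def inverse_ennreal powr_minus mult.commute)
  \<comment> \<open>Total power of l in the bump condition: \<gamma> from the volume factor, the
    rest from the two averages. As n p / q = n p - n, it satisfies e p = (\<gamma> - n) p + n (1 -
    1/r), which matches the left side of the claim.\<close>
  define e where "e = \<gamma> - n / (r * p) - n / q"
  have le: "ennreal (l powr e) * Iw epowr (1 / (r * p)) * I\<sigma> epowr (1 / q) \<le> ennreal C0"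
  proof -
    have "l powr e = l powr \<gamma> * l powr (- n / (r * p)) * l powr (- n / q)"
      by (simp add: powr_add[symmetric] e_def)
    then have "ennreal (l powr e) * Iw epowr (1 / (r * p)) * I\<sigma> epowr (1 / q)
        = ennreal (l powr \<gamma>) * (ennreal (l powr (- n / (r * p))) * Iw epowr (1 / (r * p)))
          * (ennreal (l powr (- n / q)) * I\<sigma> epowr (1 / q))"
      by (simp add: ennreal_mult mult_ac)
    also have "\<dots> = emeasure lebesgue ?Q epowr (\<gamma> / real CARD('n))
           * avg ?Q (\<lambda>x. ennreal (w x) epowr r) epowr (1 / (r * p))
           * avg ?Q (\<lambda>x. ennreal (\<nu> x) epowr (- conj_exp p / p)) epowr (1 / conj_exp p)"
      using l n p q r unfolding avg Q q_def[symmetric] Iw_def[symmetric] I\<sigma>_def[symmetric] n_def[symmetric]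
      by (simp add: epowr_mult epowr_ennreal powr_powr)
    finally show ?thesis using bump[OF l, of a] by simp
  qed
  have "Iw \<noteq> 0"
  proof
    assume "Iw = 0"
    then have "AE x in lebesgue. ennreal (w x) epowr r * indicator ?Q x = 0"
      unfolding Iw_def by (subst (asm) nn_integral_0_iff_AE) auto
    then have "AE x in lebesgue. ennreal (w x) * indicator ?Q x = 0"
      by eventually_elim (use r in \<open>auto simp: epowr_eq_0_iff indicator_def split: if_splits\<close>)
    then have "emeasure (wmeasure w) ?Q = 0"
      unfolding emeasure_wmeasure[OF w Q_sets] by (subst nn_integral_0_iff_AE) auto
    with pos show False by simp
  qed
  have I\<sigma>: "I\<sigma> \<noteq> \<infinity>"
  proof
    assume *: "I\<sigma> = \<infinity>"
    have "Iw epowr (1 / (r * p)) \<noteq> 0" using \<open>Iw \<noteq> 0\<close> p r by (simp add: epowr_eq_0_iff)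
    moreover have "I\<sigma> epowr (1 / q) = \<infinity>" using * q by (simp add: epowr_def)
    ultimately have "ennreal (l powr e) * Iw epowr (1 / (r * p)) * I\<sigma> epowr (1 / q) = \<infinity>"
      using l by (simp add: ennreal_mult_top)
    with le show False by (simp add: top_unique)
  qed
  have S\<sigma>: "(\<integral>\<^sup>+x\<in>S. ennreal (\<nu> x) epowr (- q / p) \<partial>lebesgue) \<le> I\<sigma>"
    unfolding I\<sigma>_def using S by (intro nn_integral_mono) (auto simp: indicator_def)
  have "(\<integral>\<^sup>+x\<in>S. g x \<partial>lebesgue)
      \<le> N epowr (1 / p) * (\<integral>\<^sup>+x\<in>S. ennreal (\<nu> x) epowr (- q / p) \<partial>lebesgue) epowr (1 / q)"
    unfolding N_def q_def using S\<sigma> I\<sigma> by (intro weighted_Holder p \<nu>) (auto simp: q_def top_unique)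
  also have "\<dots> \<le> N epowr (1 / p) * I\<sigma> epowr (1 / q)"
    using q by (intro mult_left_mono epowr_mono S\<sigma>) auto
  finally have "(ennreal (l powr (\<gamma> - n)) * (\<integral>\<^sup>+x\<in>S. g x \<partial>lebesgue)) epowr p
      \<le> (ennreal (l powr (\<gamma> - n)) * (N epowr (1 / p) * I\<sigma> epowr (1 / q))) epowr p"
    using p by (intro epowr_mono mult_left_mono) auto
  then have "(ennreal (l powr (\<gamma> - n)) * (\<integral>\<^sup>+x\<in>S. g x \<partial>lebesgue)) epowr p
        * (ennreal (l ^ CARD('n)) epowr (1 - 1 / r) * Iw epowr (1 / r))
      \<le> (ennreal (l powr (\<gamma> - n)) * (N epowr (1 / p) * I\<sigma> epowr (1 / q))) epowr p
        * (ennreal (l ^ CARD('n)) epowr (1 - 1 / r) * Iw epowr (1 / r))"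
    by (intro mult_right_mono) auto
  also have "\<dots> = (ennreal (l powr e) * Iw epowr (1 / (r * p)) * I\<sigma> epowr (1 / q)) epowr p * N"
  proof -
    have "(\<gamma> - n) * p + n * (1 - 1 / r) = e * p"
    proof -
      have "n / q * p = n * p - n" using p by (simp add: q_def conj_exp_def field_simps)
      then show ?thesis using p r by (simp add: e_def algebra_simps)
    qed
    then have "l powr (e * p) = l powr ((\<gamma> - n) * p) * l powr (n * (1 - 1 / r))"
      by (simp add: powr_add[symmetric])
    moreover have "ennreal (l ^ CARD('n)) epowr (1 - 1 / r) = ennreal (l powr (n * (1 - 1 / r)))"
      using l by (simp add: epowr_ennreal n_def powr_realpow[symmetric] powr_powr)
    ultimately show ?thesis
      using p q r l by (simp add: epowr_mult epowr_epowr epowr_ennreal powr_powr ennreal_mult mult_ac)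
  qed
  also have "\<dots> \<le> ennreal C0 epowr p * N"
    using p by (intro mult_right_mono epowr_mono le) auto
  finally show ?thesis by (simp add: n_def N_def Iw_def)
qed

text \<open>S and A are kept apart for two uses: in the dyadic estimate S is a cell and A a small
  part of it, in the estimate over annuli both are the same ball and \<theta> = 1.\<close>

lemma cube_estimate_wmeasure:
  fixes a :: "real ^ 'n"
  assumes l: "0 < l" and [measurable]: "g \<in> borel_measurable lebesgue" "S \<in> sets lebesgue" "A \<in> sets lebesgue"
    and S: "S \<subseteq> cube a l" and A: "A \<subseteq> cube a l"
    and \<theta>: "0 < \<theta>" "emeasure lebesgue A \<le> ennreal \<theta> * ennreal (l ^ CARD('n))"
  shows "(ennreal (l powr (\<gamma> - real CARD('n))) * (\<integral>\<^sup>+x\<in>S. g x \<partial>lebesgue)) epowr p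
      * emeasure (wmeasure w) A
    \<le> ennreal (\<theta> powr (1 - 1 / r)) * ennreal C0 epowr p * (\<integral>\<^sup>+x\<in>S. g x epowr p * ennreal (\<nu> x) \<partial>lebesgue)"
    (is "?X * _ \<le> _ * _ * ?N")
proof (cases "emeasure (wmeasure w) (cube a l) = 0")
  case True
  have "emeasure (wmeasure w) A \<le> emeasure (wmeasure w) (cube a l)"
    using A by (intro emeasure_mono) (auto simp: cube_def)
  with True show ?thesis by simp
next
  case False
  let ?W = "(\<integral>\<^sup>+x\<in>cube a l. ennreal (w x) epowr r \<partial>lebesgue) epowr (1 / r)"
  let ?V = "ennreal (l ^ CARD('n)) epowr (1 - 1 / r)"
  have r': "0 < 1 - 1 / r" using r by simp
  have "emeasure (wmeasure w) A \<le> emeasure lebesgue A epowr (1 - 1 / r) * ?W"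
    using A by (intro wmeasure_Holder r w) (auto simp: cube_def)
  also have "\<dots> \<le> (ennreal \<theta> * ennreal (l ^ CARD('n))) epowr (1 - 1 / r) * ?W"
    using r' by (intro mult_right_mono epowr_mono \<theta>) auto
  also have "\<dots> = ennreal (\<theta> powr (1 - 1 / r)) * (?V * ?W)"
    using r' \<theta> by (simp add: epowr_mult epowr_ennreal mult.assoc)
  finally have "?X * emeasure (wmeasure w) A \<le> ?X * (ennreal (\<theta> powr (1 - 1 / r)) * (?V * ?W))"
    by (intro mult_left_mono) auto
  also have "\<dots> = ennreal (\<theta> powr (1 - 1 / r)) * (?X * (?V * ?W))"
    by (simp only: mult_ac)
  also have "\<dots> \<le> ennreal (\<theta> powr (1 - 1 / r)) * (ennreal C0 epowr p * ?N)"
    by (intro mult_left_mono cube_estimate l False S) auto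
  finally show ?thesis by (simp only: mult.assoc)
qed

end

section \<open>The Riesz kernel\<close>

text \<open>The kernel is \<open>0\<close> at the origin, by \<open>0 powr a = 0\<close> and \<open>1 / 0 = 0\<close>.\<close>

definition riesz_kernel :: "real \<Rightarrow> real ^ 'n \<Rightarrow> ennreal" where
  "riesz_kernel \<gamma> z = ennreal (1 / norm z powr (real CARD('n) - \<gamma>))"

lemma measurable_riesz_kernel [measurable]: "riesz_kernel \<gamma> \<in> borel_measurable borel"
  unfolding riesz_kernel_def[abs_def] by measurable

lemma riesz_kernel_le:
  fixes z :: "real ^ 'n"
  assumes "0 < d" "d \<le> norm z \<or> z = 0" "\<gamma> < real CARD('n)"
  shows "riesz_kernel \<gamma> z \<le> ennreal (d powr (\<gamma> - real CARD('n)))"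
proof (cases "z = 0")
  case False
  have "norm z powr (\<gamma> - real CARD('n)) \<le> d powr (\<gamma> - real CARD('n))"
    using assms False by (intro powr_mono2') auto
  then show ?thesis
    using powr_minus_divide[of "norm z" "real CARD('n) - \<gamma>"]
    by (auto simp: riesz_kernel_def intro!: ennreal_leI)
qed (simp add: riesz_kernel_def)

lemma dyadic_annulus:
  assumes "0 < d" "d < (\<rho>::real)"
  obtains i :: nat where "\<rho> / 2 ^ Suc i \<le> d" "d < \<rho> / 2 ^ i"
proof -
  obtain m where "\<rho> / d < 2 ^ m" using real_arch_pow[of 2 "\<rho> / d"] by auto
  then have ex: "\<exists>m. \<rho> / 2 ^ m \<le> d" using assms by (intro exI[of _ m]) (simp add: field_simps)
  define m0 where "m0 = (LEAST m. \<rho> / 2 ^ m \<le> d)"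
  have m0: "\<rho> / 2 ^ m0 \<le> d" unfolding m0_def using ex by (rule LeastI_ex)
  with assms obtain i where i: "m0 = Suc i" by (cases m0) auto
  then have "\<not> \<rho> / 2 ^ i \<le> d"
    using not_less_Least[of i "\<lambda>m. \<rho> / 2 ^ m \<le> d"] by (simp add: m0_def)
  with m0 i that show ?thesis by auto
qed

lemma nn_integral_series_indicator:
  assumes [measurable]: "g \<in> borel_measurable M" "\<And>i. B i \<in> sets M"
  shows "(\<integral>\<^sup>+y. (\<Sum>i. c i * (g y * indicator (B i) y)) \<partial>M) = (\<Sum>i. c i * (\<integral>\<^sup>+y\<in>B i. g y \<partial>M))"
  by (simp add: nn_integral_suminf nn_integral_cmult)

text \<open>On each annulus the kernel is replaced by its value at the inner radius, and the annulus
  is then enlarged to the ball. The point y = x lies in no annulus, but the kernel is 0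
  there.\<close>

lemma riesz_kernel_near_le:
  fixes g :: "real ^ 'n \<Rightarrow> ennreal"
  assumes \<gamma>: "\<gamma> < real CARD('n)" and \<rho>: "0 < \<rho>" and g: "g \<in> borel_measurable lebesgue"
  shows "(\<integral>\<^sup>+y\<in>ball x \<rho>. g y * riesz_kernel \<gamma> (x - y) \<partial>lebesgue)
    \<le> (\<Sum>i. ennreal ((\<rho> / 2 ^ Suc i) powr (\<gamma> - real CARD('n))) * (\<integral>\<^sup>+y\<in>ball x (\<rho> / 2 ^ i). g y \<partial>lebesgue))"
proof -
  let ?c = "\<lambda>i. ennreal ((\<rho> / 2 ^ Suc i) powr (\<gamma> - real CARD('n)))"
  have pt: "g y * riesz_kernel \<gamma> (x - y) * indicator (ball x \<rho>) y
      \<le> (\<Sum>i. ?c i * (g y * indicator (ball x (\<rho> / 2 ^ i)) y))" for y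
  proof (cases "x \<noteq> y \<and> y \<in> ball x \<rho>")
    case True
    then obtain i where i: "\<rho> / 2 ^ Suc i \<le> norm (x - y)" "norm (x - y) < \<rho> / 2 ^ i"
      using dyadic_annulus[of "norm (x - y)" \<rho>] by (auto simp: dist_norm)
    have "g y * riesz_kernel \<gamma> (x - y) \<le> g y * ?c i"
      using i \<rho> \<gamma> by (intro mult_left_mono riesz_kernel_le) auto
    also have "\<dots> = (\<Sum>i\<in>{i}. ?c i * (g y * indicator (ball x (\<rho> / 2 ^ i)) y))"
      using i by (simp add: dist_norm mult.commute)
    also have "\<dots> \<le> (\<Sum>i. ?c i * (g y * indicator (ball x (\<rho> / 2 ^ i)) y))"
      by (intro sum_le_suminf) auto
    finally show ?thesis using True by simp
  next
    case False
    then have *: "g y * riesz_kernel \<gamma> (x - y) * indicator (ball x \<rho>) y = 0"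
      by (auto simp: riesz_kernel_def)
    show ?thesis unfolding * by (rule zero_le)
  qed
  have "(\<integral>\<^sup>+y\<in>ball x \<rho>. g y * riesz_kernel \<gamma> (x - y) \<partial>lebesgue)
      \<le> (\<integral>\<^sup>+y. (\<Sum>i. ?c i * (g y * indicator (ball x (\<rho> / 2 ^ i)) y)) \<partial>lebesgue)"
    by (intro nn_integral_mono pt)
  also have "\<dots> = (\<Sum>i. ?c i * (\<integral>\<^sup>+y\<in>ball x (\<rho> / 2 ^ i). g y \<partial>lebesgue))"
    using g by (rule nn_integral_series_indicator) simp
  finally show ?thesis .
qed

text \<open>If y has distance at least 2^(k+1) \<rho> from y0 and x has distance below \<rho> \<le>
  2^k \<rho>, then x and y are at least 2^k \<rho> apart. The bound does not involve x, which later
  permits a supremum over the ball.\<close>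

lemma riesz_kernel_far_le:
  fixes g :: "real ^ 'n \<Rightarrow> ennreal"
  assumes \<gamma>: "\<gamma> < real CARD('n)" and \<rho>: "0 < \<rho>" and g: "g \<in> borel_measurable lebesgue"
    and x: "x \<in> ball y0 \<rho>"
  shows "(\<integral>\<^sup>+y\<in>- ball y0 (2 * \<rho>). g y * riesz_kernel \<gamma> (x - y) \<partial>lebesgue)
    \<le> (\<Sum>k. ennreal ((2 ^ k * \<rho>) powr (\<gamma> - real CARD('n))) * (\<integral>\<^sup>+y\<in>ball y0 (2 ^ (k + 2) * \<rho>). g y \<partial>lebesgue))"
proof -
  let ?c = "\<lambda>k. ennreal ((2 ^ k * \<rho>) powr (\<gamma> - real CARD('n)))"
  have pt: "g y * riesz_kernel \<gamma> (x - y) * indicator (- ball y0 (2 * \<rho>)) y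
      \<le> (\<Sum>k. ?c k * (g y * indicator (ball y0 (2 ^ (k + 2) * \<rho>)) y))" for y
  proof (cases "y \<in> ball y0 (2 * \<rho>)")
    case False
    define d where "d = dist y0 y"
    have d: "2 * \<rho> \<le> d" using False by (simp add: d_def)
    obtain m where "d / \<rho> < 2 ^ m" using real_arch_pow[of 2 "d / \<rho>"] by auto
    then have "d < 2 ^ m * \<rho>" using \<rho> by (simp add: field_simps)
    also have "\<dots> \<le> 2 ^ (m + 2) * \<rho>" using \<rho> by simp
    finally have ex: "\<exists>m. d < 2 ^ (m + 2) * \<rho>" by blast
    define k where "k = (LEAST m. d < 2 ^ (m + 2) * \<rho>)"
    have k: "d < 2 ^ (k + 2) * \<rho>" unfolding k_def using ex by (rule LeastI_ex)
    have k': "2 ^ (k + 1) * \<rho> \<le> d"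
    proof (cases k)
      case (Suc j)
      then have "\<not> d < 2 ^ (j + 2) * \<rho>"
        using not_less_Least[of j "\<lambda>m. d < 2 ^ (m + 2) * \<rho>"] by (simp add: k_def)
      then show ?thesis using Suc by simp
    qed (use d in simp)
    have "\<rho> \<le> 2 ^ k * \<rho>" using \<rho> by simp
    then have "2 ^ k * \<rho> \<le> norm (x - y)"
      using k' x dist_triangle[of y0 y x] by (simp add: d_def dist_norm)
    then have "g y * riesz_kernel \<gamma> (x - y) \<le> g y * ?c k"
      using \<rho> \<gamma> by (intro mult_left_mono riesz_kernel_le) auto
    also have "\<dots> = (\<Sum>k\<in>{k}. ?c k * (g y * indicator (ball y0 (2 ^ (k + 2) * \<rho>)) y))"
      using k by (simp add: d_def mult.commute)
    also have "\<dots> \<le> (\<Sum>k. ?c k * (g y * indicator (ball y0 (2 ^ (k + 2) * \<rho>)) y))"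
      by (intro sum_le_suminf) auto
    finally show ?thesis using False by simp
  qed simp
  have "(\<integral>\<^sup>+y\<in>- ball y0 (2 * \<rho>). g y * riesz_kernel \<gamma> (x - y) \<partial>lebesgue)
      \<le> (\<integral>\<^sup>+y. (\<Sum>k. ?c k * (g y * indicator (ball y0 (2 ^ (k + 2) * \<rho>)) y)) \<partial>lebesgue)"
    by (intro nn_integral_mono pt)
  also have "\<dots> = (\<Sum>k. ?c k * (\<integral>\<^sup>+y\<in>ball y0 (2 ^ (k + 2) * \<rho>). g y \<partial>lebesgue))"
    using g by (rule nn_integral_series_indicator) simp
  finally show ?thesis .
qed

section \<open>Balls inside cells of finitely many shifted grids\<close>

lemma floor_neq_obtains_int:
  fixes a b :: real
  assumes "\<lfloor>a\<rfloor> \<noteq> \<lfloor>b\<rfloor>" "\<bar>a - b\<bar> < h"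
  obtains m :: int where "\<bar>m - b\<bar> < h"
proof (cases "\<lfloor>a\<rfloor> < \<lfloor>b\<rfloor>")
  case True
  then have "a < \<lfloor>b\<rfloor>" by linarith
  moreover have "\<lfloor>b\<rfloor> \<le> b" by linarith
  ultimately have "\<bar>\<lfloor>b\<rfloor> - b\<bar> < h" using assms(2) by linarith
  then show ?thesis by (rule that)
next
  case False
  with assms(1) have "b < \<lfloor>a\<rfloor>" by linarith
  moreover have "\<lfloor>a\<rfloor> \<le> a" by linarith
  ultimately have "\<bar>\<lfloor>a\<rfloor> - b\<bar> < h" using assms(2) by linarith
  then show ?thesis by (rule that)
qed

text \<open>The one-third trick: multiples of \<open>R/2\<^sup>i\<close> and their translates by \<open>R/3\<close> have distance at least
  \<open>R/(3\<cdot>2\<^sup>i)\<close>, because \<open>3\<close> does not divide \<open>2\<^sup>i\<close>.\<close>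

lemma one_third_trick:
  fixes u R :: real
  assumes R: "0 < R"
  shows "(\<forall>y. \<bar>y - u\<bar> < R / 2 ^ i / 6 \<longrightarrow> \<lfloor>y * 2 ^ i / R\<rfloor> = \<lfloor>u * 2 ^ i / R\<rfloor>) \<or>
    (\<forall>y. \<bar>y - u\<bar> < R / 2 ^ i / 6 \<longrightarrow> \<lfloor>(y - R / 3) * 2 ^ i / R\<rfloor> = \<lfloor>(u - R / 3) * 2 ^ i / R\<rfloor>)"
proof (rule ccontr)
  assume "\<not> ?thesis"
  then obtain y y' where y: "\<bar>y - u\<bar> < R / 2 ^ i / 6" "\<lfloor>y * 2 ^ i / R\<rfloor> \<noteq> \<lfloor>u * 2 ^ i / R\<rfloor>"
    and y': "\<bar>y' - u\<bar> < R / 2 ^ i / 6" "\<lfloor>(y' - R / 3) * 2 ^ i / R\<rfloor> \<noteq> \<lfloor>(u - R / 3) * 2 ^ i / R\<rfloor>"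
    by blast
  define s where "s = 2 ^ i / R"
  have s: "0 < s" "R / 2 ^ i / 6 * s = 1 / 6" "R / 3 * s = 2 ^ i / 3" using R by (auto simp: s_def)
  have scale: "\<bar>z * s - u * s\<bar> < 1 / 6" if "\<bar>z - u\<bar> < R / 2 ^ i / 6" for z
  proof -
    have "\<bar>z - u\<bar> * s < R / 2 ^ i / 6 * s" using that s(1) by (rule mult_strict_right_mono)
    also have "\<bar>z - u\<bar> * s = \<bar>z * s - u * s\<bar>" using s(1) by (simp add: abs_mult left_diff_distrib[symmetric])
    finally show ?thesis using s by simp
  qed
  have *: "\<lfloor>y * s\<rfloor> \<noteq> \<lfloor>u * s\<rfloor>" using y(2) by (simp add: s_def)
  obtain m where m: "\<bar>of_int m - u * s\<bar> < 1 / 6"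
    using floor_neq_obtains_int[OF * scale[OF y(1)]] .
  have *: "\<lfloor>y' * s - 2 ^ i / 3\<rfloor> \<noteq> \<lfloor>u * s - 2 ^ i / 3\<rfloor>"
  proof -
    have "(z - R / 3) * 2 ^ i / R = z * s - 2 ^ i / 3" for z
      using R by (simp add: s_def field_simps)
    then show ?thesis using y'(2) by simp
  qed
  have "\<bar>(y' * s - 2 ^ i / 3) - (u * s - 2 ^ i / 3)\<bar> < 1 / 6"
    using scale[OF y'(1)] by simp
  then obtain m' where m': "\<bar>of_int m' - (u * s - 2 ^ i / 3)\<bar> < 1 / 6"
    using floor_neq_obtains_int[OF *] by blast
  \<comment> \<open>m is within 1/6 of u s and m' within 1/6 of u s - 2^i/3, so m - m' is within 1/3
    of 2^i/3. Tripling gives an integer of modulus below 1, that is, 0.\<close>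
  have "\<bar>of_int (3 * (m - m') - 2 ^ i)\<bar> < (1::real)" using m m' by (simp add: abs_if split: if_splits)
  then have "3 * (m - m') = 2 ^ i" by linarith
  then have dvd: "(3::int) dvd 2 ^ i" by (metis dvd_triv_left)
  have cop: "coprime (3::int) (2 ^ i)" by simp
  show False using coprime_common_divisor[OF cop dvd_refl dvd] by simp
qed

definition offset :: "real \<Rightarrow> 'n set \<Rightarrow> real ^ 'n" where
  "offset R S = (\<chi> c. if c \<in> S then R / 3 else 0)"

text \<open>The one-third trick decides each coordinate separately, so the shift must be chosen per
  coordinate: S collects the coordinates in which the unshifted grid cuts the interval. This is why
  2^n grids are used.\<close>

lemma ball_subset_shifted_cell:
  fixes x :: "real ^ 'n"
  assumes R: "0 < R"
  obtains S where "ball x (R / 2 ^ i / 6) \<subseteq> cell (offset R S) R i x"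
proof
  define S where "S = {c. \<not> (\<forall>y. \<bar>y - x $ c\<bar> < R / 2 ^ i / 6 \<longrightarrow> \<lfloor>y * 2 ^ i / R\<rfloor> = \<lfloor>x $ c * 2 ^ i / R\<rfloor>)}"
  show "ball x (R / 2 ^ i / 6) \<subseteq> cell (offset R S) R i x"
  proof
    fix y assume "y \<in> ball x (R / 2 ^ i / 6)"
    then have yx: "\<bar>y $ c - x $ c\<bar> < R / 2 ^ i / 6" for c
      using component_le_norm_cart[of "y - x" c] by (simp add: dist_norm norm_minus_commute)
    have "\<lfloor>(y $ c - offset R S $ c) * 2 ^ i / R\<rfloor> = \<lfloor>(x $ c - offset R S $ c) * 2 ^ i / R\<rfloor>" for c
    proof (cases "c \<in> S")
      case True
      then have "offset R S $ c = R / 3" by (simp add: offset_def)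
      moreover have "\<lfloor>(y $ c - R / 3) * 2 ^ i / R\<rfloor> = \<lfloor>(x $ c - R / 3) * 2 ^ i / R\<rfloor>"
        using True one_third_trick[OF R, of "x $ c" i] yx[of c] unfolding S_def by blast
      ultimately show ?thesis by (simp only:)
    next
      case False
      then have "offset R S $ c = 0" by (simp add: offset_def)
      moreover have "\<lfloor>y $ c * 2 ^ i / R\<rfloor> = \<lfloor>x $ c * 2 ^ i / R\<rfloor>"
        using False yx[of c] unfolding S_def by blast
      ultimately show ?thesis by (simp only: diff_zero)
    qed
    then show "y \<in> cell (offset R S) R i x"
      by (simp add: cell_def cell_index_def)
  qed
qed

text \<open>The top side R = 6 \<rho> makes R/2^i/6 the radius \<rho>/2^i. The kernel is taken at
  \<rho>/2^(i+1) = (R/2^i)/12, whence the power of 12. The suitable S depends on x and i, so all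
  grids are summed.\<close>

lemma riesz_kernel_near_le_cells:
  fixes g :: "real ^ 'n \<Rightarrow> ennreal"
  assumes \<gamma>: "\<gamma> < real CARD('n)" and \<rho>: "0 < \<rho>" and g: "g \<in> borel_measurable lebesgue"
  shows "(\<integral>\<^sup>+y\<in>ball x \<rho>. g y * riesz_kernel \<gamma> (x - y) \<partial>lebesgue)
    \<le> ennreal (12 powr (real CARD('n) - \<gamma>)) *
      (\<Sum>S\<in>UNIV. \<Sum>i. cell_potential \<gamma> g (offset (6 * \<rho>) S) (6 * \<rho>) i x)"
proof -
  let ?e = "\<gamma> - real CARD('n)" and ?R = "6 * \<rho>"
  have summand: "ennreal ((\<rho> / 2 ^ Suc i) powr ?e) * (\<integral>\<^sup>+y\<in>ball x (\<rho> / 2 ^ i). g y \<partial>lebesgue)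
      \<le> ennreal (12 powr (- ?e)) * (\<Sum>S\<in>UNIV. cell_potential \<gamma> g (offset ?R S) ?R i x)" for i
  proof -
    obtain S where S: "ball x (?R / 2 ^ i / 6) \<subseteq> cell (offset ?R S) ?R i x"
      using ball_subset_shifted_cell[of ?R x i] \<rho> by auto
    have half: "\<rho> / 2 ^ Suc i = ?R / 2 ^ i / 12" by simp
    have "(\<rho> / 2 ^ Suc i) powr ?e = (?R / 2 ^ i) powr ?e / 12 powr ?e"
      unfolding half by (rule powr_divide)
    also have "\<dots> = 12 powr (- ?e) * (?R / 2 ^ i) powr ?e"
      unfolding powr_minus by (simp only: divide_inverse mult.commute)
    finally have "ennreal ((\<rho> / 2 ^ Suc i) powr ?e) * (\<integral>\<^sup>+y\<in>ball x (\<rho> / 2 ^ i). g y \<partial>lebesgue)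
        = ennreal (12 powr (- ?e)) * (ennreal ((?R / 2 ^ i) powr ?e) * (\<integral>\<^sup>+y\<in>ball x (\<rho> / 2 ^ i). g y \<partial>lebesgue))"
      by (simp add: ennreal_mult mult.assoc)
    also have "\<dots> \<le> ennreal (12 powr (- ?e)) * cell_potential \<gamma> g (offset ?R S) ?R i x"
      unfolding cell_potential_def using S
      by (intro mult_left_mono nn_integral_mono) (auto simp: indicator_def)
    also have "\<dots> \<le> ennreal (12 powr (- ?e)) * (\<Sum>S\<in>UNIV. cell_potential \<gamma> g (offset ?R S) ?R i x)"
      by (intro mult_left_mono member_le_sum) auto
    finally show ?thesis .
  qed
  have "(\<integral>\<^sup>+y\<in>ball x \<rho>. g y * riesz_kernel \<gamma> (x - y) \<partial>lebesgue)
      \<le> (\<Sum>i. ennreal (12 powr (- ?e)) * (\<Sum>S\<in>UNIV. cell_potential \<gamma> g (offset ?R S) ?R i x))"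
    by (rule order_trans[OF riesz_kernel_near_le[OF \<gamma> \<rho> g]]) (intro suminf_le summand, auto)
  also have "\<dots> = ennreal (12 powr (- ?e)) * (\<Sum>S\<in>UNIV. \<Sum>i. cell_potential \<gamma> g (offset ?R S) ?R i x)"
    by (simp add: suminf_sum)
  finally show ?thesis by simp
qed

text \<open>Cutting the kernel at distance \<rho> lets grids of top side 6 \<rho> dominate it. K1
  and K2 do not depend on \<rho>, because the estimate for one cube is uniform over all
  cubes.\<close>

lemma (in bump_pair) riesz_local_weak_type:
  obtains K1 K2 :: real where "0 < K1" "0 < K2"
    "\<And>\<rho> t g. 0 < \<rho> \<Longrightarrow> 0 < t \<Longrightarrow> g \<in> borel_measurable lebesgue \<Longrightarrow>
      ennreal (t powr p) * emeasure (wmeasure w)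
        {x. ennreal (K1 * t) < (\<integral>\<^sup>+y\<in>ball x \<rho>. g y * riesz_kernel \<gamma> (x - y) \<partial>lebesgue)}
      \<le> ennreal K2 * (\<integral>\<^sup>+x. g x epowr p * ennreal (\<nu> x) \<partial>lebesgue)"
proof -
  define \<delta> where "\<delta> = 1 - 1 / r"
  have \<delta>: "0 < \<delta>" "\<delta> \<le> 1" using r by (auto simp: \<delta>_def)
  obtain c where c0: "(1 + p) / (\<gamma> * \<delta>) < real c" using reals_Archimedean2 by blast
  have "0 < (1 + p) / (\<gamma> * \<delta>)" using p \<gamma> \<delta> by simp
  then have c: "0 < real c" "1 + p \<le> real c * \<gamma> * \<delta>"
    using c0 \<gamma> \<delta> by (linarith, simp add: field_simps)
  define m where "m = real (card (UNIV :: 'n set set))"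
  have m: "0 < m" unfolding m_def by (simp add: card_gt_0_iff)
  define b where "b = 12 powr (real CARD('n) - \<gamma>)"
  have b: "0 < b" by (simp add: b_def)
  \<comment> \<open>Where none of the m dyadic sums exceeds 4 c t, the truncated integral is at most
    b m (4 c t) = K1 t.\<close>
  define K1 where "K1 = b * m * (4 * real c)"
  define D where "D = enn2real (ennreal C0 epowr p)"
  have "ennreal C0 epowr p \<noteq> \<infinity>" using p epowr_eq_top_iff[of p "ennreal C0"] by simp
  then have D: "ennreal C0 epowr p = ennreal D" by (simp add: D_def less_top)
  have D0: "0 \<le> D" by (simp add: D_def)
  \<comment> \<open>The summand 1 keeps K2 positive when D = 0.\<close>
  define K2 where "K2 = m * (3 * D) + 1"
  show ?thesis
  proof (rule that[of K1 K2])
    show "0 < K1" using b m c by (simp add: K1_def)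
    show "0 < K2" using m D0 unfolding K2_def by (intro add_nonneg_pos mult_nonneg_nonneg) auto
    fix \<rho> t :: real and g :: "real ^ 'n \<Rightarrow> ennreal"
    assume \<rho>: "0 < \<rho>" and t: "0 < t" and g [measurable]: "g \<in> borel_measurable lebesgue"
    define R where "R = 6 * \<rho>"
    have R: "0 < R" using \<rho> by (simp add: R_def)
    define N where "N = density lebesgue (\<lambda>x. g x epowr p * ennreal (\<nu> x))"
    have N_sets: "sets N = sets lebesgue" by (simp add: N_def)
    have NA: "emeasure N A = (\<integral>\<^sup>+x\<in>A. g x epowr p * ennreal (\<nu> x) \<partial>lebesgue)" if "A \<in> sets lebesgue" for A
      unfolding N_def using that by (intro emeasure_density) auto
    let ?I = "\<lambda>x. \<integral>\<^sup>+y\<in>ball x \<rho>. g y * riesz_kernel \<gamma> (x - y) \<partial>lebesgue"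
    let ?P = "\<lambda>S x. \<Sum>i. cell_potential \<gamma> g (offset R S) R i x"
    define E where "E S = {x. ennreal (4 * real c * t) < ?P S x}" for S
    have E_sets: "E S \<in> sets lebesgue" for S
    proof -
      have "{x \<in> space lebesgue. ennreal (4 * real c * t) < ?P S x} \<in> sets lebesgue" by measurable
      then show ?thesis by (simp add: E_def)
    qed
    have weak: "ennreal (t powr p) * emeasure (wmeasure w) (E S) \<le> 3 * ennreal D * emeasure N UNIV" for S
      unfolding E_def
    proof (rule weak_type_cell_potential[OF R \<gamma>(1) \<delta> _ g sets_wmeasure N_sets _ t c(2)])
      show "0 < p" using p by simp
      fix i x A \<theta> u
      let ?Q = "cell (offset R S) R i x"
      assume A: "A \<in> sets lebesgue" "A \<subseteq> ?Q" and \<theta>: "0 < \<theta>" and u: "0 < u"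
        and AQ: "emeasure lebesgue A \<le> ennreal \<theta> * emeasure lebesgue ?Q"
        and less: "ennreal u < cell_potential \<gamma> g (offset R S) R i x"
      obtain a where a: "?Q \<subseteq> cube a (R / 2 ^ i)" using cell_box_bounds[OF R] by metis
      have "ennreal (u powr p) * emeasure (wmeasure w) A
          \<le> (cell_potential \<gamma> g (offset R S) R i x) epowr p * emeasure (wmeasure w) A"
      proof (intro mult_right_mono)
        have "ennreal (u powr p) = ennreal u epowr p" using u by (simp add: epowr_ennreal)
        also have "\<dots> \<le> (cell_potential \<gamma> g (offset R S) R i x) epowr p"
          using p less by (intro epowr_mono) auto
        finally show "ennreal (u powr p) \<le> (cell_potential \<gamma> g (offset R S) R i x) epowr p" .
      qed auto
      also have "\<dots> \<le> ennreal (\<theta> powr (1 - 1 / r)) * ennreal C0 epowr p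
          * (\<integral>\<^sup>+x\<in>?Q. g x epowr p * ennreal (\<nu> x) \<partial>lebesgue)"
        unfolding cell_potential_def
        by (rule cube_estimate_wmeasure[where a=a, OF _ g cell_sets A(1) a _ \<theta> AQ[unfolded emeasure_cell[OF R]]])
          (use R A a in auto)
      finally show "ennreal (u powr p) * emeasure (wmeasure w) A \<le> ennreal (\<theta> powr \<delta>) * ennreal D * emeasure N ?Q"
        by (simp add: \<delta>_def D NA cell_sets)
    qed
    have "{x. ennreal (K1 * t) < ?I x} \<subseteq> (\<Union>S. E S)"
    proof (rule subsetI, rule ccontr)
      fix x assume x: "x \<in> {x. ennreal (K1 * t) < ?I x}" "x \<notin> (\<Union>S. E S)"
      have "?I x \<le> ennreal b * (\<Sum>S\<in>UNIV. ?P S x)"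
        using riesz_kernel_near_le_cells[OF \<gamma>(2) \<rho> g, of x] by (simp add: b_def R_def)
      also have "\<dots> \<le> ennreal b * (\<Sum>S\<in>(UNIV :: 'n set set). ennreal (4 * real c * t))"
        using x(2) by (intro mult_left_mono sum_mono) (auto simp: E_def not_less)
      also have "\<dots> = ennreal b * (ennreal m * ennreal (4 * real c * t))"
        unfolding m_def by (simp add: ennreal_of_nat_eq_real_of_nat)
      also have "\<dots> = ennreal (K1 * t)"
        using b m t by (simp add: K1_def mult.assoc flip: ennreal_mult)
      finally show False using x(1) by simp
    qed
    then have "emeasure (wmeasure w) {x. ennreal (K1 * t) < ?I x} \<le> emeasure (wmeasure w) (\<Union>S. E S)"
      by (intro emeasure_mono) (auto intro!: sets.finite_UN E_sets)
    also have "\<dots> \<le> (\<Sum>S\<in>UNIV. emeasure (wmeasure w) (E S))"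
      by (intro emeasure_subadditive_finite) (auto simp: E_sets)
    finally have "ennreal (t powr p) * emeasure (wmeasure w) {x. ennreal (K1 * t) < ?I x}
        \<le> ennreal (t powr p) * (\<Sum>S\<in>UNIV. emeasure (wmeasure w) (E S))"
      by (intro mult_left_mono) auto
    also have "\<dots> \<le> (\<Sum>S\<in>(UNIV :: 'n set set). 3 * ennreal D * emeasure N UNIV)"
      unfolding sum_distrib_left by (intro sum_mono weak)
    also have "\<dots> = ennreal (m * (3 * D)) * emeasure N UNIV"
      unfolding m_def using D0 by (simp add: ennreal_of_nat_eq_real_of_nat ennreal_mult mult.assoc)
    also have "\<dots> \<le> ennreal K2 * emeasure N UNIV"
      by (intro mult_right_mono ennreal_leI) (auto simp: K2_def)
    also have "emeasure N UNIV = (\<integral>\<^sup>+x. g x epowr p * ennreal (\<nu> x) \<partial>lebesgue)"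
      using NA[of UNIV] sets.top[of "lebesgue :: (real ^ 'n) measure"] by simp
    finally show "ennreal (t powr p) * emeasure (wmeasure w) {x. ennreal (K1 * t) < ?I x}
      \<le> ennreal K2 * (\<integral>\<^sup>+x. g x epowr p * ennreal (\<nu> x) \<partial>lebesgue)" .
  qed
qed

section \<open>Local finiteness and doubling\<close>

lemma sigma_finite_lebesgue: "sigma_finite_measure (lebesgue :: 'a::euclidean_space measure)"
proof
  show "\<exists>A. countable A \<and> A \<subseteq> sets lebesgue \<and> \<Union>A = space (lebesgue :: 'a measure) \<and>
      (\<forall>a\<in>A. emeasure lebesgue a \<noteq> \<infinity>)"
  proof (intro exI[of _ "range (\<lambda>n. cball (0::'a) (real n))"] conjI ballI)
    show "\<Union>(range (\<lambda>n. cball (0::'a) (real n))) = space lebesgue"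
      using real_arch_simple by auto
    fix a assume "a \<in> range (\<lambda>n. cball (0::'a) (real n))"
    then obtain n where "a = cball 0 (real n)" by auto
    then show "emeasure lebesgue a \<noteq> \<infinity>"
      using emeasure_bounded_finite[of "cball (0::'a) (real n)"] by auto
  qed auto
qed

text \<open>The product of two Lebesgue sigma-algebras is not the Lebesgue sigma-algebra of the
  product space. Joint measurability is therefore assembled from Borel kernels in (x, y) and
  functions of one coordinate.\<close>

lemma measurable_lebesgue_pair_borel:
  fixes h :: "'a::euclidean_space \<Rightarrow> 'a \<Rightarrow> 'b::topological_space"
  assumes "case_prod h \<in> borel_measurable borel"
  shows "case_prod h \<in> borel_measurable (lebesgue \<Otimes>\<^sub>M lebesgue)"
proof -
  have id: "(\<lambda>x. x) \<in> lebesgue \<rightarrow>\<^sub>M (borel :: 'a measure)"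
    by (rule measurable_completion) simp
  have "(\<lambda>z. (fst z, snd z)) \<in> lebesgue \<Otimes>\<^sub>M lebesgue \<rightarrow>\<^sub>M (borel :: ('a \<times> 'a) measure)"
    unfolding borel_prod[symmetric]
    by (intro measurable_Pair measurable_compose[OF measurable_fst id] measurable_compose[OF measurable_snd id])
  from measurable_compose[OF this assms] show ?thesis by simp
qed

lemma measurable_ball_integral:
  fixes h :: "'a::euclidean_space \<Rightarrow> ennreal"
  assumes [measurable]: "h \<in> borel_measurable lebesgue"
  shows "(\<lambda>y. \<integral>\<^sup>+x\<in>ball y r. h x \<partial>lebesgue) \<in> borel_measurable lebesgue"
proof -
  interpret sigma_finite_measure "lebesgue :: 'a measure" by (rule sigma_finite_lebesgue)
  have "open {z :: 'a \<times> 'a. dist (fst z) (snd z) < r}"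
    by (intro open_Collect_less continuous_intros)
  then have "(\<lambda>z. indicator {z :: 'a \<times> 'a. dist (fst z) (snd z) < r} z :: ennreal) \<in> borel_measurable borel"
    by (intro borel_measurable_indicator) auto
  moreover have "case_prod (\<lambda>y x. indicator (ball y r) x) =
      (\<lambda>z. indicator {z :: 'a \<times> 'a. dist (fst z) (snd z) < r} z :: ennreal)"
    by (auto simp: indicator_def fun_eq_iff)
  ultimately have "case_prod (\<lambda>y x. indicator (ball (y::'a) r) x :: ennreal) \<in> borel_measurable (lebesgue \<Otimes>\<^sub>M lebesgue)"
    by (intro measurable_lebesgue_pair_borel) simp
  then have ind: "(\<lambda>z. indicator (ball (fst z) r) (snd z) :: ennreal)
      \<in> borel_measurable (lebesgue \<Otimes>\<^sub>M (lebesgue :: 'a measure))"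
    unfolding case_prod_unfold .
  have "(\<lambda>z. h (snd z)) \<in> borel_measurable ((lebesgue :: 'a measure) \<Otimes>\<^sub>M (lebesgue :: 'a measure))"
    by (rule measurable_compose[OF measurable_snd assms])
  from borel_measurable_times_ennreal[OF this ind]
  have "case_prod (\<lambda>y x. h x * indicator (ball y r) x) \<in> borel_measurable (lebesgue \<Otimes>\<^sub>M lebesgue)"
    unfolding case_prod_unfold .
  then show ?thesis by (rule borel_measurable_nn_integral)
qed

lemma measurable_diff_borel: "(\<lambda>z :: 'a::euclidean_space \<times> 'a. fst z - snd z) \<in> borel_measurable borel"
  by (intro borel_measurable_continuous_onI continuous_intros)

lemma emeasure_ball_le:
  fixes x :: "real ^ 'n"
  assumes "0 \<le> s"
  shows "emeasure lebesgue (ball x s) \<le> ennreal ((2 * s) ^ CARD('n))"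
    and "ball x s \<subseteq> cube (\<chi> i. x $ i - s) (2 * s)"
proof -
  show *: "ball x s \<subseteq> cube (\<chi> i. x $ i - s) (2 * s)"
  proof
    fix y assume "y \<in> ball x s"
    then have "\<bar>(y - x) $ i\<bar> \<le> s" for i
      using component_le_norm_cart[of "y - x" i] by (simp add: dist_norm norm_minus_commute)
    then have "x $ i - s \<le> y $ i \<and> y $ i \<le> x $ i - s + 2 * s" for i
      by (simp add: abs_le_iff) (smt (verit))
    then show "y \<in> cube (\<chi> i. x $ i - s) (2 * s)"
      by (simp add: cube_def mem_box_cart)
  qed
  have "emeasure lebesgue (ball x s) \<le> emeasure lebesgue (cube (\<chi> i. x $ i - s) (2 * s))"
    by (intro emeasure_mono *) (simp add: cube_def)
  also have "\<dots> = ennreal ((2 * s) ^ CARD('n))"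
    by (intro emeasure_cube) (use assms in simp)
  finally show "emeasure lebesgue (ball x s) \<le> ennreal ((2 * s) ^ CARD('n))" .
qed

text \<open>With s = \<rho>/2^(i+1) the i-th term is of order s^(\<gamma>-n) s^n = s^\<gamma>, so
  the series is geometric with ratio 2^(-\<gamma>). The power of 4 comes from enclosing the ball of
  radius 2 s in a cube of side 4 s.\<close>

lemma riesz_kernel_integral_finite:
  assumes \<gamma>: "0 < \<gamma>" "\<gamma> < real CARD('n)" and \<rho>: "0 < \<rho>"
  obtains A :: real where
    "\<And>y :: real ^ 'n. (\<integral>\<^sup>+x\<in>ball y \<rho>. riesz_kernel \<gamma> (y - x) \<partial>lebesgue) \<le> ennreal A"
proof -
  let ?n = "real CARD('n)"
  define q where "q = 2 powr (- \<gamma>)"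
  have q: "0 < q" "q < 1" using \<gamma> by (auto simp: q_def powr_less_one)
  define A where "A = 4 powr ?n * (\<rho> / 2) powr \<gamma>"
  have "(\<integral>\<^sup>+x\<in>ball y \<rho>. riesz_kernel \<gamma> (y - x) \<partial>lebesgue) \<le> ennreal (A * (1 / (1 - q)))" for y :: "real ^ 'n"
  proof -
    have "(\<integral>\<^sup>+x\<in>ball y \<rho>. riesz_kernel \<gamma> (y - x) \<partial>lebesgue)
        \<le> (\<Sum>i. ennreal ((\<rho> / 2 ^ Suc i) powr (\<gamma> - ?n)) * emeasure lebesgue (ball y (\<rho> / 2 ^ i)))"
      using riesz_kernel_near_le[OF \<gamma>(2) \<rho>, of "\<lambda>_. 1" y] by simp
    also have "\<dots> \<le> (\<Sum>i. ennreal (A * q ^ i))"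
    proof (intro suminf_le)
      fix i
      define s where "s = \<rho> / 2 ^ Suc i"
      have s: "0 < s" using \<rho> by (simp add: s_def)
      have "ennreal (s powr (\<gamma> - ?n)) * emeasure lebesgue (ball y (\<rho> / 2 ^ i))
          \<le> ennreal (s powr (\<gamma> - ?n)) * ennreal ((4 * s) powr ?n)"
        using emeasure_ball_le(1)[of "\<rho> / 2 ^ i" y] \<rho>
        by (intro mult_left_mono) (auto simp: s_def powr_realpow)
      also have "\<dots> = ennreal (4 powr ?n * s powr \<gamma>)"
      proof -
        have "s powr (\<gamma> - ?n) * (4 * s) powr ?n = 4 powr ?n * (s powr (\<gamma> - ?n) * s powr ?n)"
          using s by (simp add: powr_mult)
        also have "s powr (\<gamma> - ?n) * s powr ?n = s powr \<gamma>" by (simp add: powr_add[symmetric])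
        finally show ?thesis by (simp flip: ennreal_mult)
      qed
      also have "s powr \<gamma> = (\<rho> / 2) powr \<gamma> * q ^ i"
      proof -
        have s_eq: "s = (\<rho> / 2) * 2 powr (- real i)"
          by (simp add: s_def powr_minus powr_realpow field_simps)
        have "s powr \<gamma> = (\<rho> / 2) powr \<gamma> * 2 powr (- real i * \<gamma>)"
          unfolding s_eq by (simp only: powr_mult powr_powr)
        also have "2 powr (- real i * \<gamma>) = q ^ i"
          by (simp add: q_def powr_realpow[symmetric] powr_powr mult.commute)
        finally show ?thesis .
      qed
      finally show "ennreal ((\<rho> / 2 ^ Suc i) powr (\<gamma> - ?n)) * emeasure lebesgue (ball y (\<rho> / 2 ^ i)) \<le> ennreal (A * q ^ i)"
        by (simp add: s_def A_def mult.assoc)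
    qed auto
    also have "\<dots> = ennreal (A * (1 / (1 - q)))"
    proof (rule suminf_ennreal_eq)
      show "(\<lambda>i. A * q ^ i) sums (A * (1 / (1 - q)))"
        using q by (intro sums_mult geometric_sums) simp
    qed (use q in \<open>simp add: A_def\<close>)
    finally show ?thesis .
  qed
  then show ?thesis by (rule that)
qed

text \<open>In \<open>h\<close> the cutoff is written in terms of x - y, so that kernel and cutoff
  together are a Borel function composed with subtraction.\<close>

lemma
  fixes g :: "real ^ 'n \<Rightarrow> ennreal" and \<gamma> \<rho> :: real
  assumes g: "g \<in> borel_measurable lebesgue"
  defines "h \<equiv> \<lambda>x y. g y * (riesz_kernel \<gamma> (x - y) * indicator (ball 0 \<rho>) (x - y))"
  shows measurable_riesz_near_pair: "case_prod h \<in> borel_measurable (lebesgue \<Otimes>\<^sub>M lebesgue)"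
    and riesz_near_eq: "(\<integral>\<^sup>+y. h x y \<partial>lebesgue) = (\<integral>\<^sup>+y\<in>ball x \<rho>. g y * riesz_kernel \<gamma> (x - y) \<partial>lebesgue)"
    and measurable_riesz_near:
      "(\<lambda>x. \<integral>\<^sup>+y\<in>ball x \<rho>. g y * riesz_kernel \<gamma> (x - y) \<partial>lebesgue) \<in> borel_measurable lebesgue"
proof -
  interpret L: sigma_finite_measure "lebesgue :: (real ^ 'n) measure" by (rule sigma_finite_lebesgue)
  have "case_prod (\<lambda>x y. riesz_kernel \<gamma> (x - y) * indicator (ball 0 \<rho>) (x - y :: real ^ 'n))
      \<in> borel_measurable (lebesgue \<Otimes>\<^sub>M lebesgue)"
  proof (rule measurable_lebesgue_pair_borel)
    have "(\<lambda>z. riesz_kernel \<gamma> (fst z - snd z :: real ^ 'n) * indicator (ball 0 \<rho>) (fst z - snd z)) \<in> borel_measurable borel"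
      by (intro borel_measurable_times_ennreal measurable_compose[OF measurable_diff_borel measurable_riesz_kernel]
          measurable_compose[OF measurable_diff_borel borel_measurable_indicator]) simp
    then show "case_prod (\<lambda>x y. riesz_kernel \<gamma> (x - y :: real ^ 'n) * indicator (ball 0 \<rho>) (x - y)) \<in> borel_measurable borel"
      by (simp add: case_prod_beta)
  qed
  then have K: "(\<lambda>z. riesz_kernel \<gamma> (fst z - snd z :: real ^ 'n) * indicator (ball 0 \<rho>) (fst z - snd z))
      \<in> borel_measurable (lebesgue \<Otimes>\<^sub>M lebesgue)"
    unfolding case_prod_unfold .
  have "(\<lambda>z. g (snd z)) \<in> borel_measurable ((lebesgue :: (real ^ 'n) measure) \<Otimes>\<^sub>M (lebesgue :: (real ^ 'n) measure))"
    by (rule measurable_compose[OF measurable_snd g])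
  from borel_measurable_times_ennreal[OF this K]
  have h_meas: "case_prod h \<in> borel_measurable (lebesgue \<Otimes>\<^sub>M lebesgue)"
    unfolding case_prod_unfold h_def .
  then show "case_prod h \<in> borel_measurable (lebesgue \<Otimes>\<^sub>M lebesgue)" .
  have eq: "(\<integral>\<^sup>+y. h x y \<partial>lebesgue) = (\<integral>\<^sup>+y\<in>ball x \<rho>. g y * riesz_kernel \<gamma> (x - y) \<partial>lebesgue)" for x
    by (intro nn_integral_cong) (simp add: h_def dist_norm indicator_def norm_minus_commute)
  then show "(\<integral>\<^sup>+y. h x y \<partial>lebesgue) = (\<integral>\<^sup>+y\<in>ball x \<rho>. g y * riesz_kernel \<gamma> (x - y) \<partial>lebesgue)" .
  show "(\<lambda>x. \<integral>\<^sup>+y\<in>ball x \<rho>. g y * riesz_kernel \<gamma> (x - y) \<partial>lebesgue) \<in> borel_measurable lebesgue"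
    using L.borel_measurable_nn_integral[OF h_meas] unfolding eq .
qed

text \<open>By Tonelli the integral over x is at most A times the integral of g, since the kernel is
  even and its integrals over balls of radius \<rho> have a common bound A.\<close>

lemma riesz_near_finite_AE:
  fixes g :: "real ^ 'n \<Rightarrow> ennreal"
  assumes \<gamma>: "0 < \<gamma>" "\<gamma> < real CARD('n)" and \<rho>: "0 < \<rho>"
    and g: "g \<in> borel_measurable lebesgue" and fin: "(\<integral>\<^sup>+y. g y \<partial>lebesgue) < \<infinity>"
  shows "AE x in lebesgue. (\<integral>\<^sup>+y\<in>ball x \<rho>. g y * riesz_kernel \<gamma> (x - y) \<partial>lebesgue) < \<infinity>"
proof -
  interpret L: sigma_finite_measure "lebesgue :: (real ^ 'n) measure" by (rule sigma_finite_lebesgue)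
  interpret LL: pair_sigma_finite "lebesgue :: (real ^ 'n) measure" "lebesgue :: (real ^ 'n) measure" ..
  obtain A where A: "\<And>y :: real ^ 'n. (\<integral>\<^sup>+x\<in>ball y \<rho>. riesz_kernel \<gamma> (y - x) \<partial>lebesgue) \<le> ennreal A"
    using riesz_kernel_integral_finite[OF \<gamma> \<rho>] by metis
  define h where "h x y = g y * (riesz_kernel \<gamma> (x - y) * indicator (ball 0 \<rho>) (x - y))" for x y
  have h: "case_prod h \<in> borel_measurable (lebesgue \<Otimes>\<^sub>M lebesgue)"
    unfolding h_def by (rule measurable_riesz_near_pair[OF g])
  have "(\<integral>\<^sup>+x. \<integral>\<^sup>+y. h x y \<partial>lebesgue \<partial>lebesgue) = (\<integral>\<^sup>+y. \<integral>\<^sup>+x. h x y \<partial>lebesgue \<partial>lebesgue)"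
    using LL.Fubini'[OF h] by simp
  also have "\<dots> = (\<integral>\<^sup>+y. g y * (\<integral>\<^sup>+x\<in>ball y \<rho>. riesz_kernel \<gamma> (y - x) \<partial>lebesgue) \<partial>lebesgue)"
  proof (intro nn_integral_cong)
    fix y :: "real ^ 'n"
    have "(\<lambda>x. riesz_kernel \<gamma> (y - x)) \<in> borel_measurable lebesgue"
      by (intro measurable_completion) measurable
    then have m: "(\<lambda>x. riesz_kernel \<gamma> (y - x) * indicator (ball y \<rho>) x) \<in> borel_measurable lebesgue"
      by (intro borel_measurable_times_ennreal borel_measurable_indicator) auto
    have "h x y = g y * (riesz_kernel \<gamma> (y - x) * indicator (ball y \<rho>) x)" for x
      by (simp add: h_def riesz_kernel_def norm_minus_commute dist_norm indicator_def)
    then show "(\<integral>\<^sup>+x. h x y \<partial>lebesgue) = g y * (\<integral>\<^sup>+x\<in>ball y \<rho>. riesz_kernel \<gamma> (y - x) \<partial>lebesgue)"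
      using m by (simp add: nn_integral_cmult)
  qed
  also have "\<dots> \<le> (\<integral>\<^sup>+y. g y * ennreal A \<partial>lebesgue)"
    by (intro nn_integral_mono mult_left_mono A) auto
  also have "\<dots> = (\<integral>\<^sup>+y. g y \<partial>lebesgue) * ennreal A"
    using g by (rule nn_integral_multc)
  also have "\<dots> < \<infinity>"
    using fin by (simp add: ennreal_mult_less_top)
  finally have "(\<integral>\<^sup>+x. \<integral>\<^sup>+y. h x y \<partial>lebesgue \<partial>lebesgue) \<noteq> \<infinity>" by simp
  then have "(\<integral>\<^sup>+x. (\<integral>\<^sup>+y\<in>ball x \<rho>. g y * riesz_kernel \<gamma> (x - y) \<partial>lebesgue) \<partial>lebesgue) \<noteq> \<infinity>"
    unfolding h_def riesz_near_eq[OF g] .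
  then have "AE x in lebesgue. (\<integral>\<^sup>+y\<in>ball x \<rho>. g y * riesz_kernel \<gamma> (x - y) \<partial>lebesgue) \<noteq> \<infinity>"
    by (intro nn_integral_PInf_AE measurable_riesz_near[OF g])
  then show ?thesis by (simp add: less_top)
qed

section \<open>Doubling and reverse doubling\<close>

lemma Delta2_power:
  assumes C: "\<And>y r. 0 < r \<Longrightarrow> emeasure M (ball y (2 * r)) \<le> ennreal C * emeasure M (ball (y :: 'a::euclidean_space) r)"
    and r: "0 < r"
  shows "emeasure M (ball y (2 ^ k * r)) \<le> ennreal C ^ k * emeasure M (ball y r)"
proof (induction k)
  case (Suc k)
  have "emeasure M (ball y (2 ^ Suc k * r)) \<le> ennreal C * emeasure M (ball y (2 ^ k * r))"
    using C[of "2 ^ k * r" y] r by (simp add: mult.assoc)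
  also have "\<dots> \<le> ennreal C * (ennreal C ^ k * emeasure M (ball y r))"
    by (intro mult_left_mono Suc.IH) auto
  finally show ?case by (simp add: mult.assoc)
qed simp

text \<open>If one ball were null, doubling would make all its dilates by 2^k null, and these
  exhaust the space.\<close>

lemma Delta2_ball_pos:
  assumes w: "Delta2 w" "\<not> null_weight w" and r: "0 < r"
  shows "emeasure (wmeasure w) (ball y r) \<noteq> 0"
proof
  assume 0: "emeasure (wmeasure w) (ball y r) = 0"
  have weight: "weight w" using w by (simp add: Delta2_def)
  obtain C where C: "\<And>y r. 0 < r \<Longrightarrow> emeasure (wmeasure w) (ball y (2 * r)) \<le> ennreal C * emeasure (wmeasure w) (ball y r)"
    using w by (auto simp: Delta2_def)
  have "emeasure (wmeasure w) (ball y (2 ^ k * r)) = 0" for k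
    using Delta2_power[of "wmeasure w", OF C r, of y k] 0 by simp
  then have null: "(\<Union>k. ball y (2 ^ k * r)) \<in> null_sets (wmeasure w)"
    by (intro null_sets_UN) (auto simp: null_sets_def)
  have "(\<Union>k. ball y (2 ^ k * r)) = UNIV"
  proof (intro equalityI subset_UNIV subsetI)
    fix x
    obtain k where "dist y x / r < 2 ^ k" using real_arch_pow[of 2 "dist y x / r"] by auto
    then have "x \<in> ball y (2 ^ k * r)" using r by (simp add: field_simps)
    then show "x \<in> (\<Union>k. ball y (2 ^ k * r))" by blast
  qed
  with null have "emeasure (wmeasure w) UNIV = 0" by auto
  then have "AE x in lebesgue. ennreal (w x) * indicator UNIV x = 0"
    using weight_measurable[OF weight] sets.top[of "lebesgue :: 'a measure"]
    by (subst (asm) emeasure_wmeasure[OF weight]) (auto simp: nn_integral_0_iff_AE)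
  moreover have "0 \<le> w x" for x using weight by (simp add: weight_def)
  ultimately have "AE x in lebesgue. w x = 0"
    by (auto simp: ennreal_eq_0_iff intro: antisym elim!: eventually_mono)
  with w show False by (simp add: null_weight_def)
qed

text \<open>Reverse doubling: the ball \<open>B(y,2r)\<close> contains a ball of radius \<open>r/2\<close> that misses \<open>B(y,r)\<close>, and eight times
  that ball covers \<open>B(y,r)\<close>.\<close>

lemma Delta2_reverse_doubling:
  fixes w :: "'a::euclidean_space \<Rightarrow> real"
  assumes "Delta2 w"
  obtains \<theta> where "0 < \<theta>" "\<theta> < 1"
    "\<And>y r k. 0 < r \<Longrightarrow> emeasure (wmeasure w) (ball y r) \<le> ennreal (\<theta> ^ k) * emeasure (wmeasure w) (ball y (2 ^ k * r))"
proof -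
  let ?m = "\<lambda>y r. emeasure (wmeasure w) (ball y r)"
  obtain C where C0: "0 < C" and C: "\<And>y r. 0 < r \<Longrightarrow> ?m y (2 * r) \<le> ennreal C * ?m y r"
    using assms by (auto simp: Delta2_def)
  have fin: "?m y r \<noteq> \<infinity>" for y r
    using assms by (intro emeasure_wmeasure_ball_finite) (simp add: Delta2_def)
  \<comment> \<open>With a, b, c the measures of B(y,r), B(z,r/2), B(y,2r), the two facts a + b
    \<le> c and a \<le> C^3 b give a (1 + C^3) \<le> C^3 c.\<close>
  define \<theta> where "\<theta> = C ^ 3 / (1 + C ^ 3)"
  have \<theta>: "0 < \<theta>" "\<theta> < 1" using C0 by (auto simp: \<theta>_def divide_less_eq add_pos_pos)
  have step: "?m y r \<le> ennreal \<theta> * ?m y (2 * r)" if r: "0 < r" for y r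
  proof -
    obtain e :: 'a where e: "norm e = 1" using vector_choose_size[of 1] by auto
    define z where "z = y + (3 / 2 * r) *\<^sub>R e"
    have yz: "dist y z = 3 / 2 * r" using e r by (simp add: z_def dist_norm)
    have "?m y r + ?m z (r / 2) = emeasure (wmeasure w) (ball y r \<union> ball z (r / 2))"
    proof (rule plus_emeasure)
      show "ball y r \<inter> ball z (r / 2) = {}"
      proof (rule equals0I)
        fix x assume "x \<in> ball y r \<inter> ball z (r / 2)"
        then show False using yz dist_triangle2[of y z x] by auto
      qed
    qed auto
    also have "\<dots> \<le> ?m y (2 * r)"
    proof (intro emeasure_mono)
      show "ball y r \<union> ball z (r / 2) \<subseteq> ball y (2 * r)"
      proof
        fix x assume "x \<in> ball y r \<union> ball z (r / 2)"
        then show "x \<in> ball y (2 * r)" using yz r dist_triangle[of y x z] by auto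
      qed
    qed auto
    finally have sum: "?m y r + ?m z (r / 2) \<le> ?m y (2 * r)" .
    \<comment> \<open>B(y,r) reaches up to distance 5r/2 from z; two doublings of r/2 give only 2r,
      three give 4r.\<close>
    have "?m y r \<le> ?m z (2 ^ 3 * (r / 2))"
    proof (intro emeasure_mono subsetI)
      fix x assume "x \<in> ball y r"
      then show "x \<in> ball z (2 ^ 3 * (r / 2))"
        using yz r dist_triangle[of z x y] by (auto simp: dist_commute)
    qed auto
    also have "\<dots> \<le> ennreal C ^ 3 * ?m z (r / 2)"
      using Delta2_power[of "wmeasure w", OF C, of "r / 2" z 3] r by simp
    finally have le: "?m y r \<le> ennreal C ^ 3 * ?m z (r / 2)" .
    obtain a b c where abc: "?m y r = ennreal a" "?m z (r / 2) = ennreal b" "?m y (2 * r) = ennreal c"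
        "0 \<le> a" "0 \<le> b" "0 \<le> c"
      using fin by (metis ennreal_cases infinity_ennreal_def)
    have "a + b \<le> c" using sum abc by (simp flip: ennreal_plus)
    moreover have "a \<le> C ^ 3 * b" using le abc C0 by (simp add: ennreal_power flip: ennreal_mult)
    moreover have "C ^ 3 * (a + b) \<le> C ^ 3 * c" using \<open>a + b \<le> c\<close> C0 by (intro mult_left_mono) auto
    ultimately have "a * (1 + C ^ 3) \<le> C ^ 3 * c" by (simp add: algebra_simps)
    then have "a \<le> \<theta> * c" using C0 by (simp add: \<theta>_def pos_le_divide_eq add_pos_pos)
    then show ?thesis using abc \<theta> by (simp flip: ennreal_mult)
  qed
  have "?m y r \<le> ennreal (\<theta> ^ k) * ?m y (2 ^ k * r)" if r: "0 < r" for y r k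
  proof (induction k)
    case (Suc k)
    have "ennreal (\<theta> ^ k) * ?m y (2 ^ k * r) \<le> ennreal (\<theta> ^ k) * (ennreal \<theta> * ?m y (2 * (2 ^ k * r)))"
      using r by (intro mult_left_mono step) auto
    with Suc.IH show ?case
      using \<theta> by (simp add: ennreal_mult mult_ac)
  qed simp
  with \<theta> show ?thesis by (intro that)
qed

section \<open>Amalgam norms\<close>

lemma suminf_shift_le_ennreal:
  fixes h :: "nat \<Rightarrow> ennreal"
  shows "(\<Sum>k. h (k + m)) \<le> (\<Sum>k. h k)"
proof (rule suminf_le_const)
  fix n
  have "(\<Sum>k<n. h (k + m)) = (\<Sum>k\<in>(\<lambda>k. k + m) ` {..<n}. h k)"
    by (subst sum.reindex) (auto simp: inj_on_def)
  also have "\<dots> \<le> (\<Sum>k. h k)" by (intro sum_le_suminf) auto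
  finally show "(\<Sum>k<n. h (k + m)) \<le> (\<Sum>k. h k)" .
qed auto

lemma member_le_suminf_ennreal: "(h :: nat \<Rightarrow> ennreal) j \<le> (\<Sum>k. h k)"
  using sum_le_suminf[of h "{j}"] by simp

text \<open>The cube estimate bounds the integral over the k-th ball at the price m^(-1/p), where m
  is the w-measure of that ball. Reverse doubling trades w(B)^\<kappa> for a power of
  \<theta>^\<kappa> times m^\<kappa>. What remains is m^(\<kappa> - 1/p), and \<kappa> - 1/p will be
  the amalgam exponent.\<close>

lemma (in bump_pair) riesz_far_estimate:
  fixes x y0 :: "real ^ 'n"
  assumes pos: "\<And>y r. 0 < r \<Longrightarrow> emeasure (wmeasure w) (ball y r) \<noteq> 0"
    and \<theta>: "0 < \<theta>" and reverse: "\<And>y r k. 0 < r \<Longrightarrow>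
      emeasure (wmeasure w) (ball y r) \<le> ennreal (\<theta> ^ k) * emeasure (wmeasure w) (ball y (2 ^ k * r))"
    and \<kappa>: "0 < \<kappa>" and \<rho>: "0 < \<rho>" and g: "g \<in> borel_measurable lebesgue" and x: "x \<in> ball y0 \<rho>"
  defines "B k \<equiv> ball y0 (2 ^ k * \<rho>)"
  shows "emeasure (wmeasure w) (ball y0 \<rho>) epowr \<kappa>
      * (\<integral>\<^sup>+y\<in>- ball y0 (2 * \<rho>). g y * riesz_kernel \<gamma> (x - y) \<partial>lebesgue)
    \<le> ennreal (8 powr (real CARD('n) - \<gamma>)) * ennreal C0 * (\<Sum>k. ennreal ((\<theta> powr \<kappa>) ^ k)
      * (emeasure (wmeasure w) (B k) epowr (\<kappa> - 1 / p)
        * (\<integral>\<^sup>+y\<in>B k. g y epowr p * ennreal (\<nu> y) \<partial>lebesgue) epowr (1 / p)))"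
proof -
  let ?e = "\<gamma> - real CARD('n)"
  define h where "h k = ennreal ((\<theta> powr \<kappa>) ^ k) * (emeasure (wmeasure w) (B k) epowr (\<kappa> - 1 / p)
        * (\<integral>\<^sup>+y\<in>B k. g y epowr p * ennreal (\<nu> y) \<partial>lebesgue) epowr (1 / p))" for k
  define M where "M = emeasure (wmeasure w) (ball y0 \<rho>) epowr \<kappa>"
  have summand: "M * (ennreal ((2 ^ k * \<rho>) powr ?e) * (\<integral>\<^sup>+y\<in>B (k + 2). g y \<partial>lebesgue))
      \<le> ennreal (8 powr (- ?e)) * ennreal C0 * h (k + 2)" for k
  proof -
    define s where "s = 2 ^ (k + 2) * \<rho>"
    have s: "0 < s" using \<rho> by (simp add: s_def)
    define m where "m = emeasure (wmeasure w) (B (k + 2))"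
    have m: "m \<noteq> 0" "m \<noteq> \<infinity>"
      using pos[OF s, of y0] emeasure_wmeasure_ball_finite[OF w] by (auto simp: m_def B_def s_def)
    define N where "N = (\<integral>\<^sup>+y\<in>B (k + 2). g y epowr p * ennreal (\<nu> y) \<partial>lebesgue)"
    define X where "X = ennreal ((2 * s) powr ?e) * (\<integral>\<^sup>+y\<in>B (k + 2). g y \<partial>lebesgue)"
    have B: "B (k + 2) = ball y0 s" by (simp add: B_def s_def)
    have "X epowr p * m \<le> ennreal (1 powr (1 - 1 / r)) * ennreal C0 epowr p * N"
      unfolding X_def m_def N_def B
      by (rule cube_estimate_wmeasure[OF _ g _ _ emeasure_ball_le(2) emeasure_ball_le(2)])
        (use s emeasure_ball_le(1)[of s y0] in auto)
    then have "(X epowr p * m) epowr (1 / p) \<le> (ennreal C0 epowr p * N) epowr (1 / p)"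
      using p by (intro epowr_mono) auto
    then have Xm: "X * m epowr (1 / p) \<le> ennreal C0 * N epowr (1 / p)"
      using p by (simp add: epowr_mult)
    \<comment> \<open>Cancelling the powers of m requires m to be positive, by \<open>pos\<close>,
      and finite, by local integrability of w.\<close>
    have "X = X * (m epowr (1 / p) * m epowr (- (1 / p)))"
      using m by (subst epowr_add[symmetric]) (auto simp: epowr_def)
    also have "\<dots> = (X * m epowr (1 / p)) * m epowr (- (1 / p))" by (simp add: mult.assoc)
    also have "\<dots> \<le> (ennreal C0 * N epowr (1 / p)) * m epowr (- (1 / p))"
      by (intro mult_right_mono Xm) auto
    finally have X: "X \<le> (ennreal C0 * N epowr (1 / p)) * m epowr (- (1 / p))" .
    have "M \<le> (ennreal (\<theta> ^ (k + 2)) * m) epowr \<kappa>"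
      unfolding M_def m_def B_def using \<kappa> by (intro epowr_mono reverse \<rho>) auto
    also have "\<dots> = ennreal ((\<theta> ^ (k + 2)) powr \<kappa>) * m epowr \<kappa>"
      using \<kappa> \<theta> by (simp add: epowr_mult epowr_ennreal)
    also have "(\<theta> ^ (k + 2)) powr \<kappa> = (\<theta> powr \<kappa>) ^ (k + 2)"
      using \<theta> by (simp only: powr_realpow[symmetric] powr_gt_zero powr_powr mult.commute)
    finally have M: "M \<le> ennreal ((\<theta> powr \<kappa>) ^ (k + 2)) * m epowr \<kappa>" .
    \<comment> \<open>The cube around the ball of radius s has side 2 s = 8 * 2^k \<rho>, whence the
      constant 8^(n-\<gamma>).\<close>
    have "(2 ^ k * \<rho>) powr ?e = (2 * s / 8) powr ?e" by (simp add: s_def)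
    also have "\<dots> = 8 powr (- ?e) * (2 * s) powr ?e"
      unfolding powr_divide powr_minus by (simp only: divide_inverse mult.commute)
    finally have "M * (ennreal ((2 ^ k * \<rho>) powr ?e) * (\<integral>\<^sup>+y\<in>B (k + 2). g y \<partial>lebesgue))
        = ennreal (8 powr (- ?e)) * (M * X)"
      by (simp add: X_def ennreal_mult mult_ac)
    also have "\<dots> \<le> ennreal (8 powr (- ?e)) * ((ennreal ((\<theta> powr \<kappa>) ^ (k + 2)) * m epowr \<kappa>)
        * ((ennreal C0 * N epowr (1 / p)) * m epowr (- (1 / p))))"
      by (intro mult_left_mono mult_mono M X) auto
    also have "\<dots> = ennreal (8 powr (- ?e)) * ennreal C0 * (ennreal ((\<theta> powr \<kappa>) ^ (k + 2))
        * ((m epowr \<kappa> * m epowr (- (1 / p))) * N epowr (1 / p)))"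
      by (simp only: mult_ac)
    also have "m epowr \<kappa> * m epowr (- (1 / p)) = m epowr (\<kappa> - 1 / p)"
      using m by (simp add: epowr_add[symmetric])
    finally show ?thesis by (simp only: h_def m_def N_def)
  qed
  have "M * (\<integral>\<^sup>+y\<in>- ball y0 (2 * \<rho>). g y * riesz_kernel \<gamma> (x - y) \<partial>lebesgue)
      \<le> M * (\<Sum>k. ennreal ((2 ^ k * \<rho>) powr ?e) * (\<integral>\<^sup>+y\<in>B (k + 2). g y \<partial>lebesgue))"
    unfolding B_def by (intro mult_left_mono riesz_kernel_far_le[OF \<gamma>(2) \<rho> g x]) auto
  also have "\<dots> = (\<Sum>k. M * (ennreal ((2 ^ k * \<rho>) powr ?e) * (\<integral>\<^sup>+y\<in>B (k + 2). g y \<partial>lebesgue)))"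
    by simp
  also have "\<dots> \<le> (\<Sum>k. ennreal (8 powr (- ?e)) * ennreal C0 * h (k + 2))"
    by (intro suminf_le summand) auto
  also have "\<dots> = ennreal (8 powr (- ?e)) * ennreal C0 * (\<Sum>k. h (k + 2))"
    by simp
  also have "\<dots> \<le> ennreal (8 powr (- ?e)) * ennreal C0 * (\<Sum>k. h k)"
    by (intro mult_left_mono suminf_shift_le_ennreal) auto
  finally show ?thesis by (simp add: M_def h_def)
qed

section \<open>Pointwise bound and measurability of the fractional integral\<close>

lemma norm_frac_integral_le:
  fixes f :: "real ^ 'n \<Rightarrow> complex"
  shows "ennreal (norm (frac_integral \<gamma> f x))
    \<le> ennreal \<bar>1 / riesz_zeta (real CARD('n)) \<gamma>\<bar> * (\<integral>\<^sup>+y. ennreal (norm (f y)) * riesz_kernel \<gamma> (x - y) \<partial>lebesgue)"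
proof -
  have *: "ennreal (norm (riesz_integrand \<gamma> f x y)) = ennreal (norm (f y)) * riesz_kernel \<gamma> (x - y)" for y
    by (simp add: riesz_integrand_def riesz_kernel_def norm_divide flip: ennreal_mult)
  have "ennreal (norm (\<integral>y. riesz_integrand \<gamma> f x y \<partial>lebesgue))
      \<le> (\<integral>\<^sup>+y. ennreal (norm (riesz_integrand \<gamma> f x y)) \<partial>lebesgue)"
  proof (cases "integrable lebesgue (riesz_integrand \<gamma> f x)")
    case True
    then show ?thesis by (rule integral_norm_bound_ennreal)
  next
    \<comment> \<open>The Bochner integral is 0 here, so the bound holds at every x without any
      knowledge of convergence.\<close>
    case False
    then show ?thesis by (simp add: not_integrable_integral_eq)
  qed
  then have "ennreal (norm (\<integral>y. riesz_integrand \<gamma> f x y \<partial>lebesgue))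
      \<le> (\<integral>\<^sup>+y. ennreal (norm (f y)) * riesz_kernel \<gamma> (x - y) \<partial>lebesgue)"
    unfolding * .
  then have "ennreal \<bar>1 / riesz_zeta (real CARD('n)) \<gamma>\<bar> * ennreal (norm (\<integral>y. riesz_integrand \<gamma> f x y \<partial>lebesgue))
    \<le> ennreal \<bar>1 / riesz_zeta (real CARD('n)) \<gamma>\<bar> * (\<integral>\<^sup>+y. ennreal (norm (f y)) * riesz_kernel \<gamma> (x - y) \<partial>lebesgue)"
    by (intro mult_left_mono) auto
  moreover have "norm (frac_integral \<gamma> f x)
      = \<bar>1 / riesz_zeta (real CARD('n)) \<gamma>\<bar> * norm (\<integral>y. riesz_integrand \<gamma> f x y \<partial>lebesgue)"
    unfolding frac_integral_def norm_mult norm_of_real ..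
  ultimately show ?thesis by (simp only: ennreal_mult abs_ge_zero norm_ge_zero)
qed

lemma measurable_riesz_integrand_pair:
  fixes f :: "real ^ 'n \<Rightarrow> complex"
  assumes f: "f \<in> borel_measurable lebesgue"
  shows "case_prod (riesz_integrand \<gamma> f) \<in> borel_measurable (lebesgue \<Otimes>\<^sub>M lebesgue)"
proof -
  have "(\<lambda>z :: real ^ 'n. complex_of_real (norm z powr (real CARD('n) - \<gamma>))) \<in> borel_measurable borel"
    by measurable
  from measurable_compose[OF measurable_diff_borel this]
  have "case_prod (\<lambda>x y :: real ^ 'n. complex_of_real (norm (x - y) powr (real CARD('n) - \<gamma>))) \<in> borel_measurable borel"
    unfolding case_prod_unfold .
  from measurable_lebesgue_pair_borel[OF this]
  have d: "(\<lambda>z. complex_of_real (norm (fst z - snd z :: real ^ 'n) powr (real CARD('n) - \<gamma>)))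
      \<in> borel_measurable (lebesgue \<Otimes>\<^sub>M lebesgue)"
    unfolding case_prod_unfold .
  have "(\<lambda>z. f (snd z)) \<in> borel_measurable ((lebesgue :: (real ^ 'n) measure) \<Otimes>\<^sub>M lebesgue)"
    by (rule measurable_compose[OF measurable_snd f])
  from borel_measurable_divide[OF this d] show ?thesis
    unfolding case_prod_unfold riesz_integrand_def .
qed

lemma measurable_riesz_integrand:
  assumes f: "f \<in> borel_measurable lebesgue"
  shows "riesz_integrand \<gamma> f x \<in> borel_measurable lebesgue"
  using measurable_compose[OF measurable_Pair1' measurable_riesz_integrand_pair[OF f, of \<gamma>], of x]
  by simp

lemma measurable_frac_integral:
  fixes f :: "real ^ 'n \<Rightarrow> complex"
  assumes f: "f \<in> borel_measurable lebesgue"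
  shows "frac_integral \<gamma> f \<in> borel_measurable lebesgue"
proof -
  interpret sigma_finite_measure "lebesgue :: (real ^ 'n) measure" by (rule sigma_finite_lebesgue)
  have "(\<lambda>x. \<integral>y. riesz_integrand \<gamma> f x y \<partial>lebesgue) \<in> borel_measurable lebesgue"
    by (rule borel_measurable_lebesgue_integral[OF measurable_riesz_integrand_pair[OF f]])
  then show ?thesis
    unfolding frac_integral_def[abs_def] by (intro borel_measurable_times borel_measurable_const)
qed

section \<open>Norms over balls and their measurability in the center\<close>

lemma Lp_norm_restrict:
  assumes p: "0 < p" and \<nu>: "weight \<nu>" and f: "f \<in> borel_measurable lebesgue" and B: "B \<in> sets lebesgue"
  shows "Lp_norm (ennreal p) (wmeasure \<nu>) (\<lambda>x. ennreal (norm (f x * indicator B x :: complex)))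
    = (\<integral>\<^sup>+x\<in>B. ennreal (norm (f x)) epowr p * ennreal (\<nu> x) \<partial>lebesgue) epowr (1 / p)"
proof -
  note [measurable] = weight_measurable[OF \<nu>] f B
  have "ennreal (norm (f x * indicator B x)) epowr p = ennreal (norm (f x)) epowr p * indicator B x" for x
    using p by (simp add: indicator_def)
  then have "(\<integral>\<^sup>+x. ennreal (norm (f x * indicator B x)) epowr p \<partial>wmeasure \<nu>)
      = (\<integral>\<^sup>+x. ennreal (norm (f x)) epowr p * indicator B x \<partial>wmeasure \<nu>)"
    by (simp only:)
  also have "\<dots> = (\<integral>\<^sup>+x. ennreal (\<nu> x) * (ennreal (norm (f x)) epowr p * indicator B x) \<partial>lebesgue)"
    unfolding wmeasure_def by (rule nn_integral_density) measurable
  also have "\<dots> = (\<integral>\<^sup>+x\<in>B. ennreal (norm (f x)) epowr p * ennreal (\<nu> x) \<partial>lebesgue)"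
    by (simp only: mult_ac)
  finally show ?thesis using p by (simp add: Lp_norm_def)
qed

lemma weak_Lp_norm_restrict:
  fixes h :: "'a::euclidean_space \<Rightarrow> complex"
  shows "weak_Lp_norm p (wmeasure w) (\<lambda>x. h x * indicator B x) =
    (SUP t\<in>{0<..}. ennreal t * emeasure (wmeasure w) ({x. t < norm (h x)} \<inter> B) epowr (1 / p))"
proof -
  have "{x \<in> space (wmeasure w). t < norm (h x * indicator B x)} = {x. t < norm (h x)} \<inter> B" if "0 < t" for t
    using that by (auto simp: indicator_def split: if_splits)
  then show ?thesis unfolding weak_Lp_norm_def by (intro SUP_cong refl) simp
qed

text \<open>Reduces the weak norm to countably many levels, which makes it measurable in the center of the ball.\<close>

lemma SUP_level_rational:
  fixes \<phi> :: "real \<Rightarrow> ennreal"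
  assumes "antimono \<phi>"
  shows "(SUP t\<in>{0<..}. ennreal t * \<phi> t) = (SUP t\<in>{0<..} \<inter> \<rat>. ennreal t * \<phi> t)"
proof (rule antisym)
  show "(SUP t\<in>{0<..}. ennreal t * \<phi> t) \<le> (SUP t\<in>{0<..} \<inter> \<rat>. ennreal t * \<phi> t)"
  proof (rule SUP_least)
    fix t :: real assume t: "t \<in> {0<..}"
    have "ennreal t = (SUP u\<in>{0<..<t} \<inter> \<rat>. ennreal u)"
    proof (rule antisym)
      show "ennreal t \<le> (SUP u\<in>{0<..<t} \<inter> \<rat>. ennreal u)"
      proof (rule dense_le)
        fix v assume v: "v < ennreal t"
        then obtain v' where v': "v = ennreal v'" "0 \<le> v'" by (cases v) auto
        with v obtain u where "u \<in> \<rat>" "v' < u" "u < t"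
          using Rats_dense_in_real[of v' t] by (auto simp: ennreal_less_iff)
        with v' show "v \<le> (SUP u\<in>{0<..<t} \<inter> \<rat>. ennreal u)"
          by (intro SUP_upper2[of u]) (auto intro!: ennreal_leI)
      qed
    qed (auto intro!: SUP_least ennreal_leI)
    then have "ennreal t * \<phi> t = (SUP u\<in>{0<..<t} \<inter> \<rat>. ennreal u * \<phi> t)"
      by (simp add: SUP_mult_right_ennreal)
    also have "\<dots> \<le> (SUP t\<in>{0<..} \<inter> \<rat>. ennreal t * \<phi> t)"
    proof (rule SUP_mono)
      fix u assume u: "u \<in> {0<..<t} \<inter> \<rat>"
      then have "ennreal u * \<phi> t \<le> ennreal u * \<phi> u"
        using assms by (intro mult_left_mono) (auto simp: antimono_def)
      with u show "\<exists>u'\<in>{0<..} \<inter> \<rat>. ennreal u * \<phi> t \<le> ennreal u' * \<phi> u'" by auto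
    qed
    finally show "ennreal t * \<phi> t \<le> (SUP t\<in>{0<..} \<inter> \<rat>. ennreal t * \<phi> t)" .
  qed
qed (auto intro!: SUP_subset_mono)

lemma measurable_emeasure_ball:
  assumes w: "weight (w :: 'a::euclidean_space \<Rightarrow> real)" and A: "A \<in> sets lebesgue"
  shows "(\<lambda>y. emeasure (wmeasure w) (A \<inter> ball y r)) \<in> borel_measurable lebesgue"
proof -
  note [measurable] = weight_measurable[OF w] A
  have "emeasure (wmeasure w) (A \<inter> ball y r) = (\<integral>\<^sup>+x\<in>ball y r. ennreal (w x) * indicator A x \<partial>lebesgue)" for y
    using A by (subst emeasure_wmeasure[OF w]) (auto simp: indicator_inter_arith mult.assoc)
  then show ?thesis by (simp add: measurable_ball_integral)
qed

lemma measurable_weak_Lp_norm_ball: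
  fixes h :: "'a::euclidean_space \<Rightarrow> complex"
  assumes w: "weight w" and h: "h \<in> borel_measurable lebesgue" and p: "0 < p"
  shows "(\<lambda>y. weak_Lp_norm p (wmeasure w) (\<lambda>x. h x * indicator (ball y r) x)) \<in> borel_measurable lebesgue"
proof -
  have sets: "{x. t < norm (h x)} \<in> sets lebesgue" for t
  proof -
    have "{x \<in> space lebesgue. t < norm (h x)} \<in> sets lebesgue" using h by measurable
    then show ?thesis by simp
  qed
  have "weak_Lp_norm p (wmeasure w) (\<lambda>x. h x * indicator (ball y r) x) =
      (SUP t\<in>{0<..} \<inter> \<rat>. ennreal t * emeasure (wmeasure w) ({x. t < norm (h x)} \<inter> ball y r) epowr (1 / p))" for y
    unfolding weak_Lp_norm_restrict
  proof (rule SUP_level_rational, rule antimonoI, rule epowr_mono, rule emeasure_mono)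
    fix t u :: real
    show "t \<le> u \<Longrightarrow> {x. u < norm (h x)} \<inter> ball y r \<subseteq> {x. t < norm (h x)} \<inter> ball y r" by auto
    show "{x. t < norm (h x)} \<inter> ball y r \<in> sets (wmeasure w)" using sets by auto
  qed (use p in simp)
  then show ?thesis
    using countable_rat by (simp only:)
      (intro borel_measurable_SUP borel_measurable_times_ennreal borel_measurable_const measurable_epowr
        measurable_emeasure_ball w sets, auto intro: countable_subset)
qed

lemma Lp_norm_finite_AE:
  assumes s: "1 < s" and [measurable]: "F \<in> borel_measurable M" and fin: "Lp_norm s M F < \<infinity>"
  shows "AE x in M. F x < \<infinity>"
proof (cases "s = \<infinity>")
  case True
  then have "esssup M F < \<infinity>" using fin by (simp add: Lp_norm_def)
  then show ?thesis using esssup_AE[of F M] by (auto elim!: eventually_mono intro: le_less_trans)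
next
  case False
  define \<sigma> where "\<sigma> = enn2real s"
  have \<sigma>: "0 < \<sigma>" using s False by (simp add: \<sigma>_def enn2real_positive_iff less_top order.strict_trans[of 0 1 s])
  have "(\<integral>\<^sup>+x. F x epowr \<sigma> \<partial>M) epowr (1 / \<sigma>) \<noteq> \<infinity>" using fin False by (simp add: Lp_norm_def \<sigma>_def)
  then have "(\<integral>\<^sup>+x. F x epowr \<sigma> \<partial>M) \<noteq> \<infinity>" using \<sigma> epowr_eq_top_iff[of "1 / \<sigma>"] by simp
  then have "AE x in M. F x epowr \<sigma> \<noteq> \<infinity>" by (intro nn_integral_PInf_AE) auto
  then show ?thesis
    by (rule eventually_mono) (metis epowr_eq_top_iff[OF \<sigma>] less_top infinity_ennreal_def)
qed

text \<open>Both bounds share one majorant: the first serves the convergence of the integral almost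
  everywhere, the second the norm inequality. G f \<rho> k is the function whose L^s norm enters the
  amalgam norm at radius 2^k \<rho>, and \<tau> is \<theta>^(e+1/p) with \<theta> from reverse
  doubling.\<close>

lemma (in bump_pair) amalgam_pointwise_estimate:
  assumes D2: "Delta2 w" "\<not> null_weight w" and e: "e \<le> 0" and \<kappa>: "0 < e + 1 / p"
  defines "m \<equiv> \<lambda>y \<rho>. emeasure (wmeasure w) (ball y \<rho>)"
    and "G \<equiv> \<lambda>f \<rho> k y. emeasure (wmeasure w) (ball y (2 ^ k * \<rho>)) epowr e *
        Lp_norm (ennreal p) (wmeasure \<nu>) (\<lambda>x. ennreal (norm (f x * indicator (ball y (2 ^ k * \<rho>)) x)))"
  obtains b \<tau> :: real where "0 < b" "0 < \<tau>" "\<tau> < 1"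
    "\<And>f \<rho> y x. f \<in> borel_measurable lebesgue \<Longrightarrow> 0 < \<rho> \<Longrightarrow> x \<in> ball y \<rho> \<Longrightarrow>
      m y \<rho> epowr (e + 1 / p) * (\<integral>\<^sup>+z\<in>- ball y (2 * \<rho>). ennreal (norm (f z)) * riesz_kernel \<gamma> (x - z) \<partial>lebesgue)
      \<le> (\<Sum>k. ennreal (b * \<tau> ^ k) * G f \<rho> k y)"
    "\<And>f \<rho> y. f \<in> borel_measurable lebesgue \<Longrightarrow> 0 < \<rho> \<Longrightarrow>
      m y \<rho> epowr e * weak_Lp_norm p (wmeasure w) (\<lambda>x. frac_integral \<gamma> f x * indicator (ball y \<rho>) x)
      \<le> (\<Sum>k. ennreal (b * \<tau> ^ k) * G f \<rho> k y)"
proof -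
  have p0: "0 < p" using p by simp
  note pos = Delta2_ball_pos[OF D2]
  have m: "m y \<rho> \<noteq> 0" "m y \<rho> \<noteq> \<infinity>" if "0 < \<rho>" for y \<rho>
    using pos[OF that] emeasure_wmeasure_ball_finite[OF w] by (auto simp: m_def)
  obtain \<theta> where \<theta>: "0 < \<theta>" "\<theta> < 1" and reverse: "\<And>y r k. 0 < r \<Longrightarrow>
      emeasure (wmeasure w) (ball y r) \<le> ennreal (\<theta> ^ k) * emeasure (wmeasure w) (ball y (2 ^ k * r))"
    using Delta2_reverse_doubling[OF D2(1)] by metis
  obtain C where C: "0 < C" and doubling: "\<And>y \<rho>. 0 < \<rho> \<Longrightarrow> m y (2 * \<rho>) \<le> ennreal C * m y \<rho>"
    using D2(1) by (auto simp: Delta2_def m_def)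
  obtain K1 K2 where K: "0 < K1" "0 < K2" and local_weak: "\<And>\<rho> t g. 0 < \<rho> \<Longrightarrow> 0 < t \<Longrightarrow> g \<in> borel_measurable lebesgue \<Longrightarrow>
      ennreal (t powr p) * emeasure (wmeasure w)
        {x. ennreal (K1 * t) < (\<integral>\<^sup>+y\<in>ball x \<rho>. g y * riesz_kernel \<gamma> (x - y) \<partial>lebesgue)}
      \<le> ennreal K2 * (\<integral>\<^sup>+x. g x epowr p * ennreal (\<nu> x) \<partial>lebesgue)"
    by (rule riesz_local_weak_type) (rule that)
  define \<kappa>' where "\<kappa>' = e + 1 / p"
  define \<tau> where "\<tau> = \<theta> powr \<kappa>'"
  have \<tau>: "0 < \<tau>" "\<tau> < 1" using \<theta> \<kappa> powr_less_mono2[of \<kappa>' \<theta> 1] by (auto simp: \<tau>_def \<kappa>'_def)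
  \<comment> \<open>Adding 1 makes Z positive without evaluating the Gamma factors.\<close>
  define Z where "Z = \<bar>1 / riesz_zeta (real CARD('n)) \<gamma>\<bar> + 1"
  have Z: "0 < Z" by (simp add: Z_def add_nonneg_pos)
  define b1 where "b1 = 8 powr (real CARD('n) - \<gamma>) * max C0 0"
  have b1: "0 \<le> b1" by (simp add: b1_def)
  define a where "a = 2 * Z * K1 * K2 powr (1 / p) * C powr (- e)"
  have a: "0 < a" using Z K C by (simp add: a_def)
  \<comment> \<open>The local part uses only the term k = 1, which carries the factor \<tau>, so a
    is divided by \<tau>. The summand 2 Z b1 pays for the far part of the weak norm and the last b1
    for the first bound.\<close>
  define b where "b = a / \<tau> + 2 * Z * b1 + b1"
  have b: "0 < b" unfolding b_def using a \<tau> b1 Z by (intro add_pos_nonneg divide_pos_pos mult_nonneg_nonneg) auto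
  have far: "m y \<rho> epowr \<kappa>' * (\<integral>\<^sup>+z\<in>- ball y (2 * \<rho>). ennreal (norm (f z)) * riesz_kernel \<gamma> (x - z) \<partial>lebesgue)
      \<le> ennreal b1 * (\<Sum>k. ennreal (\<tau> ^ k) * G f \<rho> k y)"
    if f: "f \<in> borel_measurable lebesgue" and \<rho>: "0 < \<rho>" and x: "x \<in> ball y \<rho>" for f \<rho> y x
  proof -
    have fm: "(\<lambda>z. ennreal (norm (f z))) \<in> borel_measurable lebesgue" using f by measurable
    have C0: "ennreal C0 = ennreal (max C0 0)" by (cases "0 \<le> C0") (auto simp: ennreal_neg)
    show ?thesis
      using riesz_far_estimate[OF pos \<theta>(1) reverse _ \<rho> fm x, of \<kappa>'] \<kappa>
      by (simp add: \<kappa>'_def \<tau>_def m_def G_def b1_def C0 ennreal_mult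
          Lp_norm_restrict[OF p0 \<nu> f])
  qed
  have series: "ennreal c * (\<Sum>k. ennreal (\<tau> ^ k) * G f \<rho> k y) = (\<Sum>k. ennreal (c * \<tau> ^ k) * G f \<rho> k y)"
    if "0 \<le> c" for c f \<rho> y
    using that \<tau> by (simp add: ennreal_mult mult.assoc)
  show ?thesis
  proof (rule that[OF b \<tau>])
    fix f :: "real ^ 'n \<Rightarrow> complex" and \<rho> :: real and y x :: "real ^ 'n"
    assume f: "f \<in> borel_measurable lebesgue" and \<rho>: "0 < \<rho>" and x: "x \<in> ball y \<rho>"
    have "m y \<rho> epowr \<kappa>' * (\<integral>\<^sup>+z\<in>- ball y (2 * \<rho>). ennreal (norm (f z)) * riesz_kernel \<gamma> (x - z) \<partial>lebesgue)
        \<le> ennreal b1 * (\<Sum>k. ennreal (\<tau> ^ k) * G f \<rho> k y)"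
      by (rule far[OF f \<rho> x])
    also have "\<dots> \<le> ennreal b * (\<Sum>k. ennreal (\<tau> ^ k) * G f \<rho> k y)"
      using a \<tau> b1 Z by (intro mult_right_mono ennreal_leI) (auto simp: b_def)
    also have "\<dots> = (\<Sum>k. ennreal (b * \<tau> ^ k) * G f \<rho> k y)"
      using b by (intro series) simp
    finally show "m y \<rho> epowr (e + 1 / p) * (\<integral>\<^sup>+z\<in>- ball y (2 * \<rho>). ennreal (norm (f z)) * riesz_kernel \<gamma> (x - z) \<partial>lebesgue)
      \<le> (\<Sum>k. ennreal (b * \<tau> ^ k) * G f \<rho> k y)" unfolding \<kappa>'_def .
  next
    fix f :: "real ^ 'n \<Rightarrow> complex" and \<rho> :: real and y :: "real ^ 'n"
    assume f: "f \<in> borel_measurable lebesgue" and \<rho>: "0 < \<rho>"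
    let ?T = "frac_integral \<gamma> f" and ?S = "\<Sum>k. ennreal (\<tau> ^ k) * G f \<rho> k y"
    define h where "h z = ennreal (norm (f z))" for z
    have h: "h \<in> borel_measurable lebesgue" unfolding h_def[abs_def] using f by measurable
    define near where "near x = (\<integral>\<^sup>+z\<in>ball y (2 * \<rho>). h z * riesz_kernel \<gamma> (x - z) \<partial>lebesgue)" for x
    define rest where "rest x = (\<integral>\<^sup>+z\<in>- ball y (2 * \<rho>). h z * riesz_kernel \<gamma> (x - z) \<partial>lebesgue)" for x
    define A where "A = (SUP x\<in>ball y \<rho>. rest x)"
    define N where "N = (\<integral>\<^sup>+x\<in>ball y (2 * \<rho>). h x epowr p * ennreal (\<nu> x) \<partial>lebesgue)"
    have Km: "(\<lambda>z. riesz_kernel \<gamma> (x - z)) \<in> borel_measurable lebesgue" for x :: "real ^ 'n"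
      by (intro measurable_completion) measurable
    have T: "ennreal (norm (?T x)) \<le> ennreal Z * (near x + rest x)" for x
    proof -
      have "(\<integral>\<^sup>+z. h z * riesz_kernel \<gamma> (x - z) \<partial>lebesgue) = (\<integral>\<^sup>+z. h z * riesz_kernel \<gamma> (x - z) * indicator (ball y (2 * \<rho>)) z
          + h z * riesz_kernel \<gamma> (x - z) * indicator (- ball y (2 * \<rho>)) z \<partial>lebesgue)"
        by (intro nn_integral_cong) (auto simp: indicator_def)
      also have "\<dots> = near x + rest x"
        unfolding near_def rest_def
        by (intro nn_integral_add borel_measurable_times_ennreal h Km borel_measurable_indicator) auto
      finally have "(\<integral>\<^sup>+z. h z * riesz_kernel \<gamma> (x - z) \<partial>lebesgue) = near x + rest x" .
      then have "ennreal (norm (?T x)) \<le> ennreal \<bar>1 / riesz_zeta (real CARD('n)) \<gamma>\<bar> * (near x + rest x)"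
        using norm_frac_integral_le[of \<gamma> f x] by (simp add: h_def)
      also have "\<dots> \<le> ennreal Z * (near x + rest x)"
        by (intro mult_right_mono ennreal_leI) (auto simp: Z_def)
      finally show ?thesis .
    qed
    have mA: "m y \<rho> epowr \<kappa>' * A \<le> ennreal b1 * ?S"
      unfolding A_def SUP_mult_left_ennreal
      by (intro SUP_least) (use far[OF f \<rho>] in \<open>simp add: rest_def h_def\<close>)
    have weak: "weak_Lp_norm p (wmeasure w) (\<lambda>x. ?T x * indicator (ball y \<rho>) x)
        \<le> ennreal (2 * Z * K1 * K2 powr (1 / p)) * N epowr (1 / p) + ennreal (2 * Z) * A * m y \<rho> epowr (1 / p)"
      unfolding weak_Lp_norm_restrict
    proof (rule SUP_least)
      fix t :: real assume "t \<in> {0<..}"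
      then have t: "0 < t" by simp
      let ?E = "{x. t < norm (?T x)} \<inter> ball y \<rho>"
      show "ennreal t * emeasure (wmeasure w) ?E epowr (1 / p)
          \<le> ennreal (2 * Z * K1 * K2 powr (1 / p)) * N epowr (1 / p) + ennreal (2 * Z) * A * m y \<rho> epowr (1 / p)"
      \<comment> \<open>A is the supremum of the far part over the ball. Up to the level 2 Z A the
        trivial bound by w(B) suffices; above it the far part accounts for less than t/2, so the
        near part must exceed t/(2 Z) = K1 u.\<close>
      proof (cases "ennreal t \<le> ennreal (2 * Z) * A")
        case True
        have "emeasure (wmeasure w) ?E \<le> m y \<rho>"
          unfolding m_def by (intro emeasure_mono) auto
        then have "ennreal t * emeasure (wmeasure w) ?E epowr (1 / p) \<le> ennreal (2 * Z) * A * m y \<rho> epowr (1 / p)"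
          using True p0 by (intro mult_mono epowr_mono) auto
        then show ?thesis by (rule order_trans) simp
      next
        case False
        define u where "u = t / (2 * Z * K1)"
        have u: "0 < u" using t Z K by (simp add: u_def)
        define g where "g z = h z * indicator (ball y (2 * \<rho>)) z" for z
        have g: "g \<in> borel_measurable lebesgue"
          unfolding g_def[abs_def] by (intro borel_measurable_times_ennreal h borel_measurable_indicator) auto
        \<comment> \<open>For x in B(y,\<rho>) the ball B(y,2\<rho>) lies in B(x,3\<rho>), so the
          cutoff at 3\<rho> loses nothing of g.\<close>
        let ?I = "\<lambda>x. \<integral>\<^sup>+z\<in>ball x (3 * \<rho>). g z * riesz_kernel \<gamma> (x - z) \<partial>lebesgue"
        have E: "ennreal (K1 * u) < ?I x" if x: "x \<in> ?E" for x
        proof (rule ccontr)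
          assume "\<not> ennreal (K1 * u) < ?I x"
          then have I: "?I x \<le> ennreal (t / (2 * Z))" using K by (simp add: u_def)
          have "near x \<le> ?I x"
            unfolding near_def
          proof (intro nn_integral_mono)
            fix z
            show "h z * riesz_kernel \<gamma> (x - z) * indicator (ball y (2 * \<rho>)) z
                \<le> g z * riesz_kernel \<gamma> (x - z) * indicator (ball x (3 * \<rho>)) z"
            proof (cases "z \<in> ball y (2 * \<rho>)")
              case True
              then have "z \<in> ball x (3 * \<rho>)" using x dist_triangle[of x z y] by (auto simp: dist_commute)
              with True show ?thesis by (simp add: g_def)
            qed simp
          qed
          with I have n: "near x \<le> ennreal (t / (2 * Z))" by (rule order_trans[rotated])
          have "rest x \<le> A" unfolding A_def using x by (intro SUP_upper) auto
          have A_fin: "ennreal (2 * Z) * A < ennreal t" using False by simp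
          then have "A \<noteq> \<infinity>" using Z by (auto simp: ennreal_mult_top)
          then obtain A' where A': "A = ennreal A'" "0 \<le> A'" by (cases A) auto
          have "2 * Z * A' < t" using A_fin A' Z t by (simp add: ennreal_less_iff flip: ennreal_mult)
          have "ennreal (norm (?T x)) \<le> ennreal Z * (ennreal (t / (2 * Z)) + ennreal A')"
            using n \<open>rest x \<le> A\<close> A' by (intro order_trans[OF T] mult_left_mono add_mono) auto
          also have "\<dots> = ennreal (t / 2 + Z * A')"
            using Z t A' by (simp add: distrib_left flip: ennreal_plus ennreal_mult)
          also have "\<dots> \<le> ennreal t"
            using \<open>2 * Z * A' < t\<close> by (intro ennreal_leI) simp
          finally have "norm (?T x) \<le> t" using t by simp
          with x show False by simp
        qed
        have Isets: "{x. ennreal (K1 * u) < ?I x} \<in> sets (wmeasure w)"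
        proof -
          have "?I \<in> borel_measurable lebesgue" by (rule measurable_riesz_near[OF g])
          then have "{x \<in> space lebesgue. ennreal (K1 * u) < ?I x} \<in> sets lebesgue" by measurable
          then show ?thesis by simp
        qed
        have "ennreal (u powr p) * emeasure (wmeasure w) ?E
            \<le> ennreal (u powr p) * emeasure (wmeasure w) {x. ennreal (K1 * u) < ?I x}"
          using E by (intro mult_left_mono emeasure_mono Isets) auto
        also have "\<dots> \<le> ennreal K2 * (\<integral>\<^sup>+x. g x epowr p * ennreal (\<nu> x) \<partial>lebesgue)"
          using \<rho> u g by (intro local_weak) auto
        also have "(\<integral>\<^sup>+x. g x epowr p * ennreal (\<nu> x) \<partial>lebesgue) = N"
          unfolding N_def using p0 by (intro nn_integral_cong) (simp add: g_def indicator_def)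
        finally have "(ennreal (u powr p) * emeasure (wmeasure w) ?E) epowr (1 / p) \<le> (ennreal K2 * N) epowr (1 / p)"
          using p0 by (intro epowr_mono) auto
        then have "ennreal u * emeasure (wmeasure w) ?E epowr (1 / p) \<le> ennreal (K2 powr (1 / p)) * N epowr (1 / p)"
          using p0 u K by (simp add: epowr_mult epowr_ennreal powr_powr)
        then have "ennreal (2 * Z * K1) * (ennreal u * emeasure (wmeasure w) ?E epowr (1 / p))
            \<le> ennreal (2 * Z * K1) * (ennreal (K2 powr (1 / p)) * N epowr (1 / p))"
          by (intro mult_left_mono) auto
        moreover have "ennreal (2 * Z * K1) * ennreal u = ennreal t"
          using Z K u by (simp add: u_def flip: ennreal_mult)
        moreover have "ennreal (2 * Z * K1) * ennreal (K2 powr (1 / p)) = ennreal (2 * Z * K1 * K2 powr (1 / p))"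
          using Z K by (simp flip: ennreal_mult)
        ultimately have "ennreal t * emeasure (wmeasure w) ?E epowr (1 / p)
            \<le> ennreal (2 * Z * K1 * K2 powr (1 / p)) * N epowr (1 / p)"
          by (simp only: mult.assoc[symmetric])
        then show ?thesis by (rule order_trans) simp
      qed
    qed
    \<comment> \<open>As e \<le> 0, enlarging the ball can only lower the power; doubling limits the
      loss to the factor C^(-e). The radius 2\<rho> is that of the term k = 1.\<close>
    have me: "m y \<rho> epowr e \<le> ennreal (C powr (- e)) * m y (2 * \<rho>) epowr e"
    proof -
      have "ennreal (C powr e) * m y \<rho> epowr e = (ennreal C * m y \<rho>) epowr e"
        using C m[OF \<rho>] by (subst epowr_mult_finite) (auto simp: epowr_ennreal)
      also have "\<dots> \<le> m y (2 * \<rho>) epowr e"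
        using e by (intro epowr_antimono doubling \<rho>) auto
      finally have "ennreal (C powr (- e)) * (ennreal (C powr e) * m y \<rho> epowr e) \<le> ennreal (C powr (- e)) * m y (2 * \<rho>) epowr e"
        by (intro mult_left_mono) auto
      moreover have "ennreal (C powr (- e)) * ennreal (C powr e) = 1"
        using C by (simp add: powr_add[symmetric] flip: ennreal_mult)
      ultimately show ?thesis by (simp add: mult.assoc[symmetric])
    qed
    have G1: "G f \<rho> 1 y = m y (2 * \<rho>) epowr e * N epowr (1 / p)"
      by (simp add: G_def m_def N_def h_def Lp_norm_restrict[OF p0 \<nu> f])
    have "m y \<rho> epowr e * weak_Lp_norm p (wmeasure w) (\<lambda>x. ?T x * indicator (ball y \<rho>) x)
        \<le> m y \<rho> epowr e * (ennreal (2 * Z * K1 * K2 powr (1 / p)) * N epowr (1 / p) + ennreal (2 * Z) * A * m y \<rho> epowr (1 / p))"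
      by (intro mult_left_mono weak) auto
    also have "\<dots> = ennreal (2 * Z * K1 * K2 powr (1 / p)) * (m y \<rho> epowr e * N epowr (1 / p))
        + ennreal (2 * Z) * ((m y \<rho> epowr e * m y \<rho> epowr (1 / p)) * A)"
      by (simp only: distrib_left mult_ac)
    also have "m y \<rho> epowr e * m y \<rho> epowr (1 / p) = m y \<rho> epowr \<kappa>'"
      unfolding \<kappa>'_def using m[OF \<rho>] by (simp add: epowr_add)
    also have "ennreal (2 * Z * K1 * K2 powr (1 / p)) * (m y \<rho> epowr e * N epowr (1 / p))
        + ennreal (2 * Z) * (m y \<rho> epowr \<kappa>' * A)
        \<le> ennreal (a / \<tau>) * ?S + ennreal (2 * Z) * (ennreal b1 * ?S)"
    proof (rule add_mono)
      have "ennreal (2 * Z * K1 * K2 powr (1 / p)) * (m y \<rho> epowr e * N epowr (1 / p))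
          \<le> ennreal (2 * Z * K1 * K2 powr (1 / p)) * ((ennreal (C powr (- e)) * m y (2 * \<rho>) epowr e) * N epowr (1 / p))"
        by (intro mult_left_mono mult_right_mono me) auto
      also have "\<dots> = ennreal a * G f \<rho> 1 y"
        unfolding G1 a_def using Z K by (simp add: ennreal_mult mult_ac)
      also have "ennreal a = ennreal (a / \<tau>) * ennreal \<tau>"
        using a \<tau> by (simp flip: ennreal_mult)
      also have "ennreal (a / \<tau>) * ennreal \<tau> * G f \<rho> 1 y = ennreal (a / \<tau>) * (ennreal (\<tau> ^ 1) * G f \<rho> 1 y)"
        by (simp only: mult.assoc power_one_right)
      also have "\<dots> \<le> ennreal (a / \<tau>) * ?S"
        by (intro mult_left_mono member_le_suminf_ennreal) auto
      finally show "ennreal (2 * Z * K1 * K2 powr (1 / p)) * (m y \<rho> epowr e * N epowr (1 / p)) \<le> ennreal (a / \<tau>) * ?S" .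
      show "ennreal (2 * Z) * (m y \<rho> epowr \<kappa>' * A) \<le> ennreal (2 * Z) * (ennreal b1 * ?S)"
        by (intro mult_left_mono mA) auto
    qed
    also have "\<dots> = ennreal (a / \<tau> + 2 * Z * b1) * ?S"
      using a \<tau> Z b1 by (simp add: distrib_right ennreal_mult mult.assoc)
    also have "\<dots> \<le> ennreal b * ?S"
      using b1 by (intro mult_right_mono ennreal_leI) (auto simp: b_def)
    also have "\<dots> = (\<Sum>k. ennreal (b * \<tau> ^ k) * G f \<rho> k y)"
      using b by (intro series) simp
    finally show "m y \<rho> epowr e * weak_Lp_norm p (wmeasure w) (\<lambda>x. ?T x * indicator (ball y \<rho>) x)
      \<le> (\<Sum>k. ennreal (b * \<tau> ^ k) * G f \<rho> k y)" .
  qed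
qed

text \<open>The sum is 1/\<alpha> - 1/s. Its positivity turns reverse doubling into geometric
  decay.\<close>

lemma amalgam_exp_pos:
  assumes "0 < \<alpha>" "ennreal \<alpha> < s"
  shows "0 < amalgam_exp p s \<alpha> + 1 / p"
proof (cases "s = \<infinity>")
  case False
  then obtain u where u: "s = ennreal u" "0 \<le> u" by (cases s) auto
  with assms have "\<alpha> < u" by (simp add: ennreal_less_iff)
  with assms u show ?thesis
    by (simp add: amalgam_exp_def inverse_ennreal inverse_eq_divide frac_less2)
qed (use assms in \<open>simp add: amalgam_exp_def\<close>)

lemma amalgam_exp_nonpos:
  assumes "0 < p" "p \<le> \<alpha>"
  shows "amalgam_exp p s \<alpha> \<le> 0"
  using assms frac_le[of 1 1 p \<alpha>] enn2real_nonneg[of "inverse s"]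
  unfolding amalgam_exp_def by linarith

text \<open>All balls have w-measure 0, so the power in front may be \<infinity>; it is multiplied
  by a weak norm equal to 0, and the product is 0.\<close>

lemma weak_amalgam_norm_null_weight:
  assumes w: "weight w" "null_weight w" and s: "1 < s" and p: "0 < p"
  shows "weak_amalgam_norm p s \<alpha> w \<mu> h = 0"
proof -
  note [measurable] = weight_measurable[OF w(1)]
  have null: "emeasure (wmeasure w) A = 0" for A
  proof (cases "A \<in> sets lebesgue")
    case True
    have "AE x in lebesgue. ennreal (w x) * indicator A x = 0"
      using w(2) unfolding null_weight_def by eventually_elim simp
    with True show ?thesis
      by (subst emeasure_wmeasure[OF w(1) True]) (simp add: nn_integral_0_iff_AE)
  qed (simp add: emeasure_notin_sets)
  \<comment> \<open>Comparison with the zero series treats finite and infinite s at once.\<close>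
  have "Lp_norm s (wmeasure \<mu>) (\<lambda>y. 0) \<le> (\<Sum>k::nat. 0) * Lp_norm s (wmeasure \<mu>) (\<lambda>y. 0)"
    by (rule Lp_norm_series_le[OF s, where G="\<lambda>k y. 0"]) auto
  then have "Lp_norm s (wmeasure \<mu>) (\<lambda>y. 0 :: ennreal) = 0" by simp
  then show ?thesis
    using p by (simp add: weak_amalgam_norm_def weak_Lp_norm_def null)
qed

theorem theorem6p3:
  fixes \<gamma> p \<alpha> :: real and s :: ennreal and \<mu> w \<nu> :: "real ^ 'n \<Rightarrow> real"
  assumes "0 < \<gamma>" and "\<gamma> < real CARD('n)"
    and "1 < p" and "p \<le> \<alpha>" and "ennreal \<alpha> < s"
    and "Delta2 \<mu>"
    and "weight w" and "weight \<nu>"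
    and "\<exists>r>1. \<exists>C0::real. \<forall>a l. 0 < l \<longrightarrow>
           emeasure lebesgue (cube a l) epowr (\<gamma> / real CARD('n))
           * avg (cube a l) (\<lambda>x. ennreal (w x) epowr r) epowr (1 / (r * p))
           * avg (cube a l) (\<lambda>x. ennreal (\<nu> x) epowr (- conj_exp p / p)) epowr (1 / conj_exp p)
           \<le> ennreal C0"
    and "Delta2 w"
  shows "\<exists>C::real. C > 0 \<and> (\<forall>f \<in> amalgam_space p s \<alpha> \<nu> w \<mu>.
           (\<not> null_weight w \<and> \<not> null_weight \<mu> \<longrightarrow>
              (AE x in lebesgue. integrable lebesgue (riesz_integrand \<gamma> f x))) \<and>
           frac_integral \<gamma> f \<in> weak_amalgam_space p s \<alpha> w \<mu> \<and>
           weak_amalgam_norm p s \<alpha> w \<mu> (frac_integral \<gamma> f)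
             \<le> ennreal C * amalgam_norm p s \<alpha> \<nu> w \<mu> f)"
proof -
  note p = \<open>1 < p\<close> and w = \<open>weight w\<close> and \<nu> = \<open>weight \<nu>\<close>
  have p0: "0 < p" and \<alpha>: "0 < \<alpha>" using p \<open>p \<le> \<alpha>\<close> by auto
  have "ennreal 1 < ennreal \<alpha>" using p \<open>p \<le> \<alpha>\<close> \<alpha> by (subst ennreal_less_iff) auto
  from less_trans[OF this \<open>ennreal \<alpha> < s\<close>] have s: "1 < s" by simp
  have meas: "f \<in> borel_measurable lebesgue" if "f \<in> amalgam_space p s \<alpha> \<nu> w \<mu>" for f
    using that by (simp add: amalgam_space_def locally_integrable_measurable)
  have in_space: "frac_integral \<gamma> f \<in> weak_amalgam_space p s \<alpha> w \<mu>"
    if f: "f \<in> amalgam_space p s \<alpha> \<nu> w \<mu>"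
      and le: "weak_amalgam_norm p s \<alpha> w \<mu> (frac_integral \<gamma> f) \<le> ennreal C * amalgam_norm p s \<alpha> \<nu> w \<mu> f" for f C
  proof -
    have "ennreal C * amalgam_norm p s \<alpha> \<nu> w \<mu> f < \<infinity>"
      using f by (simp add: amalgam_space_def ennreal_mult_less_top)
    with le have "weak_amalgam_norm p s \<alpha> w \<mu> (frac_integral \<gamma> f) < \<infinity>" by (rule le_less_trans)
    then show ?thesis
      using measurable_frac_integral[OF meas[OF f]] by (simp add: weak_amalgam_space_def)
  qed
  show ?thesis
  proof (cases "null_weight w")
    \<comment> \<open>Balls of positive w-measure, on which the estimates rest, do not exist here.
      The weak norm is 0 and the convergence claim is vacuous.\<close>
    case True
    then have bound: "weak_amalgam_norm p s \<alpha> w \<mu> (frac_integral \<gamma> f) \<le> ennreal 1 * amalgam_norm p s \<alpha> \<nu> w \<mu> f" for f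
      using weak_amalgam_norm_null_weight[OF w _ s p0] by simp
    show ?thesis
      using True bound in_space[OF _ bound] by (intro exI[of _ 1] conjI ballI) simp_all
  next
    case False
    obtain r C0 where r: "1 < r" and bump: "\<And>a l. 0 < l \<Longrightarrow>
           emeasure lebesgue (cube a l) epowr (\<gamma> / real CARD('n))
           * avg (cube a l) (\<lambda>x. ennreal (w x) epowr r) epowr (1 / (r * p))
           * avg (cube a l) (\<lambda>x. ennreal (\<nu> x) epowr (- conj_exp p / p)) epowr (1 / conj_exp p)
           \<le> ennreal C0"
      using assms(9) by auto
    interpret bump_pair \<gamma> p r C0 w \<nu>
      by unfold_locales (use assms(1,2) p w \<nu> r bump in auto)
    define e where "e = amalgam_exp p s \<alpha>"
    define G where "G f \<rho> k y = emeasure (wmeasure w) (ball y (2 ^ k * \<rho>)) epowr e *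
        Lp_norm (ennreal p) (wmeasure \<nu>) (\<lambda>x. ennreal (norm (f x * indicator (ball y (2 ^ k * \<rho>)) x)))"
      for f :: "real ^ 'n \<Rightarrow> complex" and \<rho> :: real and k :: nat and y
    have e: "e \<le> 0" "0 < e + 1 / p"
      unfolding e_def using amalgam_exp_nonpos[OF p0 \<open>p \<le> \<alpha>\<close>] amalgam_exp_pos[OF \<alpha> \<open>ennreal \<alpha> < s\<close>] by auto
    obtain b \<tau> :: real where b: "0 < b" and \<tau>: "0 < \<tau>" "\<tau> < 1"
      and far: "\<And>f \<rho> y x. f \<in> borel_measurable lebesgue \<Longrightarrow> 0 < \<rho> \<Longrightarrow> x \<in> ball y \<rho> \<Longrightarrow>
        emeasure (wmeasure w) (ball y \<rho>) epowr (e + 1 / p) *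
          (\<integral>\<^sup>+z\<in>- ball y (2 * \<rho>). ennreal (norm (f z)) * riesz_kernel \<gamma> (x - z) \<partial>lebesgue)
        \<le> (\<Sum>k. ennreal (b * \<tau> ^ k) * G f \<rho> k y)"
      and weak: "\<And>f \<rho> y. f \<in> borel_measurable lebesgue \<Longrightarrow> 0 < \<rho> \<Longrightarrow>
        emeasure (wmeasure w) (ball y \<rho>) epowr e *
          weak_Lp_norm p (wmeasure w) (\<lambda>x. frac_integral \<gamma> f x * indicator (ball y \<rho>) x)
        \<le> (\<Sum>k. ennreal (b * \<tau> ^ k) * G f \<rho> k y)"
      by (rule amalgam_pointwise_estimate[OF \<open>Delta2 w\<close> False e, folded G_def])
        (rule that, assumption, assumption, assumption, assumption, assumption)
    define C where "C = b * (1 / (1 - \<tau>))"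
    have C: "0 < C" using b \<tau> by (simp add: C_def)
    have sum_C: "(\<Sum>k. ennreal (b * \<tau> ^ k)) = ennreal C"
      unfolding C_def
    proof (rule suminf_ennreal_eq)
      show "(\<lambda>k. b * \<tau> ^ k) sums (b * (1 / (1 - \<tau>)))"
        using \<tau> by (intro sums_mult geometric_sums) simp
    qed (use b \<tau> in simp)
    have m_meas: "(\<lambda>y. emeasure (wmeasure w) (ball y \<rho>) epowr a) \<in> borel_measurable lebesgue" for \<rho> a
      using measurable_epowr[OF measurable_emeasure_ball[OF w, of UNIV \<rho>], of a]
        sets.top[of "lebesgue :: (real ^ 'n) measure"] by simp
    have G_meas: "G f \<rho> k \<in> borel_measurable (wmeasure \<mu>)" if f: "f \<in> borel_measurable lebesgue" for f \<rho> k
    proof -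
      have "(\<lambda>x. ennreal (norm (f x)) epowr p * ennreal (\<nu> x)) \<in> borel_measurable lebesgue"
        using f by measurable
      then have "(\<lambda>y. (\<integral>\<^sup>+x\<in>ball y (2 ^ k * \<rho>). ennreal (norm (f x)) epowr p * ennreal (\<nu> x) \<partial>lebesgue) epowr (1 / p))
          \<in> borel_measurable lebesgue"
        by (intro measurable_epowr measurable_ball_integral)
      then have "(\<lambda>y. G f \<rho> k y) \<in> borel_measurable lebesgue"
        unfolding G_def by (intro borel_measurable_times_ennreal m_meas) (simp add: Lp_norm_restrict[OF p0 \<nu> f])
      then show ?thesis by (simp add: measurable_cong_sets[OF sets_wmeasure refl])
    qed
    \<comment> \<open>The left side is the amalgam expression at radius 2^k \<rho>, one competitor
      in the supremum over all radii.\<close>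
    have G_le: "Lp_norm s (wmeasure \<mu>) (G f \<rho> k) \<le> amalgam_norm p s \<alpha> \<nu> w \<mu> f" if "0 < \<rho>" for f \<rho> k
      unfolding amalgam_norm_def G_def[abs_def] e_def using that by (intro SUP_upper) simp
    have bound: "weak_amalgam_norm p s \<alpha> w \<mu> (frac_integral \<gamma> f) \<le> ennreal C * amalgam_norm p s \<alpha> \<nu> w \<mu> f"
      if "f \<in> amalgam_space p s \<alpha> \<nu> w \<mu>" for f
      unfolding weak_amalgam_norm_def e_def[symmetric] sum_C[symmetric]
    proof (rule SUP_least)
      fix \<rho> :: real assume "\<rho> \<in> {0<..}"
      then have \<rho>: "0 < \<rho>" by simp
      have f: "f \<in> borel_measurable lebesgue" using that by (rule meas)
      have F_meas: "(\<lambda>y. emeasure (wmeasure w) (ball y \<rho>) epowr e *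
          weak_Lp_norm p (wmeasure w) (\<lambda>x. frac_integral \<gamma> f x * indicator (ball y \<rho>) x)) \<in> borel_measurable (wmeasure \<mu>)"
        unfolding measurable_cong_sets[OF sets_wmeasure refl]
        by (intro borel_measurable_times_ennreal m_meas measurable_weak_Lp_norm_ball w measurable_frac_integral f p0)
      show "Lp_norm s (wmeasure \<mu>) (\<lambda>y. emeasure (wmeasure w) (ball y \<rho>) epowr e *
          weak_Lp_norm p (wmeasure w) (\<lambda>x. frac_integral \<gamma> f x * indicator (ball y \<rho>) x))
        \<le> (\<Sum>k. ennreal (b * \<tau> ^ k)) * amalgam_norm p s \<alpha> \<nu> w \<mu> f"
        by (rule Lp_norm_series_le[OF s F_meas G_meas[OF f] weak[OF f \<rho>] G_le[OF \<rho>]])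
    qed
    \<comment> \<open>A single center y with finite majorants for all radii n + 1 is enough. The
      balls B(y,n+1) exhaust the space; on each of them the far part is finite by the first
      pointwise bound and the near part is finite almost everywhere by Tonelli.\<close>
    have integrable: "AE x in lebesgue. integrable lebesgue (riesz_integrand \<gamma> f x)"
      if fs: "f \<in> amalgam_space p s \<alpha> \<nu> w \<mu>" and \<mu>: "\<not> null_weight \<mu>" for f
    proof -
      have f: "f \<in> borel_measurable lebesgue" using fs by (rule meas)
      define h where "h z = ennreal (norm (f z))" for z
      have h: "h \<in> borel_measurable lebesgue" unfolding h_def[abs_def] using f by measurable
      define \<rho> where "\<rho> n = real (Suc n)" for n
      have \<rho>: "0 < \<rho> n" for n by (simp add: \<rho>_def)
      define S where "S n y = (\<Sum>k. ennreal (b * \<tau> ^ k) * G f (\<rho> n) k y)" for n y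
      have S_meas: "S n \<in> borel_measurable (wmeasure \<mu>)" for n
        unfolding S_def[abs_def] using G_meas[OF f] by measurable
      have "AE y in wmeasure \<mu>. \<forall>n. S n y < \<infinity>"
        unfolding AE_all_countable
      proof
        fix n
        have "Lp_norm s (wmeasure \<mu>) (S n) \<le> (\<Sum>k. ennreal (b * \<tau> ^ k)) * amalgam_norm p s \<alpha> \<nu> w \<mu> f"
          by (rule Lp_norm_series_le[OF s S_meas, where G="G f (\<rho> n)"])
            (simp_all add: S_def G_meas[OF f] G_le[OF \<rho>])
        also have "\<dots> < \<infinity>"
          using fs by (simp add: sum_C amalgam_space_def ennreal_mult_less_top)
        finally show "AE y in wmeasure \<mu>. S n y < \<infinity>"
          by (rule Lp_norm_finite_AE[OF s S_meas])
      qed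
      \<comment> \<open>As \<mu> does not vanish almost everywhere, a property valid \<mu>-almost
        everywhere holds at some point; this produces the center.\<close>
      moreover have "\<not> (AE y in wmeasure \<mu>. False)"
      proof
        assume "AE y in wmeasure \<mu>. False"
        moreover have \<mu>': "weight \<mu>" using \<open>Delta2 \<mu>\<close> by (simp add: Delta2_def)
        then have "(\<lambda>x. ennreal (\<mu> x)) \<in> borel_measurable lebesgue"
          using weight_measurable[of \<mu>] by measurable
        ultimately have "AE y in lebesgue. \<not> 0 < ennreal (\<mu> y)"
          unfolding wmeasure_def by (simp add: AE_density)
        then have "AE y in lebesgue. \<mu> y = 0"
          using \<mu>' by (auto simp: weight_def intro: antisym elim!: eventually_mono)
        with \<mu> show False by (simp add: null_weight_def)
      qed
      ultimately obtain y where y: "\<And>n. S n y < \<infinity>"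
        by (metis (mono_tags, lifting) eventually_mono)
      have rest: "(\<integral>\<^sup>+z\<in>- ball y (2 * \<rho> n). h z * riesz_kernel \<gamma> (x - z) \<partial>lebesgue) < \<infinity>"
        if "x \<in> ball y (\<rho> n)" for x n
      proof -
        define m where "m = emeasure (wmeasure w) (ball y (\<rho> n)) epowr (e + 1 / p)"
        have "m \<noteq> 0"
          unfolding m_def using Delta2_ball_pos[OF \<open>Delta2 w\<close> False \<rho>] e by (simp add: epowr_eq_0_iff)
        moreover have "m * (\<integral>\<^sup>+z\<in>- ball y (2 * \<rho> n). h z * riesz_kernel \<gamma> (x - z) \<partial>lebesgue) < \<infinity>"
          using far[OF f \<rho> that] y[of n] unfolding m_def h_def S_def by (rule le_less_trans)
        ultimately show ?thesis by (auto simp: ennreal_mult_less_top)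
      qed
      define g where "g n z = h z * indicator (ball y (2 * \<rho> n)) z" for n z
      have g: "g n \<in> borel_measurable lebesgue" for n
        unfolding g_def[abs_def] by (intro borel_measurable_times_ennreal h borel_measurable_indicator) auto
      have "(\<integral>\<^sup>+z. g n z \<partial>lebesgue) < \<infinity>" for n
        using locally_integrable_nn_integral_finite[of f y "2 * \<rho> n"] fs
        by (simp add: g_def h_def amalgam_space_def)
      then have "AE x in lebesgue. \<forall>n. (\<integral>\<^sup>+z\<in>ball x (3 * \<rho> n). g n z * riesz_kernel \<gamma> (x - z) \<partial>lebesgue) < \<infinity>"
        unfolding AE_all_countable using \<rho>
        by (intro allI riesz_near_finite_AE assms(1,2) g) auto
      then show ?thesis
      proof eventually_elim
        case (elim x)
        obtain n where "dist y x < real n" using reals_Archimedean2 by blast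
        then have x: "x \<in> ball y (\<rho> n)" by (simp add: \<rho>_def)
        have "(\<integral>\<^sup>+z. h z * riesz_kernel \<gamma> (x - z) \<partial>lebesgue)
            \<le> (\<integral>\<^sup>+z. g n z * riesz_kernel \<gamma> (x - z) * indicator (ball x (3 * \<rho> n)) z
              + h z * riesz_kernel \<gamma> (x - z) * indicator (- ball y (2 * \<rho> n)) z \<partial>lebesgue)"
        proof (intro nn_integral_mono)
          fix z
          show "h z * riesz_kernel \<gamma> (x - z) \<le> g n z * riesz_kernel \<gamma> (x - z) * indicator (ball x (3 * \<rho> n)) z
              + h z * riesz_kernel \<gamma> (x - z) * indicator (- ball y (2 * \<rho> n)) z"
          proof (cases "z \<in> ball y (2 * \<rho> n)")
            case True
            then have "z \<in> ball x (3 * \<rho> n)" using x dist_triangle[of x z y] by (auto simp: dist_commute)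
            with True show ?thesis by (simp add: g_def)
          qed simp
        qed
        also have "\<dots> = (\<integral>\<^sup>+z\<in>ball x (3 * \<rho> n). g n z * riesz_kernel \<gamma> (x - z) \<partial>lebesgue)
            + (\<integral>\<^sup>+z\<in>- ball y (2 * \<rho> n). h z * riesz_kernel \<gamma> (x - z) \<partial>lebesgue)"
        proof -
          have "(\<lambda>z. riesz_kernel \<gamma> (x - z)) \<in> borel_measurable lebesgue"
            by (intro measurable_completion) measurable
          then show ?thesis
            by (intro nn_integral_add borel_measurable_times_ennreal h g borel_measurable_indicator) auto
        qed
        also have "\<dots> < \<infinity>" using elim rest[OF x] by simp
        also have "(\<integral>\<^sup>+z. h z * riesz_kernel \<gamma> (x - z) \<partial>lebesgue)
            = (\<integral>\<^sup>+z. ennreal (norm (riesz_integrand \<gamma> f x z)) \<partial>lebesgue)"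
          by (intro nn_integral_cong)
            (simp add: h_def riesz_integrand_def riesz_kernel_def norm_divide flip: ennreal_mult)
        finally show "integrable lebesgue (riesz_integrand \<gamma> f x)"
          using measurable_riesz_integrand[OF f, of \<gamma> x] by (intro integrableI_bounded) auto
      qed
    qed
    show ?thesis
      using C integrable in_space bound by (intro exI[of _ C]) blast
  qed
qed

end
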